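(* There exists a randomized algorithm with the following property. For every constant $\gamma\in(0,1/2)$ and every $\beta>0$, when the input $q$ is generated by the noisy sorting model with parameter $\gamma$, the algorithm outputs an optimal ranking for $q$ (a ranking maximizing the score $s_q$), runs in time $n^{O((\beta+1)\gamma^{-4})}$, and fails to do so with probability at most $n^{-\beta}$. Here the probability is over both the noise in $q$ and the internal randomness of the algorithm.
   Context: Noisy sorting without resampling (NSWR). There are $n$ items $a_1,\dots,a_n$. There is an unknown true order given by a permutation $\pi$ of $\{1,\dots,n\}$, where $a_i<a_j$ in the true order iff $\pi(i)<\pi(j)$. For every pair $i\neq j$ there is a comparison outcome $q(a_i,a_j)\in\{+1,-1\}$ with $q(a_j,a_i)=-q(a_i,a_j)$. If $\pi(i)>\pi(j)$ then $\Pr[q(a_i,a_j)=+1]\ge \tfrac12+\gamma$, where $0<\gamma<1/2$ is a constant. The outcomes for distinct unordered pairs are independent conditioned on $\pi$. A ranking is a permutation $\sigma$ of $\{1,\dots,n\}$, with $\sigma(i)$ the position assigned to $a_i$. Its score is $s_q(\sigma)=\sum_{(i,j):\,\sigma(i)>\sigma(j)} q(a_i,a_j)$: each pair contributes $+1$ if the ranking agrees with the comparison outcome and $-1$ otherwise. A ranking is optimal for $q$ if it maximizes $s_q$ over all rankings. The NSWR problem is to find an optimal ranking given $q$. *)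

theory Defs
  imports "HOL-Probability.Probability" "HOL-Combinatorics.Permutations"
begin

section \<open>Randomized algorithms\<close>

text \<open>
  The model of computation is the WHILE language of Jones (\<^emph>\<open>Computability and Complexity from a
  Programming Perspective\<close>) extended with fair coin tosses. Data are S-expressions over a single
  atom; there is neither arithmetic nor an equality test. Every elementary command costs one step.
  This is polynomially equivalent to probabilistic Turing machines: a fixed program evaluates
  expressions of bounded size, and as data are immutable, structures built by repeated sharing
  are represented in space linear in the number of steps plus the size of the input.
\<close>

datatype sexp = Atom | Cell sexp sexp

type_synonym store = "nat \<Rightarrow> sexp"

datatype exp = Var nat | Nil_exp | Cons_exp exp exp | Car exp | Cdr exp

primrec car :: "sexp \<Rightarrow> sexp" where
  "car Atom = Atom"
| "car (Cell a b) = a"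

primrec cdr :: "sexp \<Rightarrow> sexp" where
  "cdr Atom = Atom"
| "cdr (Cell a b) = b"

primrec eval_exp :: "exp \<Rightarrow> store \<Rightarrow> sexp" where
  "eval_exp (Var x) s = s x"
| "eval_exp Nil_exp s = Atom"
| "eval_exp (Cons_exp e f) s = Cell (eval_exp e s) (eval_exp f s)"
| "eval_exp (Car e) s = car (eval_exp e s)"
| "eval_exp (Cdr e) s = cdr (eval_exp e s)"

datatype com =
    Skip
  | Assign nat exp
  | Flip nat
  | Seq com com
  | Branch exp com com
  | While exp com

type_synonym config = "com \<times> store"

definition bit_sexp :: "bool \<Rightarrow> sexp" where
  "bit_sexp b = (if b then Cell Atom Atom else Atom)"

text \<open>The configurations with command \<open>Skip\<close> are the halted ones; they are absorbing.\<close>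

primrec step :: "com \<Rightarrow> store \<Rightarrow> config pmf" where
  "step Skip s = return_pmf (Skip, s)"
| "step (Assign x e) s = return_pmf (Skip, s(x := eval_exp e s))"
| "step (Flip x) s = map_pmf (\<lambda>b. (Skip, s(x := bit_sexp b))) (bernoulli_pmf (1/2))"
| "step (Seq c d) s =
     (if c = Skip then return_pmf (d, s)
      else map_pmf (\<lambda>(c', s'). (Seq c' d, s')) (step c s))"
| "step (Branch e c d) s = return_pmf (if eval_exp e s \<noteq> Atom then c else d, s)"
| "step (While e c) s =
     return_pmf (if eval_exp e s \<noteq> Atom then Seq c (While e c) else Skip, s)"

primrec steps :: "nat \<Rightarrow> config \<Rightarrow> config pmf" where
  "steps 0 cfg = return_pmf cfg"
| "steps (Suc t) cfg = bind_pmf (step (fst cfg) (snd cfg)) (steps t)"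

text \<open>The input is placed in variable 0, which also holds the output upon halting.\<close>

definition initial :: "com \<Rightarrow> sexp \<Rightarrow> config" where
  "initial P x = (P, (\<lambda>_. Atom)(0 := x))"

definition halts_with :: "config \<Rightarrow> sexp \<Rightarrow> bool" where
  "halts_with cfg y \<longleftrightarrow> fst cfg = Skip \<and> snd cfg 0 = y"

definition list_sexp :: "sexp list \<Rightarrow> sexp" where
  "list_sexp xs = foldr Cell xs Atom"

definition nat_sexp :: "nat \<Rightarrow> sexp" where
  "nat_sexp k = list_sexp (replicate k Atom)"


section \<open>Noisy sorting without resampling\<close>

text \<open>Outcomes are functions \<open>q\<close> on indices, with \<open>q i j\<close> for the comparison of items \<open>i\<close> and \<open>j\<close>;
  values at \<open>i = j\<close> or outside \<open>{1..n}\<close> are irrelevant.\<close>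

type_synonym outcome = "nat \<Rightarrow> nat \<Rightarrow> int"

definition comparison_outcome :: "nat \<Rightarrow> outcome \<Rightarrow> bool" where
  "comparison_outcome n q \<longleftrightarrow>
     (\<forall>i\<in>{1..n}. \<forall>j\<in>{1..n}. i \<noteq> j \<longrightarrow> q i j \<in> {1, -1} \<and> q j i = - q i j)"

text \<open>\<open>D\<close> is the law of the outcomes conditioned on the true order \<open>\<pi>\<close>. The success
  probabilities may differ from pair to pair.\<close>

definition noisy_sorting_model ::
    "nat \<Rightarrow> real \<Rightarrow> (nat \<Rightarrow> nat) \<Rightarrow> outcome pmf \<Rightarrow> bool" where
  "noisy_sorting_model n \<gamma> \<pi> D \<longleftrightarrow>
     (\<forall>q\<in>set_pmf D. comparison_outcome n q) \<and>
     (\<forall>i\<in>{1..n}. \<forall>j\<in>{1..n}. \<pi> i > \<pi> j \<longrightarrow>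
        measure_pmf.prob D {q. q i j = 1} \<ge> 1/2 + \<gamma>) \<and>
     prob_space.indep_vars (measure_pmf D) (\<lambda>_. count_space UNIV) (\<lambda>(i, j) q. q i j)
       {(i, j). 1 \<le> i \<and> i < j \<and> j \<le> n}"

definition score :: "nat \<Rightarrow> outcome \<Rightarrow> (nat \<Rightarrow> nat) \<Rightarrow> int" where
  "score n q \<sigma> = (\<Sum>(i, j) \<in> {(i, j) \<in> {1..n} \<times> {1..n}. \<sigma> i > \<sigma> j}. q i j)"

definition optimal_ranking :: "nat \<Rightarrow> outcome \<Rightarrow> (nat \<Rightarrow> nat) \<Rightarrow> bool" where
  "optimal_ranking n q \<sigma> \<longleftrightarrow> is_arg_max (score n q) (\<lambda>\<tau>. \<tau> permutes {1..n}) \<sigma>"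

definition outcome_sexp :: "nat \<Rightarrow> outcome \<Rightarrow> sexp" where
  "outcome_sexp n q =
     list_sexp (map (\<lambda>i. list_sexp (map (\<lambda>j. bit_sexp (i \<noteq> j \<and> q i j = 1)) [1..<Suc n])) [1..<Suc n])"

definition ranking_sexp :: "nat \<Rightarrow> (nat \<Rightarrow> nat) \<Rightarrow> sexp" where
  "ranking_sexp n \<sigma> = list_sexp (map (\<lambda>i. nat_sexp (\<sigma> i)) [1..<Suc n])"

text \<open>Besides \<open>q\<close>, the algorithm is told the parameters of the problem. As a program cannot read
  a real number, it gets only the integers \<open>\<lceil>1/\<gamma>\<rceil>\<close> and \<open>\<lceil>\<beta>\<rceil>\<close>. Unary notation is harmless, since
  running times are measured in \<open>n\<close> and not in the length of the input.\<close>

definition nswr_input :: "real \<Rightarrow> real \<Rightarrow> nat \<Rightarrow> outcome \<Rightarrow> sexp" where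
  "nswr_input \<gamma> \<beta> n q =
     list_sexp [nat_sexp (nat \<lceil>1 / \<gamma>\<rceil>), nat_sexp (nat \<lceil>\<beta>\<rceil>), nat_sexp n, outcome_sexp n q]"

text \<open>The joint law of the outcomes \<open>q \<sim> D\<close> and of the configuration reached by \<open>P\<close> from
  input \<open>q\<close> after \<open>t\<close> steps, with coin tosses independent of the noise.\<close>

definition nswr_run ::
    "com \<Rightarrow> nat \<Rightarrow> real \<Rightarrow> real \<Rightarrow> nat \<Rightarrow> outcome pmf \<Rightarrow> (outcome \<times> config) pmf" where
  "nswr_run P t \<gamma> \<beta> n D =
     bind_pmf D (\<lambda>q. map_pmf (\<lambda>cfg. (q, cfg)) (steps t (initial P (nswr_input \<gamma> \<beta> n q))))"

text \<open>As halted configurations are absorbing, this says of the configuration after \<open>t\<close> steps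
  that the program has halted within \<open>t\<close> steps and its output is an optimal ranking.\<close>

definition solves_nswr :: "nat \<Rightarrow> outcome \<Rightarrow> config \<Rightarrow> bool" where
  "solves_nswr n q cfg \<longleftrightarrow> (\<exists>\<sigma>. optimal_ranking n q \<sigma> \<and> halts_with cfg (ranking_sexp n \<sigma>))"

end

theory Submission
  imports Defs
begin

text \<open>
  With high probability, optimal orders are close to the true order. First, if a list of \<open>s\<close> items has
  at least \<open>K s\<close> inverted pairs, where \<open>K\<close> is of order \<open>(\<beta> + 1) \<gamma>\<^sup>-\<^sup>2 log n\<close>, then most outcomes on these
  pairs are correct: there are only \<open>n\<^sup>s\<close> such lists, and each is bad with probability at most
  \<open>exp (- \<gamma>\<^sup>2 K s / 2)\<close> by Hoeffding's inequality. Sorting a block of an optimal order correctly does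
  not improve the score, so every block of \<open>s\<close> consecutive items has fewer than \<open>K s\<close> inversions.
  Now let \<open>W\<close> be the maximal displacement, attained at \<open>x\<close>. At each of the two cuts given by the actual
  and by the correct position of \<open>x\<close>, the \<open>a\<close> items on the wrong left side and the \<open>a\<close> items on the wrong
  right side are pairwise inverted and lie in a block of length at most \<open>4 W\<close>; hence \<open>a\<^sup>2 < 4 K W\<close>.
  So apart from fewer than \<open>4 sqrt (K W)\<close> items, the items which \<open>x\<close> jumped over
  are the \<open>W\<close> items next to \<open>x\<close> in the true order, against which \<open>x\<close> has a surplus of at least
  \<open>\<gamma> W\<close> correct outcomes. If \<open>W\<close> is at least \<open>64 K / \<gamma>\<^sup>2\<close>, then moving \<open>x\<close> back improves the score.

  The algorithm is deterministic. It inserts the items one by one and maintains an optimal order. As the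
  old and the new optimal order are both close to the true order, the set of the first \<open>m\<close> items of the
  new order is known up to a window of length \<open>O(W)\<close>, so a dynamic program over the \<open>2\<^sup>O\<^sup>(\<^sup>W\<^sup>)\<close> candidates
  for these sets finds the new order.

  Running times are controlled by a calculus of functions that are computable in time and with output
  size polynomial in the input size plus a potential. The table of all \<open>2\<^sup>O\<^sup>(\<^sup>W\<^sup>)\<close> bit vectors is the only
  large object; once it has been computed, everything else is polynomial in its size.
\<close>

section \<open>Deterministic execution\<close>

text \<open>A bind is deterministic iff every value in the support of the first distribution leads
  to the same point mass. This lets the inductions on runs treat coin tosses like any other
  step.\<close>

lemma bind_pmf_eq_return_pmf_iff:
  "bind_pmf M f = return_pmf x \<longleftrightarrow> (\<forall>m\<in>set_pmf M. f m = return_pmf x)"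
  unfolding set_pmf_subset_singleton[symmetric]
  by (auto simp: set_bind_pmf UN_subset_iff)

lemma steps_Skip: "steps t (Skip, s) = return_pmf (Skip, s)"
  by (induction t) (simp_all add: bind_return_pmf)

lemma steps_mono:
  assumes "steps t cfg = return_pmf (Skip, s')" "t \<le> u"
  shows "steps u cfg = return_pmf (Skip, s')"
  using assms
proof (induction t arbitrary: u cfg)
  case 0
  then show ?case by (simp add: steps_Skip)
next
  case (Suc t)
  then obtain v where u: "u = Suc v" by (cases u) auto
  with Suc show ?case by (auto simp: bind_pmf_eq_return_pmf_iff)
qed

text \<open>The additional step in \<open>Suc u\<close> is the one that passes from
  \<open>Seq Skip d\<close> to \<open>d\<close>.\<close>

lemma steps_Seq:
  assumes "steps t (c, s) = return_pmf (Skip, s')" "steps u (d, s') = return_pmf (Skip, s'')"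
  shows "steps (t + Suc u) (Seq c d, s) = return_pmf (Skip, s'')"
  using assms
proof (induction t arbitrary: c s)
  case 0
  then show ?case by (simp add: bind_return_pmf)
next
  case (Suc t)
  show ?case
  proof (cases "c = Skip")
    case True
    with Suc.prems have "s' = s" using steps_Skip[of "Suc t" s] by simp
    moreover have "steps (t + Suc u) (d, s') = return_pmf (Skip, s'')"
      using Suc.prems(2) by (rule steps_mono) simp
    ultimately show ?thesis using True by (simp add: bind_return_pmf)
  next
    case False
    have "steps (t + Suc u) (Seq c' d, r) = return_pmf (Skip, s'')" if "(c', r) \<in> set_pmf (step c s)" for c' r
      using Suc.IH[of c' r] Suc.prems that by (fastforce simp: bind_pmf_eq_return_pmf_iff)
    then show ?thesis using False
      by (auto simp: bind_pmf_eq_return_pmf_iff)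
  qed
qed

text \<open>Programs use variable 0 for the current value and variable 1 as a stack of saved values.\<close>

definition exec :: "com \<Rightarrow> sexp \<Rightarrow> sexp \<Rightarrow> nat \<Rightarrow> sexp \<Rightarrow> sexp \<Rightarrow> bool" where
  "exec c x k t y l \<longleftrightarrow> (\<forall>s. s 0 = x \<and> s 1 = k \<longrightarrow>
     (\<exists>s'. steps t (c, s) = return_pmf (Skip, s') \<and> s' 0 = y \<and> s' 1 = l))"

lemma exec_mono: "exec c x k t y l \<Longrightarrow> t \<le> u \<Longrightarrow> exec c x k u y l"
  unfolding exec_def using steps_mono by blast

lemma exec_Seq:
  assumes "exec c x k t y l" "exec d y l u z m"
  shows "exec (Seq c d) x k (t + Suc u) z m"
  unfolding exec_def
proof (intro allI impI)
  fix s :: store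
  assume s: "s 0 = x \<and> s 1 = k"
  with assms(1) obtain s' where s': "steps t (c, s) = return_pmf (Skip, s')" "s' 0 = y" "s' 1 = l"
    unfolding exec_def by blast
  with assms(2) obtain s'' where "steps u (d, s') = return_pmf (Skip, s'')" "s'' 0 = z" "s'' 1 = m"
    unfolding exec_def by blast
  with s' show "\<exists>s''. steps (t + Suc u) (Seq c d, s) = return_pmf (Skip, s'') \<and> s'' 0 = z \<and> s'' 1 = m"
    using steps_Seq by blast
qed

text \<open>The constructed programs mention only variables 0 and 1, so evaluation can be described
  without a store. The value \<open>Atom\<close> for other variables is a dummy that
  \<open>vars01\<close> rules out.\<close>

primrec eval2 :: "exp \<Rightarrow> sexp \<Rightarrow> sexp \<Rightarrow> sexp" where
  "eval2 (Var v) x k = (if v = 0 then x else if v = 1 then k else Atom)"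
| "eval2 Nil_exp x k = Atom"
| "eval2 (Cons_exp e f) x k = Cell (eval2 e x k) (eval2 f x k)"
| "eval2 (Car e) x k = car (eval2 e x k)"
| "eval2 (Cdr e) x k = cdr (eval2 e x k)"

primrec vars01 :: "exp \<Rightarrow> bool" where
  "vars01 (Var v) = (v < 2)"
| "vars01 Nil_exp = True"
| "vars01 (Cons_exp e f) = (vars01 e \<and> vars01 f)"
| "vars01 (Car e) = vars01 e"
| "vars01 (Cdr e) = vars01 e"

lemma eval_exp_eval2: "vars01 e \<Longrightarrow> eval_exp e s = eval2 e (s 0) (s 1)"
proof (induction e)
  case (Var x)
  then have "x = 0 \<or> x = 1" by auto
  then show ?case by auto
qed auto

lemma exec_Assign0: "vars01 e \<Longrightarrow> exec (Assign 0 e) x k 1 (eval2 e x k) k"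
  and exec_Assign1: "vars01 e \<Longrightarrow> exec (Assign 1 e) x k 1 x (eval2 e x k)"
  by (auto simp: exec_def bind_return_pmf eval_exp_eval2)

lemma exec_Branch:
  assumes "vars01 e" "eval2 e x k \<noteq> Atom \<Longrightarrow> exec c x k t y l" "eval2 e x k = Atom \<Longrightarrow> exec d x k t y l"
  shows "exec (Branch e c d) x k (Suc t) y l"
  using assms by (auto simp: exec_def bind_return_pmf eval_exp_eval2)

lemma exec_While_False:
  assumes "vars01 e" "eval2 e x k = Atom"
  shows "exec (While e c) x k 1 x k"
  using assms by (auto simp: exec_def bind_return_pmf eval_exp_eval2)

lemma exec_While_True:
  assumes "vars01 e" "eval2 e x k \<noteq> Atom" "exec c x k t y l" "exec (While e c) y l u z m"
  shows "exec (While e c) x k (Suc (t + Suc u)) z m"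
  using exec_Seq[OF assms(3,4)] assms(1,2) by (auto simp: exec_def bind_return_pmf eval_exp_eval2)

section \<open>Encodings and polynomially bounded quantities\<close>

text \<open>Time bounds can thus be stated for functions on HOL types. Codes coincide across types:
  a number has the code of a list of units, and a nonempty list that of the pair of its head and
  tail, which makes these conversions free.\<close>

class enc =
  fixes enc :: "'a \<Rightarrow> sexp"

instantiation bool :: enc begin
definition enc_bool :: "bool \<Rightarrow> sexp" where "enc_bool = bit_sexp"
instance ..
end

instantiation nat :: enc begin
definition enc_nat :: "nat \<Rightarrow> sexp" where "enc_nat = nat_sexp"
instance ..
end

instantiation unit :: enc begin
definition enc_unit :: "unit \<Rightarrow> sexp" where "enc_unit u = Atom"
instance ..
end

instantiation prod :: (enc, enc) enc begin
definition enc_prod :: "'a \<times> 'b \<Rightarrow> sexp" where "enc_prod p = Cell (enc (fst p)) (enc (snd p))"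
instance ..
end

instantiation list :: (enc) enc begin
definition enc_list :: "'a list \<Rightarrow> sexp" where "enc_list xs = list_sexp (map enc xs)"
instance ..
end

lemma enc_simps [simp]:
  "enc True = Cell Atom Atom" "enc False = Atom" "enc (a, b) = Cell (enc a) (enc b)"
  "enc ([] :: 'a::enc list) = Atom" "enc (x # xs) = Cell (enc x) (enc (xs :: 'a list))"
  "enc (0 :: nat) = Atom" "enc (Suc n) = Cell Atom (enc n)" "enc () = Atom"
  by (simp_all add: enc_bool_def enc_prod_def enc_list_def enc_nat_def enc_unit_def bit_sexp_def
      list_sexp_def nat_sexp_def)

text \<open>This is the number of \<open>Cell\<close>s in the unfolded tree, so shared parts count
  every time they occur. A number has its own value as size.\<close>

definition sz :: "'a::enc \<Rightarrow> nat" where "sz x = size (enc x)"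

lemma sz_simps [simp]:
  "sz True = 1" "sz False = 0" "sz (a, b) = sz a + sz b + 1"
  "sz ([] :: 'a::enc list) = 0" "sz (x # xs) = sz x + sz (xs :: 'a list) + 1"
  "sz () = 0"
  by (simp_all add: sz_def)

lemma sz_nat [simp]: "sz (n :: nat) = n"
  by (induction n) (simp_all add: sz_def)

lemma sz_append [simp]: "sz (xs @ ys :: 'a::enc list) = sz xs + sz ys"
  by (induction xs) auto

lemma sz_rev [simp]: "sz (rev xs :: 'a::enc list) = sz xs"
  by (induction xs) auto

lemma length_le_sz: "length xs \<le> sz (xs :: 'a::enc list)"
  by (induction xs) auto

lemma sz_mem: "x \<in> set xs \<Longrightarrow> sz x < sz (xs :: 'a::enc list)"
  by (induction xs) auto

lemma sz_list_le: "(\<And>x. x \<in> set xs \<Longrightarrow> sz x \<le> B) \<Longrightarrow> sz (xs :: 'a::enc list) \<le> length xs * (B + 1)"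
  by (induction xs) (auto simp: algebra_simps intro: add_mono)

text \<open>Polynomial growth in the size of the input plus a potential \<open>p\<close>. The
  summand 2 makes the base at least 2, so that constants and sums are absorbed by a larger
  exponent.\<close>

definition pb :: "('e::enc \<Rightarrow> nat) \<Rightarrow> ('e \<Rightarrow> nat) \<Rightarrow> bool" where
  "pb p h \<longleftrightarrow> (\<exists>d. \<forall>e. h e \<le> (p e + sz e + 2) ^ d)"

named_theorems pb_intros

lemma pb_mono: "pb p h \<Longrightarrow> (\<And>e. g e \<le> h e) \<Longrightarrow> pb p g"
  unfolding pb_def by (meson le_trans)

lemma pb_const [pb_intros]: "pb p (\<lambda>_. c)"
proof -
  have "c \<le> (m + 2) ^ c" for m :: nat
  proof -
    have "c < 2 ^ c" by (rule less_exp)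
    also have "(2::nat) ^ c \<le> (m + 2) ^ c" by (rule power_mono) auto
    finally show ?thesis by simp
  qed
  then show ?thesis unfolding pb_def by blast
qed

lemma pb_mult [pb_intros]: "pb p g \<Longrightarrow> pb p h \<Longrightarrow> pb p (\<lambda>e. g e * h e)"
  unfolding pb_def
proof (elim exE)
  fix a b
  assume "\<forall>e. g e \<le> (p e + sz e + 2) ^ a" "\<forall>e. h e \<le> (p e + sz e + 2) ^ b"
  then have "\<forall>e. g e * h e \<le> (p e + sz e + 2) ^ (a + b)"
    unfolding power_add by (auto intro: mult_mono)
  then show "\<exists>d. \<forall>e. g e * h e \<le> (p e + sz e + 2) ^ d" by blast
qed

lemma pb_add [pb_intros]: 
  assumes "pb p g" "pb p h" shows "pb p (\<lambda>e. g e + h e)"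
proof -
  from assms obtain a b where ab: "\<And>e. g e \<le> (p e + sz e + 2) ^ a" "\<And>e. h e \<le> (p e + sz e + 2) ^ b"
    unfolding pb_def by blast
  have "g e + h e \<le> (p e + sz e + 2) ^ (a + b + 1)" for e
  proof -
    let ?m = "p e + sz e + 2"
    have "g e \<le> ?m ^ (a + b)" using ab(1)[of e] by (rule order_trans) (simp add: power_increasing)
    moreover have "h e \<le> ?m ^ (a + b)" using ab(2)[of e] by (rule order_trans) (simp add: power_increasing)
    moreover have "2 * ?m ^ (a + b) \<le> ?m ^ (a + b + 1)" by simp
    ultimately show ?thesis by linarith
  qed
  then show ?thesis unfolding pb_def by blast
qed

lemma pb_power [pb_intros]: "pb p g \<Longrightarrow> pb p (\<lambda>e. g e ^ c)"
  by (induction c) (auto intro: pb_intros)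

lemma pb_Suc [pb_intros]: "pb p g \<Longrightarrow> pb p (\<lambda>e. Suc (g e))"
  using pb_add[OF _ pb_const[of p 1]] by simp

lemma pb_p [pb_intros]: "pb p p"
  and pb_sz [pb_intros]: "pb p sz"
  unfolding pb_def by (rule exI[of _ 1], simp)+

text \<open>The outer bound has potential 0 because it is evaluated at \<open>f e\<close>, of which
  only the size is controlled.\<close>

lemma pb_comp:
  assumes "pb (\<lambda>_. 0) h" "pb p (\<lambda>e. sz (f e))"
  shows "pb p (\<lambda>e. h (f e))"
proof -
  from assms(1) obtain d where "\<And>e. h e \<le> (sz e + 2) ^ d" unfolding pb_def by auto
  moreover have "pb p (\<lambda>e. (sz (f e) + 2) ^ d)" by (intro pb_intros assms)
  ultimately show ?thesis by (rule pb_mono[rotated])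
qed

section \<open>Functions computed by programs in polynomial time\<close>

text \<open>The size of the output is bounded separately, since sharing allows a short run to build
  an exponentially large tree. Leaving every stack \<open>k\<close> unchanged makes the programs
  composable.\<close>

definition fpm :: "('e::enc \<Rightarrow> nat) \<Rightarrow> ('e \<Rightarrow> 'a::enc) \<Rightarrow> bool" where
  "fpm p f \<longleftrightarrow> pb p (\<lambda>e. sz (f e)) \<and>
     (\<exists>c T. pb p T \<and> (\<forall>e k. exec c (enc e) k (T e) (enc (f e)) k))"

abbreviation fp :: "('e::enc \<Rightarrow> 'a::enc) \<Rightarrow> bool" where "fp \<equiv> fpm (\<lambda>_. 0)"

named_theorems fp_intros

lemma fpm_sz: "fpm p f \<Longrightarrow> pb p (\<lambda>e. sz (f e))"
  by (simp add: fpm_def)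

lemma fpm_exp:
  assumes "vars01 E" "\<And>e k. eval2 E (enc e) k = enc (f e)" "pb p (\<lambda>e. sz (f e))"
  shows "fpm p f"
  unfolding fpm_def
proof (intro conjI exI allI)
  show "pb p (\<lambda>_. 1)" by (rule pb_const)
  show "exec (Assign 0 E) (enc e) k 1 (enc (f e)) k" for e k
    using exec_Assign0[OF assms(1), of "enc e" k] assms(2) by simp
qed fact

lemma fpm_id [fp_intros]: "fpm p (\<lambda>e. e)"
  by (rule fpm_exp[of "Var 0"]) (auto intro: pb_intros)

lemma fpm_const [fp_intros]: "fpm p (\<lambda>_. c)"
proof -
  have "\<exists>E. vars01 E \<and> (\<forall>x k. eval2 E x k = y)" for y
  proof (induction y)
    case Atom
    show ?case by (rule exI[of _ Nil_exp]) simp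
  next
    case (Cell a b)
    then obtain E F where "vars01 E \<and> (\<forall>x k. eval2 E x k = a)" "vars01 F \<and> (\<forall>x k. eval2 F x k = b)" by blast
    then show ?case by (intro exI[of _ "Cons_exp E F"]) simp
  qed
  then obtain E where "vars01 E \<and> (\<forall>x k. eval2 E x k = enc c)" by blast
  then show ?thesis by (intro fpm_exp[of E]) (auto intro: pb_intros)
qed

lemma fpm_comp:
  assumes "fpm p f" "fp g"
  shows "fpm p (\<lambda>e. g (f e))"
proof -
  from assms(1) obtain c T where c: "pb p T" "\<And>e k. exec c (enc e) k (T e) (enc (f e)) k"
    unfolding fpm_def by blast
  from assms(2) obtain d U where d: "pb (\<lambda>_. 0) U" "\<And>e k. exec d (enc e) k (U e) (enc (g e)) k"
    unfolding fpm_def by blast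
  have "pb p (\<lambda>e. T e + Suc (U (f e)))"
    by (intro pb_intros c(1) pb_comp[OF d(1)] fpm_sz[OF assms(1)])
  moreover have "exec (Seq c d) (enc e) k (T e + Suc (U (f e))) (enc (g (f e))) k" for e k
    using exec_Seq[OF c(2) d(2)] .
  moreover have "pb p (\<lambda>e. sz (g (f e)))"
    by (rule pb_comp[OF fpm_sz[OF assms(2)] fpm_sz[OF assms(1)]])
  ultimately show ?thesis unfolding fpm_def by blast
qed

text \<open>The pushed argument is swapped with the first component, so that the second component can
  be computed from it.\<close>

lemma fpm_Pair [fp_intros]:
  assumes "fpm p f" "fpm p g"
  shows "fpm p (\<lambda>e. (f e, g e))"
proof -
  from assms(1) obtain c T where c: "pb p T" "\<And>e k. exec c (enc e) k (T e) (enc (f e)) k"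
    unfolding fpm_def by blast
  from assms(2) obtain d U where d: "pb p U" "\<And>e k. exec d (enc e) k (U e) (enc (g e)) k"
    unfolding fpm_def by blast
  define c1 where "c1 = Assign 1 (Cons_exp (Var 0) (Var 1))"
  define c2 where "c2 = Assign 1 (Cons_exp (Var 0) (Var 1))"
  define c3 where "c3 = Assign 0 (Car (Cdr (Var 1)))"
  define c4 where "c4 = Assign 0 (Cons_exp (Car (Var 1)) (Var 0))"
  define c5 where "c5 = Assign 1 (Cdr (Cdr (Var 1)))"
  define P where "P = Seq c1 (Seq c (Seq c2 (Seq c3 (Seq d (Seq c4 c5)))))"
  have "exec P (enc e) k (1 + Suc (T e + Suc (1 + Suc (1 + Suc (U e + Suc (1 + Suc 1))))))
      (enc (f e, g e)) k" for e k
    unfolding P_def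
  proof (intro exec_Seq)
    show "exec c1 (enc e) k 1 (enc e) (Cell (enc e) k)"
      using exec_Assign1[of "Cons_exp (Var 0) (Var 1)" "enc e" k] by (simp add: c1_def)
    show "exec c (enc e) (Cell (enc e) k) (T e) (enc (f e)) (Cell (enc e) k)" by (rule c)
    show "exec c2 (enc (f e)) (Cell (enc e) k) 1 (enc (f e)) (Cell (enc (f e)) (Cell (enc e) k))"
      using exec_Assign1[of "Cons_exp (Var 0) (Var 1)" "enc (f e)" "Cell (enc e) k"] by (simp add: c2_def)
    show "exec c3 (enc (f e)) (Cell (enc (f e)) (Cell (enc e) k)) 1 (enc e) (Cell (enc (f e)) (Cell (enc e) k))"
      using exec_Assign0[of "Car (Cdr (Var 1))" "enc (f e)" "Cell (enc (f e)) (Cell (enc e) k)"]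
      by (simp add: c3_def)
    show "exec d (enc e) (Cell (enc (f e)) (Cell (enc e) k)) (U e) (enc (g e)) (Cell (enc (f e)) (Cell (enc e) k))"
      by (rule d)
    show "exec c4 (enc (g e)) (Cell (enc (f e)) (Cell (enc e) k)) 1 (enc (f e, g e)) (Cell (enc (f e)) (Cell (enc e) k))"
      using exec_Assign0[of "Cons_exp (Car (Var 1)) (Var 0)" "enc (g e)" "Cell (enc (f e)) (Cell (enc e) k)"]
      by (simp add: c4_def)
    show "exec c5 (enc (f e, g e)) (Cell (enc (f e)) (Cell (enc e) k)) 1 (enc (f e, g e)) k"
      using exec_Assign1[of "Cdr (Cdr (Var 1))" "enc (f e, g e)" "Cell (enc (f e)) (Cell (enc e) k)"]
      by (simp add: c5_def)
  qed
  moreover have "pb p (\<lambda>e. 1 + Suc (T e + Suc (1 + Suc (1 + Suc (U e + Suc (1 + Suc 1))))))"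
    by (intro pb_intros c d)
  moreover have "pb p (\<lambda>e. sz (f e, g e))"
    unfolding sz_simps by (intro pb_intros fpm_sz assms)
  ultimately show ?thesis unfolding fpm_def by blast
qed

lemma fpm_If [fp_intros]:
  assumes "fpm p b" "fpm p f" "fpm p g"
  shows "fpm p (\<lambda>e. if b e then f e else g e)"
proof -
  have eq: "(\<lambda>e. if b e then f e else g e) = (\<lambda>e. (\<lambda>(x, e). if x then f e else g e) (b e, e))" by auto
  from assms(1) obtain a S where a: "pb p S" "\<And>e k. exec a (enc e) k (S e) (enc (b e)) k"
    unfolding fpm_def by blast
  from assms(2) obtain c T where c: "pb p T" "\<And>e k. exec c (enc e) k (T e) (enc (f e)) k"
    unfolding fpm_def by blast
  from assms(3) obtain d U where d: "pb p U" "\<And>e k. exec d (enc e) k (U e) (enc (g e)) k"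
    unfolding fpm_def by blast
  define c1 where "c1 = Assign 1 (Cons_exp (Var 0) (Var 1))"
  define c2 where "c2 = Assign 1 (Cons_exp (Var 0) (Var 1))"
  define c3 where "c3 = Assign 0 (Car (Cdr (Var 1)))"
  define c4 where "c4 = Assign 1 (Cdr (Cdr (Var 1)))"
  \<comment> \<open>The stack holds the value of the condition and below it the argument, until
    \<open>c4\<close> drops both.\<close>
  define P where "P = Seq c1 (Seq a (Seq c2 (Seq c3 (Seq (Branch (Car (Var 1)) c d) c4))))"
  have "exec P (enc e) k (1 + Suc (S e + Suc (1 + Suc (1 + Suc (Suc (T e + U e) + Suc 1)))))
      (enc (if b e then f e else g e)) k" for e k
    unfolding P_def
  proof (intro exec_Seq)
    let ?k = "Cell (enc (b e)) (Cell (enc e) k)"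
    show "exec c1 (enc e) k 1 (enc e) (Cell (enc e) k)"
      using exec_Assign1[of "Cons_exp (Var 0) (Var 1)" "enc e" k] by (simp add: c1_def)
    show "exec a (enc e) (Cell (enc e) k) (S e) (enc (b e)) (Cell (enc e) k)" by (rule a)
    show "exec c2 (enc (b e)) (Cell (enc e) k) 1 (enc (b e)) ?k"
      using exec_Assign1[of "Cons_exp (Var 0) (Var 1)" "enc (b e)" "Cell (enc e) k"] by (simp add: c2_def)
    show "exec c3 (enc (b e)) ?k 1 (enc e) ?k"
      using exec_Assign0[of "Car (Cdr (Var 1))" "enc (b e)" ?k] by (simp add: c3_def)
    show "exec (Branch (Car (Var 1)) c d) (enc e) ?k (Suc (T e + U e)) (enc (if b e then f e else g e)) ?k"
    proof (rule exec_Branch)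
      show "vars01 (Car (Var 1))" by simp
      show "exec c (enc e) ?k (T e + U e) (enc (if b e then f e else g e)) ?k"
        if "eval2 (Car (Var 1)) (enc e) ?k \<noteq> Atom"
        using that exec_mono[OF c(2)] by (cases "b e") auto
      show "exec d (enc e) ?k (T e + U e) (enc (if b e then f e else g e)) ?k"
        if "eval2 (Car (Var 1)) (enc e) ?k = Atom"
        using that exec_mono[OF d(2)] by (cases "b e") auto
    qed
    show "exec c4 (enc (if b e then f e else g e)) ?k 1 (enc (if b e then f e else g e)) k"
      using exec_Assign1[of "Cdr (Cdr (Var 1))" _ ?k] by (simp add: c4_def)
  qed
  moreover have "pb p (\<lambda>e. 1 + Suc (S e + Suc (1 + Suc (1 + Suc (Suc (T e + U e) + Suc 1)))))"
    by (intro pb_intros a c d)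
  moreover have "pb p (\<lambda>e. sz (if b e then f e else g e))"
    by (rule pb_mono[OF pb_add[OF fpm_sz[OF assms(2)] fpm_sz[OF assms(3)]]]) simp
  ultimately show ?thesis unfolding fpm_def by blast
qed

text \<open>The accumulator is kept in variable 0, the remaining list and the argument
  \<open>e\<close> on the stack. Iterating a polynomial body can square a size again and again,
  hence the hypothesis that one polynomial \<open>h\<close> bounds the accumulators after all
  prefixes of the list.\<close>

lemma fpm_fold:
  assumes l: "fpm p l" and a: "fpm p a"
    and b: "fp (\<lambda>z. b (fst (fst z)) (snd (fst z)) (snd z))"
    and h: "pb p h" "\<And>e xs ys. l e = xs @ ys \<Longrightarrow> sz (fold (b e) xs (a e)) \<le> h e"
  shows "fpm p (\<lambda>e. fold (\<lambda>x. b e x) (l e) (a e))"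
proof -
  from l obtain cl Tl where cl: "pb p Tl" "\<And>e k. exec cl (enc e) k (Tl e) (enc (l e)) k"
    unfolding fpm_def by blast
  from a obtain ca Ta where ca: "pb p Ta" "\<And>e k. exec ca (enc e) k (Ta e) (enc (a e)) k"
    unfolding fpm_def by blast
  from b obtain cb Tb where "pb (\<lambda>_. 0) Tb" and cb:
    "\<And>e k. exec cb (enc e) k (Tb e) (enc (b (fst (fst e)) (snd (fst e)) (snd e))) k"
    unfolding fpm_def by blast
  then obtain d where d: "\<And>z. Tb z \<le> (sz z + 2) ^ d" unfolding pb_def add_0 by blast
  \<comment> \<open>\<open>B e\<close> bounds one execution of the body: pairing \<open>e\<close>,
    an entry and an accumulator takes two more cells, and \<open>pb\<close> adds 2.\<close>
  define B where "B e = (sz e + sz (l e) + h e + 4) ^ d" for e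
  define E X A where "E = Car (Cdr (Var 1))" and "X = Car (Car (Var 1))" and "A = Var 0"
  define b1 where "b1 = Assign 0 (Cons_exp (Cons_exp E X) A)"
  define b2 where "b2 = Assign 1 (Cons_exp (Cdr (Car (Var 1))) (Cdr (Var 1)))"
  define W where "W = While (Car (Var 1)) (Seq b1 (Seq b2 cb))"
  \<comment> \<open>The loop invariant after the prefix \<open>xs\<close>, with \<open>ys\<close>
    still on the stack. Besides the body, a round costs 6 steps for the test, the two assignments
    and the sequencing.\<close>
  have W: "exec W (enc (fold (b e) xs (a e))) (Cell (enc ys) (Cell (enc e) k))
      (length ys * (B e + 6) + 1) (enc (fold (b e) (l e) (a e))) (Cell Atom (Cell (enc e) k))"
    if "l e = xs @ ys" for e k xs ys
    using that
  proof (induction ys arbitrary: xs)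
    case Nil
    then show ?case unfolding W_def
      using exec_While_False[of "Car (Var 1)"] by simp
  next
    case (Cons y ys)
    let ?u = "fold (b e) xs (a e)"
    let ?k = "Cell (enc ys) (Cell (enc e) k)"
    have IH: "exec W (enc (b e y ?u)) ?k (length ys * (B e + 6) + 1)
        (enc (fold (b e) (l e) (a e))) (Cell Atom (Cell (enc e) k))"
      using Cons.IH[of "xs @ [y]"] Cons.prems by simp
    have "sz y < sz (l e)" using Cons.prems by (intro sz_mem) auto
    moreover have "sz ?u \<le> h e" using h(2) Cons.prems by blast
    ultimately have "Tb ((e, y), ?u) \<le> B e"
      unfolding B_def by (intro order_trans[OF d] power_mono) auto
    from exec_mono[OF cb[of "((e, y), ?u)"] this]
    have cb': "exec cb (enc ((e, y), ?u)) ?k (B e) (enc (b e y ?u)) ?k" by simp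
    have b1: "exec b1 (enc ?u) (Cell (enc (y # ys)) (Cell (enc e) k)) 1 (enc ((e, y), ?u)) (Cell (enc (y # ys)) (Cell (enc e) k))"
      using exec_Assign0[of "Cons_exp (Cons_exp E X) A" "enc ?u" "Cell (enc (y # ys)) (Cell (enc e) k)"]
      by (simp add: b1_def E_def X_def A_def)
    have b2: "exec b2 (enc ((e, y), ?u)) (Cell (enc (y # ys)) (Cell (enc e) k)) 1 (enc ((e, y), ?u)) ?k"
      using exec_Assign1[of "Cons_exp (Cdr (Car (Var 1))) (Cdr (Var 1))" "enc ((e, y), ?u)" "Cell (enc (y # ys)) (Cell (enc e) k)"]
      by (simp add: b2_def)
    have "exec W (enc ?u) (Cell (enc (y # ys)) (Cell (enc e) k))
      (Suc ((1 + Suc (1 + Suc (B e))) + Suc (length ys * (B e + 6) + 1)))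
      (enc (fold (b e) (l e) (a e))) (Cell Atom (Cell (enc e) k))"
      unfolding W_def
      by (rule exec_While_True[OF _ _ exec_Seq[OF b1 exec_Seq[OF b2 cb']] IH[unfolded W_def]]) auto
    then show ?case by (rule exec_mono) simp
  qed
  define c1 where "c1 = Assign 1 (Cons_exp (Var 0) (Var 1))"
  define c2 where "c2 = Assign 1 (Cons_exp (Var 0) (Var 1))"
  define c3 where "c3 = Assign 0 (Car (Cdr (Var 1)))"
  define c4 where "c4 = Assign 1 (Cdr (Cdr (Var 1)))"
  define P where "P = Seq c1 (Seq cl (Seq c2 (Seq c3 (Seq ca (Seq W c4)))))"
  have "exec P (enc e) k (1 + Suc (Tl e + Suc (1 + Suc (1 + Suc (Ta e + Suc ((length (l e) * (B e + 6) + 1) + Suc 1))))))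
      (enc (fold (b e) (l e) (a e))) k" for e k
    unfolding P_def
  proof (intro exec_Seq)
    let ?k = "Cell (enc (l e)) (Cell (enc e) k)"
    show "exec c1 (enc e) k 1 (enc e) (Cell (enc e) k)"
      using exec_Assign1[of "Cons_exp (Var 0) (Var 1)" "enc e" k] by (simp add: c1_def)
    show "exec cl (enc e) (Cell (enc e) k) (Tl e) (enc (l e)) (Cell (enc e) k)" by (rule cl)
    show "exec c2 (enc (l e)) (Cell (enc e) k) 1 (enc (l e)) ?k"
      using exec_Assign1[of "Cons_exp (Var 0) (Var 1)" "enc (l e)" "Cell (enc e) k"] by (simp add: c2_def)
    show "exec c3 (enc (l e)) ?k 1 (enc e) ?k"
      using exec_Assign0[of "Car (Cdr (Var 1))" "enc (l e)" ?k] by (simp add: c3_def)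
    show "exec ca (enc e) ?k (Ta e) (enc (a e)) ?k" by (rule ca)
    show "exec W (enc (a e)) ?k (length (l e) * (B e + 6) + 1) (enc (fold (b e) (l e) (a e))) (Cell Atom (Cell (enc e) k))"
      using W[of e "[]" "l e" k] by simp
    show "exec c4 (enc (fold (b e) (l e) (a e))) (Cell Atom (Cell (enc e) k)) 1 (enc (fold (b e) (l e) (a e))) k"
      using exec_Assign1[of "Cdr (Cdr (Var 1))" _ "Cell Atom (Cell (enc e) k)"] by (simp add: c4_def)
  qed
  moreover have "pb p (\<lambda>e. 1 + Suc (Tl e + Suc (1 + Suc (1 + Suc (Ta e + Suc ((length (l e) * (B e + 6) + 1) + Suc 1))))))"
    unfolding B_def
    by (intro pb_intros cl ca fpm_sz[OF l] h pb_mono[OF fpm_sz[OF l] length_le_sz])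
  moreover have "pb p (\<lambda>e. sz (fold (b e) (l e) (a e)))"
    using h(2)[of _ "l _" "[]"] by (intro pb_mono[OF h(1)]) auto
  ultimately show ?thesis unfolding fpm_def by blast
qed

lemma fpm_comp2:
  assumes "fp (\<lambda>z. g (fst z) (snd z))" "fpm p f" "fpm p h"
  shows "fpm p (\<lambda>e. g (f e) (h e))"
  using fpm_comp[OF fpm_Pair[OF assms(2,3)] assms(1)] by simp

lemma fpm_comp3:
  assumes "fp (\<lambda>z. g (fst (fst z)) (snd (fst z)) (snd z))" "fpm p f" "fpm p h" "fpm p i"
  shows "fpm p (\<lambda>e. g (f e) (h e) (i e))"
  using fpm_comp[OF fpm_Pair[OF fpm_Pair[OF assms(2,3)] assms(4)] assms(1)] by simp

section \<open>Arithmetic and list operations\<close>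

lemma fp_fst: "fp fst"
  by (rule fpm_exp[of "Car (Var 0)"]) (auto intro: pb_mono[OF pb_sz])

lemma fp_snd: "fp snd"
  by (rule fpm_exp[of "Cdr (Var 0)"]) (auto intro: pb_mono[OF pb_sz])

lemma fp_Suc: "fp Suc"
  by (rule fpm_exp[of "Cons_exp Nil_exp (Var 0)"]) (auto intro!: pb_intros pb_mono[OF pb_Suc[OF pb_sz]])

lemma fp_pred: "fp (\<lambda>n::nat. n - 1)"
proof (rule fpm_exp[of "Cdr (Var 0)"])
  show "eval2 (Cdr (Var 0)) (enc n) k = enc (n - 1)" for n :: nat and k by (cases n) auto
qed (auto intro: pb_mono[OF pb_sz])

lemma fp_tl: "fp (tl :: 'a::enc list \<Rightarrow> 'a list)"
proof (rule fpm_exp[of "Cdr (Var 0)"])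
  show "eval2 (Cdr (Var 0)) (enc xs) k = enc (tl xs)" for xs :: "'a list" and k by (cases xs) auto
  have "sz (tl xs) \<le> sz xs" for xs :: "'a list" by (cases xs) auto
  then show "pb (\<lambda>_. 0) (\<lambda>xs :: 'a list. sz (tl xs))" by (rule pb_mono[OF pb_sz])
qed auto

lemma fp_Cons: "fp (\<lambda>z. fst z # snd z)"
proof (rule fpm_exp[of "Var 0"])
  show "eval2 (Var 0) (enc z) k = enc (fst z # snd z)" for z :: "'a \<times> 'a list" and k by (cases z) auto
  have "sz (fst z # snd z) = sz z" for z :: "'a \<times> 'a list" by (cases z) auto
  then show "pb (\<lambda>_. 0) (\<lambda>z :: 'a \<times> 'a list. sz (fst z # snd z))" by (simp only: pb_sz)
qed auto

lemma sz_unit_list [simp]: "sz (xs :: unit list) = length xs"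
  by (induction xs) auto

lemma fp_units: "fp (\<lambda>n. replicate n ())"
proof (rule fpm_exp[of "Var 0"])
  have "enc n = enc (replicate n ())" for n by (induction n) auto
  then show "eval2 (Var 0) (enc n) k = enc (replicate n ())" for n k by simp
  show "pb (\<lambda>_. 0) (\<lambda>n. sz (replicate n ()))" by (rule pb_mono[OF pb_sz]) simp
qed auto

lemma fp_nonempty: "fp (\<lambda>xs :: 'a::enc list. xs \<noteq> [])"
proof -
  define c where "c = Branch (Var 0) (Assign 0 (Cons_exp Nil_exp Nil_exp)) (Assign 0 Nil_exp)"
  have "exec c (enc xs) k (Suc 1) (enc (xs \<noteq> [])) k" for xs :: "'a list" and k
    unfolding c_def
    using exec_Assign0[of "Cons_exp Nil_exp Nil_exp" "enc xs" k] exec_Assign0[of "Nil_exp" "enc xs" k]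
    by (intro exec_Branch) (cases xs; simp)+
  moreover have "pb (\<lambda>_. 0) (\<lambda>xs :: 'a list. Suc 1)" by (rule pb_const)
  moreover have "sz b \<le> 1" for b :: bool by (cases b) auto
  then have "pb (\<lambda>_. 0) (\<lambda>xs :: 'a list. sz (xs \<noteq> []))" by (rule pb_mono[OF pb_const])
  ultimately show ?thesis unfolding fpm_def by blast
qed

lemmas fpm_fst [fp_intros] = fpm_comp[OF _ fp_fst]
  and fpm_snd [fp_intros] = fpm_comp[OF _ fp_snd]
  and fpm_Suc [fp_intros] = fpm_comp[OF _ fp_Suc]
  and fpm_pred [fp_intros] = fpm_comp[OF _ fp_pred]
  and fpm_tl [fp_intros] = fpm_comp[OF _ fp_tl]
  and fpm_units [fp_intros] = fpm_comp[OF _ fp_units]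
  and fpm_nonempty [fp_intros] = fpm_comp[OF _ fp_nonempty]
  and fpm_Cons [fp_intros] = fpm_comp2[OF fp_Cons]

lemma fpm_Not [fp_intros]:
  assumes "fpm p b" shows "fpm p (\<lambda>e. \<not> b e)"
proof -
  have "(\<lambda>e. \<not> b e) = (\<lambda>e. if b e then False else True)" by auto
  then show ?thesis using fpm_If[OF assms fpm_const fpm_const] by (simp only:)
qed

lemma fpm_conj [fp_intros]:
  assumes "fpm p b" "fpm p c" shows "fpm p (\<lambda>e. b e \<and> c e)"
proof -
  have "(\<lambda>e. b e \<and> c e) = (\<lambda>e. if b e then c e else False)" by auto
  then show ?thesis using fpm_If[OF assms fpm_const] by (simp only:)
qed

lemma fpm_disj [fp_intros]:
  assumes "fpm p b" "fpm p c" shows "fpm p (\<lambda>e. b e \<or> c e)"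
proof -
  have "(\<lambda>e. b e \<or> c e) = (\<lambda>e. if b e then True else c e)" by auto
  then show ?thesis using fpm_If[OF assms(1) fpm_const assms(2)] by (simp only:)
qed

lemma fpm_empty [fp_intros]: "fpm p l \<Longrightarrow> fpm p (\<lambda>e. l e = [])"
  using fpm_Not[OF fpm_nonempty] by simp

lemma fpm_pos [fp_intros]: "fpm p f \<Longrightarrow> fpm p (\<lambda>e. 0 < (f e :: nat))"
  using fpm_nonempty[OF fpm_units] by simp

section \<open>Unary arithmetic by iteration\<close>

lemma fold_units: "fold (\<lambda>_. g) (replicate n ()) a = (g ^^ n) a"
  by (induction n arbitrary: a) (simp_all add: funpow_swap1)

lemma fold_any_units: "fold (\<lambda>_. g) xs a = (g ^^ length xs) a"
  by (induction xs arbitrary: a) (simp_all add: funpow_swap1)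

lemma funpow_Suc: "(Suc ^^ n) a = a + n"
  by (induction n) auto

lemma funpow_pred: "((\<lambda>n. n - Suc 0) ^^ n) a = a - n"
  by (induction n) auto

lemma funpow_add: "((\<lambda>n::nat. n + m) ^^ n) a = a + n * m"
  by (induction n) auto

lemma funpow_tl: "(tl ^^ n) xs = drop n xs"
  by (induction n) (auto simp: drop_Suc tl_drop)

lemma append_le_sz: "l = xs @ ys \<Longrightarrow> length xs \<le> sz (l :: 'a::enc list)"
  using length_le_sz[of l] by simp

lemma fp_add: "fp (\<lambda>z. fst z + snd z :: nat)"
proof -
  have "fp (\<lambda>z :: nat \<times> nat. fold (\<lambda>_ a. Suc a) (replicate (snd z) ()) (fst z))"
  proof (rule fpm_fold)
    fix z :: "nat \<times> nat" and xs ys :: "unit list"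
    assume "replicate (snd z) () = xs @ ys"
    then have "length xs \<le> snd z" by (metis length_append length_replicate le_add1)
    then show "sz (fold (\<lambda>_. Suc) xs (fst z)) \<le> sz z"
      by (cases z) (simp add: fold_any_units funpow_Suc)
  qed (intro fp_intros pb_intros)+
  then show ?thesis by (simp add: fold_units funpow_Suc add.commute)
qed

lemma fp_diff: "fp (\<lambda>z. fst z - snd z :: nat)"
proof -
  have "fp (\<lambda>z :: nat \<times> nat. fold (\<lambda>_ a. a - 1) (replicate (snd z) ()) (fst z))"
  proof (rule fpm_fold)
    fix z :: "nat \<times> nat" and xs ys :: "unit list"
    show "sz (fold (\<lambda>_ a. a - 1) xs (fst z)) \<le> sz z"
      by (cases z) (simp add: fold_any_units funpow_pred)
  qed (intro fp_intros pb_intros)+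
  then show ?thesis by (simp add: fold_units funpow_pred)
qed

lemmas fpm_add [fp_intros] = fpm_comp2[OF fp_add]
  and fpm_diff [fp_intros] = fpm_comp2[OF fp_diff]

lemma fp_mult: "fp (\<lambda>z. fst z * snd z :: nat)"
proof -
  have "fp (\<lambda>z :: nat \<times> nat. fold (\<lambda>_ a. a + snd z) (replicate (fst z) ()) 0)"
  proof (rule fpm_fold)
    fix z :: "nat \<times> nat" and xs ys :: "unit list"
    assume "replicate (fst z) () = xs @ ys"
    then have "length xs \<le> fst z" by (metis length_append length_replicate le_add1)
    then have "length xs * snd z \<le> fst z * snd z" by simp
    also have "\<dots> \<le> sz z * sz z" by (cases z) (simp add: algebra_simps)
    finally show "sz (fold (\<lambda>_ a. a + snd z) xs 0) \<le> sz z * sz z"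
      by (simp add: fold_any_units funpow_add)
  qed (intro fp_intros pb_intros)+
  then show ?thesis by (simp add: fold_units funpow_add)
qed

lemmas fpm_mult [fp_intros] = fpm_comp2[OF fp_mult]

lemma fpm_power [fp_intros]: "fpm p f \<Longrightarrow> fpm p (\<lambda>e. f e ^ k :: nat)"
  by (induction k) (simp_all add: fpm_const fpm_mult)

lemma fpm_less [fp_intros]: "fpm p f \<Longrightarrow> fpm p g \<Longrightarrow> fpm p (\<lambda>e. (f e :: nat) < g e)"
  using fpm_pos[OF fpm_diff, of p g f] by simp

lemma fpm_le [fp_intros]: "fpm p f \<Longrightarrow> fpm p g \<Longrightarrow> fpm p (\<lambda>e. (f e :: nat) \<le> g e)"
  using fpm_Not[OF fpm_less, of p g f] by (simp add: not_less)

lemma fpm_eq_nat [fp_intros]: "fpm p f \<Longrightarrow> fpm p g \<Longrightarrow> fpm p (\<lambda>e. (f e :: nat) = g e)"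
  using fpm_conj[OF fpm_le fpm_le, of p f g g f] by (simp add: eq_iff)

section \<open>List operations\<close>

lemma fp_rev: "fp (rev :: 'a::enc list \<Rightarrow> 'a list)"
proof -
  have "fp (\<lambda>l :: 'a list. fold (\<lambda>x a. x # a) l [])"
  proof (rule fpm_fold)
    fix l xs ys :: "'a list"
    assume "l = xs @ ys"
    then show "sz (fold Cons xs []) \<le> sz l" by (simp add: rev_conv_fold[symmetric])
  qed (intro fp_intros pb_intros)+
  then show ?thesis by (simp add: rev_conv_fold[abs_def])
qed

lemmas fpm_rev [fp_intros] = fpm_comp[OF _ fp_rev]

lemma fold_Cons: "fold Cons xs ys = rev xs @ ys"
  by (induction xs arbitrary: ys) auto

lemma fp_append: "fp (\<lambda>z :: 'a::enc list \<times> 'a list. fst z @ snd z)"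
proof -
  have "fp (\<lambda>z :: 'a list \<times> 'a list. fold (\<lambda>x a. x # a) (rev (fst z)) (snd z))"
  proof (rule fpm_fold)
    fix z :: "'a list \<times> 'a list" and xs ys
    assume *: "rev (fst z) = xs @ ys"
    have "sz (fst z) = sz (rev (fst z))" by simp
    then have "sz xs \<le> sz (fst z)" unfolding * by simp
    then show "sz (fold Cons xs (snd z)) \<le> sz z" by (cases z) (simp add: fold_Cons)
  qed (intro fp_intros pb_intros)+
  then show ?thesis by (simp add: fold_Cons)
qed

lemmas fpm_append [fp_intros] = fpm_comp2[OF fp_append]

lemma fold_map_rev: "fold (\<lambda>x a. f x # a) xs ys = rev (map f xs) @ ys"
  by (induction xs arbitrary: ys) auto

text \<open>The accumulators stay small by themselves: an entry of the result is polynomial in the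
  size of the pair \<open>(e, x)\<close>, and there are at most \<open>sz (l e)\<close>
  entries.\<close>

lemma fpm_map [fp_intros]:
  assumes l: "fpm p l" and f: "fp (\<lambda>z. f (fst z) (snd z))"
  shows "fpm p (\<lambda>e. map (\<lambda>x. f e x) (l e))"
proof -
  from fpm_sz[OF f] obtain d where d: "\<And>z. sz (f (fst z) (snd z)) \<le> (sz z + 2) ^ d"
    unfolding pb_def add_0 by blast
  have "fpm p (\<lambda>e. fold (\<lambda>x a. f e x # a) (l e) [])"
  proof (rule fpm_fold[OF l])
    show "fp (\<lambda>z. f (fst (fst z)) (snd (fst z)) # snd z)"
      by (intro fp_intros fpm_comp[OF _ f])
    show "pb p (\<lambda>e. sz (l e) * ((sz e + sz (l e) + 3) ^ d + 1))"
      by (intro pb_intros fpm_sz l)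
  next
    fix e xs ys
    assume e: "l e = xs @ ys"
    have "sz (map (f e) xs) \<le> length (map (f e) xs) * ((sz e + sz (l e) + 3) ^ d + 1)"
    proof (rule sz_list_le)
      fix y assume "y \<in> set (map (f e) xs)"
      then obtain x where x: "x \<in> set xs" "y = f e x" by auto
      then have "sz x < sz (l e)" using e by (intro sz_mem) auto
      with d[of "(e, x)"] x(2) show "sz y \<le> (sz e + sz (l e) + 3) ^ d"
        by (auto intro!: power_mono elim!: order_trans)
    qed
    also have "\<dots> \<le> sz (l e) * ((sz e + sz (l e) + 3) ^ d + 1)"
      using append_le_sz[OF e] by (intro mult_right_mono) auto
    finally show "sz (fold (\<lambda>x a. f e x # a) xs []) \<le> sz (l e) * ((sz e + sz (l e) + 3) ^ d + 1)"
      by (simp add: fold_map_rev)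
  qed (intro fp_intros)
  from fpm_rev[OF this] show ?thesis by (simp add: fold_map_rev)
qed

lemma fp_concat: "fp (concat :: 'a::enc list list \<Rightarrow> 'a list)"
proof -
  have eq: "fold (\<lambda>x a. a @ x) xs ys = ys @ concat xs" for xs and ys :: "'a list"
    by (induction xs arbitrary: ys) auto
  have le: "sz (concat xs) \<le> sz xs" for xs :: "'a list list" by (induction xs) auto
  have "fp (\<lambda>l :: 'a list list. fold (\<lambda>x a. a @ x) l [])"
  proof (rule fpm_fold)
    fix l xs ys :: "'a list list"
    assume "l = xs @ ys"
    then show "sz (fold (\<lambda>x a. a @ x) xs []) \<le> sz l"
      using le[of xs] by (simp add: eq)
  qed (intro fp_intros pb_intros)+
  then show ?thesis by (simp add: eq)
qed

lemmas fpm_concat [fp_intros] = fpm_comp[OF _ fp_concat]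

lemma fpm_filter [fp_intros]:
  assumes "fpm p l" "fp (\<lambda>z. f (fst z) (snd z))"
  shows "fpm p (\<lambda>e. filter (\<lambda>x. f e x) (l e))"
proof -
  have "fpm p (\<lambda>e. concat (map (\<lambda>x. if f e x then [x] else []) (l e)))"
    by (intro fp_intros assms)
  moreover have "concat (map (\<lambda>x. if f e x then [x] else []) xs) = filter (f e) xs" for e xs
    by (induction xs) auto
  ultimately show ?thesis by simp
qed

lemma fp_length: "fp (length :: 'a::enc list \<Rightarrow> nat)"
proof -
  have "fp (\<lambda>l :: 'a list. fold (\<lambda>_ a. Suc a) l 0)"
  proof (rule fpm_fold)
    fix l xs ys :: "'a list"
    assume "l = xs @ ys"
    then show "sz (fold (\<lambda>_. Suc) xs 0) \<le> sz l"
      using append_le_sz[of l xs ys] by (simp add: fold_any_units funpow_Suc)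
  qed (intro fp_intros pb_intros)+
  then show ?thesis by (simp add: fold_any_units funpow_Suc)
qed

lemmas fpm_length [fp_intros] = fpm_comp[OF _ fp_length]

lemma sz_drop: "sz (drop n xs) \<le> sz (xs :: 'a::enc list)"
  by (metis append_take_drop_id sz_append le_add2)

lemma fp_drop: "fp (\<lambda>z. drop (fst z) (snd z :: 'a::enc list))"
proof -
  have "fp (\<lambda>z :: nat \<times> 'a list. fold (\<lambda>_ a. tl a) (replicate (fst z) ()) (snd z))"
  proof (rule fpm_fold)
    fix z :: "nat \<times> 'a list" and xs ys :: "unit list"
    show "sz (fold (\<lambda>_. tl) xs (snd z)) \<le> sz z"
      using sz_drop[of "length xs" "snd z"] by (cases z) (simp add: fold_any_units funpow_tl)
  qed (intro fp_intros pb_intros)+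
  then show ?thesis by (simp add: fold_units funpow_tl)
qed

lemmas fpm_drop [fp_intros] = fpm_comp2[OF fp_drop]

lemma fpm_take [fp_intros]:
  assumes "fpm p n" "fpm p (l :: 'e::enc \<Rightarrow> 'a::enc list)"
  shows "fpm p (\<lambda>e. take (n e) (l e))"
proof -
  have "fpm p (\<lambda>e. rev (drop (length (l e) - n e) (rev (l e))))" by (intro fp_intros assms)
  moreover have "rev (drop (length xs - m) (rev xs)) = take m xs" for m and xs :: "'a list"
    by (cases "m \<le> length xs") (simp_all add: rev_drop)
  ultimately show ?thesis by simp
qed

definition hd0 :: "'a \<Rightarrow> 'a list \<Rightarrow> 'a" where
  "hd0 d xs = (case xs of [] \<Rightarrow> d | x # _ \<Rightarrow> x)"

lemma hd0_simps [simp]: "hd0 d [] = d" "hd0 d (x # xs) = x"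
  by (simp_all add: hd0_def)

lemma hd0_drop: "i < length xs \<Longrightarrow> hd0 d (drop i xs) = xs ! i"
  by (simp add: Cons_nth_drop_Suc[symmetric])

lemma fp_hd0: "fp (\<lambda>z. hd0 (fst z) (snd z))"
proof -
  have eq: "fold (\<lambda>x _. x) xs d = hd0 d (rev xs)" for xs and d :: 'a
    by (induction xs rule: rev_induct) auto
  have "fp (\<lambda>z :: 'a \<times> 'a list. fold (\<lambda>x a. x) (rev (snd z)) (fst z))"
  proof (rule fpm_fold)
    fix z :: "'a \<times> 'a list" and xs ys
    assume *: "rev (snd z) = xs @ ys"
    have "sz (hd0 (fst z) (rev xs)) \<le> sz (fst z) + sz (rev xs)" by (cases "rev xs") auto
    moreover have "sz (snd z) = sz (rev (snd z))" by simp
    then have "sz xs \<le> sz (snd z)" unfolding * by simp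
    ultimately show "sz (fold (\<lambda>x a. x) xs (fst z)) \<le> sz z" by (cases z) (simp add: eq)
  qed (intro fp_intros pb_intros)+
  then show ?thesis by (simp add: eq)
qed

lemmas fpm_hd0 [fp_intros] = fpm_comp2[OF fp_hd0]

lemma fp_upt: "fp (\<lambda>n. [0..<n])"
proof -
  \<comment> \<open>The length of the accumulator serves as the counter.\<close>
  have eq: "fold (\<lambda>_ a. length a # a) xs [] = rev [0..<length xs]" for xs :: "unit list"
    by (induction xs rule: rev_induct) auto
  have "fp (\<lambda>n. rev (fold (\<lambda>_ a. length a # a) (replicate n ()) []))"
  proof (intro fpm_rev fpm_fold)
    fix n :: nat and xs ys :: "unit list"
    assume "replicate n () = xs @ ys"
    then have n: "length xs \<le> n" by (metis length_append length_replicate le_add1)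
    have "sz [0..<length xs] \<le> length [0..<length xs] * (length xs + 1)" by (rule sz_list_le) auto
    also have "\<dots> \<le> n * (n + 1)" using n by (intro mult_le_mono) simp_all
    finally show "sz (fold (\<lambda>_ a. length a # a) xs []) \<le> sz n * (sz n + 1)" by (simp add: eq)
  qed (intro fp_intros pb_intros)+
  then show ?thesis unfolding eq by simp
qed

lemmas fpm_upt [fp_intros] = fpm_comp[OF _ fp_upt]

lemma fpm_mem [fp_intros]:
  assumes "fpm p x" "fpm p l"
  shows "fpm p (\<lambda>e. (x e :: nat) \<in> set (l e))"
proof -
  have "fp (\<lambda>z. filter (\<lambda>y. y = fst z) (snd z) \<noteq> ([] :: nat list))" by (intro fp_intros)
  then have "fp (\<lambda>z. (fst z :: nat) \<in> set (snd z))" by (simp add: filter_empty_conv)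
  from fpm_comp2[OF this assms] show ?thesis .
qed

lemma fpm_set_eq [fp_intros]:
  assumes "fpm p k" "fpm p l"
  shows "fpm p (\<lambda>e. set (k e :: nat list) = set (l e))"
proof -
  have "fp (\<lambda>z. filter (\<lambda>y. y \<notin> set (snd z)) (fst z) = ([] :: nat list) \<and> filter (\<lambda>y. y \<notin> set (fst z)) (snd z) = [])"
    by (intro fp_intros)
  moreover have "(filter (\<lambda>y. y \<notin> set v) u = [] \<and> filter (\<lambda>y. y \<notin> set u) v = []) \<longleftrightarrow> set u = set v"
    for u v :: "nat list" by (auto simp: filter_empty_conv)
  ultimately have "fp (\<lambda>z. set (fst z :: nat list) = set (snd z))" by simp
  from fpm_comp2[OF this assms] show ?thesis .
qed

section \<open>The algorithm\<close>

text \<open>Items are numbered from 0. An order is listed from the largest item to the smallest; inside the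
  dynamic program it is built in reverse, so that it grows at the head, and is paired with the
  number of comparisons it agrees with.\<close>

definition beats :: "bool list list \<Rightarrow> nat \<Rightarrow> nat \<Rightarrow> bool" where
  "beats M u y = hd0 False (drop y (hd0 [] (drop u M)))"

definition extensions :: "bool list list \<Rightarrow> nat list \<Rightarrow> (nat \<times> nat list) list \<Rightarrow> (nat \<times> nat list) list" where
  "extensions M V T =
     concat (map (\<lambda>t. map (\<lambda>y. (fst t + length (filter (\<lambda>u. beats M u y) (snd t)), y # snd t))
       (filter (\<lambda>y. y \<notin> set (snd t)) V)) T)"

text \<open>An optional maximum: the result has at most one entry and is empty only if there are no
  candidates.\<close>

definition best :: "(nat \<times> 'a) list \<Rightarrow> (nat \<times> 'a) list" where
  "best es = fold (\<lambda>e a. if a = [] \<or> fst (hd0 e a) < fst e then [e] else a) es []"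

primrec select_by :: "bool list \<Rightarrow> 'a list \<Rightarrow> 'a list" where
  "select_by v [] = []"
| "select_by v (x # xs) = (if hd0 False v then x # select_by (tl v) xs else select_by (tl v) xs)"

text \<open>The sets that can be the first \<open>m\<close> items of an order of the items of \<open>\<sigma>\<close> and \<open>x\<close> in which no item of
  \<open>\<sigma>\<close> is more than \<open>w\<close> places away from its position in \<open>\<sigma>\<close>. A vector \<open>v\<close> decides on the items in the
  window of undetermined positions.\<close>

definition targets :: "nat list \<Rightarrow> nat \<Rightarrow> nat \<Rightarrow> bool list list \<Rightarrow> nat \<Rightarrow> nat list list" where
  "targets \<sigma> x w vs m =
     concat (map (\<lambda>v. [take (m - w) \<sigma> @ select_by v (take (w + w) (drop (m - w) \<sigma>)),
       x # take (m - w) \<sigma> @ select_by v (take (w + w) (drop (m - w) \<sigma>))]) vs)"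

text \<open>Appending \<open>y\<close> to an order gains a number of agreements that depends only on
  the set of items already placed. So it suffices to keep one best order for each candidate
  set.\<close>

definition dp_step ::
    "bool list list \<Rightarrow> nat list \<Rightarrow> nat \<Rightarrow> nat \<Rightarrow> bool list list \<Rightarrow> nat \<Rightarrow> (nat \<times> nat list) list \<Rightarrow> (nat \<times> nat list) list" where
  "dp_step M \<sigma> x w vs m T =
     concat (map (\<lambda>S. best (filter (\<lambda>e. set (snd e) = set S) (extensions M (x # \<sigma>) T))) (targets \<sigma> x w vs m))"

definition dp ::
    "bool list list \<Rightarrow> nat list \<Rightarrow> nat \<Rightarrow> nat \<Rightarrow> bool list list \<Rightarrow> (nat \<times> nat list) list" where
  "dp M \<sigma> x w vs = fold (dp_step M \<sigma> x w vs) (map Suc [0..<Suc (length \<sigma>)]) [(0, [])]"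

definition insert_item :: "bool list list \<Rightarrow> nat \<Rightarrow> bool list list \<Rightarrow> nat \<Rightarrow> nat list \<Rightarrow> nat list" where
  "insert_item M w vs x \<sigma> = rev (snd (hd0 (0, []) (best (dp M \<sigma> x w vs))))"

definition order_items :: "bool list list \<Rightarrow> nat \<Rightarrow> bool list list \<Rightarrow> nat \<Rightarrow> nat list" where
  "order_items M w vs n = fold (insert_item M w vs) [0..<n] []"

text \<open>For a list without repetitions this counts \<open>i\<close> and all items after it. As
  the largest item comes first, this is the position of \<open>i\<close> in the ranking, starting
  from 1; the value 0 signals that \<open>i\<close> has not been met.\<close>

definition position :: "nat \<Rightarrow> nat list \<Rightarrow> nat" where
  "position i \<sigma> = fold (\<lambda>u a. if 0 < a \<or> u = i then Suc a else a) \<sigma> 0"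

definition positions :: "nat \<Rightarrow> nat list \<Rightarrow> nat list" where
  "positions n \<sigma> = map (\<lambda>i. position i \<sigma>) [0..<n]"

text \<open>The binary logarithm rounded up, found by doubling.\<close>

definition lg :: "nat \<Rightarrow> nat" where
  "lg n = fst (fold (\<lambda>_ s. if n \<le> snd s then s else (Suc (fst s), snd s + snd s)) (replicate n ()) (0, 1))"

text \<open>The constant is chosen such that this exceeds \<open>64 K / \<gamma>\<^sup>2\<close> for \<open>K = 8 (b + 1) a\<^sup>2 lg n\<close>, the bound of the
  analysis on the number of inversions per item in a block of an optimal order.\<close>

definition disp_bound :: "nat \<Rightarrow> nat \<Rightarrow> nat \<Rightarrow> nat" where
  "disp_bound a b n = 520 * (b + 1) * a ^ 4 * lg n"

definition bit_vectors :: "nat \<Rightarrow> bool list list" where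
  "bit_vectors k = fold (\<lambda>_ A. map ((#) True) A @ map ((#) False) A) (replicate k ()) [[]]"

type_synonym input = "nat \<times> nat \<times> nat \<times> bool list list \<times> unit"

fun window :: "input \<Rightarrow> nat" where
  "window (a, b, n, M, _) = 2 * disp_bound a b n"

text \<open>With the table \<open>vs\<close> as an argument, this part is polynomial with potential
  0, and only the computation of the table needs an exponential potential.\<close>

fun rank_items :: "bool list list \<times> input \<Rightarrow> nat list" where
  "rank_items (vs, a, b, n, M, u) = positions n (order_items M (window (a, b, n, M, u)) vs n)"

definition algorithm :: "input \<Rightarrow> nat list" where
  "algorithm I = rank_items (bit_vectors (2 * window I), I)"


subsection \<open>Running time\<close>

lemma fpm_comp4:
  assumes "fp (\<lambda>z. g (fst z) (fst (snd z)) (fst (snd (snd z))) (snd (snd (snd z))))"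
    "fpm p f1" "fpm p f2" "fpm p f3" "fpm p f4"
  shows "fpm p (\<lambda>e. g (f1 e) (f2 e) (f3 e) (f4 e))"
  using fpm_comp[OF fpm_Pair[OF assms(2) fpm_Pair[OF assms(3) fpm_Pair[OF assms(4,5)]]] assms(1)] by simp

lemma fpm_comp5:
  assumes "fp (\<lambda>z. g (fst z) (fst (snd z)) (fst (snd (snd z))) (fst (snd (snd (snd z)))) (snd (snd (snd (snd z)))))"
    "fpm p f1" "fpm p f2" "fpm p f3" "fpm p f4" "fpm p f5"
  shows "fpm p (\<lambda>e. g (f1 e) (f2 e) (f3 e) (f4 e) (f5 e))"
  using fpm_comp[OF fpm_Pair[OF assms(2) fpm_Pair[OF assms(3) fpm_Pair[OF assms(4) fpm_Pair[OF assms(5,6)]]]] assms(1)] by simp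

lemma fpm_beats [fp_intros]:
  "fpm p M \<Longrightarrow> fpm p u \<Longrightarrow> fpm p y \<Longrightarrow> fpm p (\<lambda>e. beats (M e) (u e) (y e))"
  unfolding beats_def by (intro fp_intros)

lemma fpm_extensions [fp_intros]:
  assumes "fpm p M" "fpm p V" "fpm p T"
  shows "fpm p (\<lambda>e. extensions (M e) (V e) (T e))"
  by (rule fpm_comp3[OF _ assms]) (unfold extensions_def, intro fp_intros)

lemma best_cases: "best es = [] \<and> es = [] \<or> (\<exists>e\<in>set es. best es = [e] \<and> (\<forall>e'\<in>set es. fst e' \<le> fst e))"
  by (induction es rule: rev_induct) (auto simp: best_def)

lemma fp_best: "fp (best :: (nat \<times> 'a::enc) list \<Rightarrow> _)"
proof -
  have "fp (\<lambda>es :: (nat \<times> 'a) list. fold (\<lambda>e a. if a = [] \<or> fst (hd0 e a) < fst e then [e] else a) es [])"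
  proof (rule fpm_fold)
    fix es xs ys :: "(nat \<times> 'a) list"
    assume *: "es = xs @ ys"
    have "sz (best xs) \<le> sz xs"
      using best_cases[of xs] sz_mem[of _ xs] by fastforce
    then show "sz (fold (\<lambda>e a. if a = [] \<or> fst (hd0 e a) < fst e then [e] else a) xs []) \<le> sz es"
      using * by (simp add: best_def)
  qed (intro fp_intros pb_intros)+
  then show ?thesis by (simp add: best_def[abs_def])
qed

lemmas fpm_best [fp_intros] = fpm_comp[OF _ fp_best]

lemma fpm_select_by [fp_intros]:
  assumes "fpm p v" "fpm p (l :: 'e::enc \<Rightarrow> 'a::enc list)"
  shows "fpm p (\<lambda>e. select_by (v e) (l e))"
proof (rule fpm_comp2[OF _ assms])
  let ?f = "\<lambda>x s. (tl (fst s), if hd0 False (fst s) then (x :: 'a) # snd s else snd s)"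
  have eq: "fold ?f xs (v, a) = (drop (length xs) v, rev (select_by v xs) @ a)" for xs v a
    by (induction xs arbitrary: v a) (auto simp: drop_Suc)
  have le: "sz (select_by v xs) \<le> sz xs" for v and xs :: "'a list"
  proof (induction xs arbitrary: v)
    case (Cons x xs)
    from Cons.IH[of "tl v"] show ?case by (cases "hd0 False v") simp_all
  qed simp
  have "fp (\<lambda>z :: bool list \<times> 'a list. rev (snd (fold ?f (snd z) (fst z, []))))"
  proof (intro fpm_rev fpm_snd fpm_fold)
    fix z :: "bool list \<times> 'a list" and xs ys
    assume "snd z = xs @ ys"
    then show "sz (fold ?f xs (fst z, [])) \<le> sz z"
      using le[of "fst z" xs] sz_drop[of "length xs" "fst z"] by (cases z) (simp add: eq)
  qed (intro fp_intros pb_intros)+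
  then show "fp (\<lambda>z. select_by (fst z) (snd z :: 'a list))" by (simp add: eq)
qed

lemma fpm_targets [fp_intros]:
  assumes "fpm p \<sigma>" "fpm p x" "fpm p w" "fpm p vs" "fpm p m"
  shows "fpm p (\<lambda>e. targets (\<sigma> e) (x e) (w e) (vs e) (m e))"
  by (rule fpm_comp5[OF _ assms]) (unfold targets_def, intro fp_intros)

section \<open>Size of the tables of the dynamic program\<close>

lemma set_extensions:
  "set (extensions M V T) =
     {(s + length (filter (\<lambda>u. beats M u y) z), y # z) | s z y. (s, z) \<in> set T \<and> y \<in> set V \<and> y \<notin> set z}"
  (is "_ = ?R")
proof -
  have "e \<in> set (extensions M V T) \<longleftrightarrow> (\<exists>t\<in>set T. \<exists>y. y \<in> set V \<and> y \<notin> set (snd t) \<and>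
      e = (fst t + length (filter (\<lambda>u. beats M u y) (snd t)), y # snd t))" for e
    by (auto simp: extensions_def)
  then show ?thesis by (simp add: set_eq_iff Bex_def) blast
qed

text \<open>Running times have to be bounded on all inputs, including malformed ones. This invariant
  holds without assumptions on the data and still bounds the size of a table.\<close>

definition table_inv :: "nat list \<Rightarrow> nat \<Rightarrow> (nat \<times> nat list) list \<Rightarrow> bool" where
  "table_inv V m T \<longleftrightarrow> (\<forall>(s, z)\<in>set T. length z = m \<and> set z \<subseteq> set V \<and> s \<le> m * m)"

lemma table_inv_extensions:
  assumes "table_inv V m T" shows "table_inv V (Suc m) (extensions M V T)"
proof -
  have le: "s + length (filter P z) \<le> Suc m * Suc m" if "s \<le> m * m" "length z = m" for s P and z :: "nat list"
    using that length_filter_le[of P z] by simp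
  show ?thesis unfolding table_inv_def set_extensions
  proof (clarify)
    fix s z y
    assume "(s, z) \<in> set T" "y \<in> set V"
    with assms have "length z = m" "set z \<subseteq> set V" "s \<le> m * m" unfolding table_inv_def by auto
    with le \<open>y \<in> set V\<close> show "length (y # z) = Suc m \<and> set (y # z) \<subseteq> set V \<and>
        s + length (filter (\<lambda>u. beats M u y) z) \<le> Suc m * Suc m" by simp
  qed
qed

lemma best_subset: "set (best es) \<subseteq> set es"
  using best_cases[of es] by auto

lemma set_dp_step_subset: "set (dp_step M \<sigma> x w vs k T) \<subseteq> set (extensions M (x # \<sigma>) T)"
proof
  fix e assume "e \<in> set (dp_step M \<sigma> x w vs k T)"
  then obtain S where "e \<in> set (best (filter (\<lambda>e. set (snd e) = set S) (extensions M (x # \<sigma>) T)))"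
    unfolding dp_step_def by auto
  from subsetD[OF best_subset this] show "e \<in> set (extensions M (x # \<sigma>) T)" by simp
qed

lemma table_inv_dp_step:
  assumes "table_inv (x # \<sigma>) m T" shows "table_inv (x # \<sigma>) (Suc m) (dp_step M \<sigma> x w vs k T)"
proof -
  from table_inv_extensions[OF assms] set_dp_step_subset show ?thesis unfolding table_inv_def by blast
qed

lemma table_inv_dp: "table_inv (x # \<sigma>) (length ks) (fold (dp_step M \<sigma> x w vs) ks [(0, [])])"
proof (induction ks rule: rev_induct)
  case Nil
  show ?case by (simp add: table_inv_def)
next
  case (snoc k ks)
  from table_inv_dp_step[OF this] show ?case by simp
qed

lemma length_best: "length (best es) \<le> 1"
  using best_cases[of es] by auto

text \<open>A vector yields two candidate sets, and a candidate set contributes at most one entry;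
  the summand 1 covers the initial table.\<close>

lemma length_dp: "length (fold (dp_step M \<sigma> x w vs) ks [(0, [])]) \<le> 2 * length vs + 1"
proof (cases ks rule: rev_cases)
  case (snoc ks' k)
  have "length (concat (map (\<lambda>S. best (f S)) l)) \<le> length l" for f :: "nat list \<Rightarrow> (nat \<times> nat list) list" and l
  proof (induction l)
    case (Cons S l)
    then show ?case using length_best[of "f S"] by simp
  qed simp
  then have "length (dp_step M \<sigma> x w vs k T) \<le> length (targets \<sigma> x w vs k)" for T
    unfolding dp_step_def .
  also have "length (targets \<sigma> x w vs k) = 2 * length vs"
    unfolding targets_def by (induction vs) auto
  finally show ?thesis using snoc by (simp add: le_SucI)
qed simp

lemma sz_nat_list_le: "set xs \<subseteq> set ys \<Longrightarrow> sz (xs :: nat list) \<le> length xs * (sz ys + 1)"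
proof (rule sz_list_le)
  fix x assume "set xs \<subseteq> set ys" "x \<in> set xs"
  then show "sz x \<le> sz ys" using sz_mem[of x ys] by auto
qed

lemma sz_table:
  assumes "table_inv V m T" "length T \<le> L" "m \<le> N"
  shows "sz T \<le> L * (N * N + N * (sz V + 1) + 1 + 1)"
proof -
  have "sz T \<le> length T * ((N * N + N * (sz V + 1) + 1) + 1)"
  proof (rule sz_list_le)
    fix t assume "t \<in> set T"
    then obtain s z where t: "t = (s, z)" and z: "length z = m" "set z \<subseteq> set V" "s \<le> m * m"
      using assms(1) unfolding table_inv_def by (cases t) auto
    have "sz z \<le> N * (sz V + 1)"
      using sz_nat_list_le[OF z(2)] z(1) assms(3) by (meson le_trans mult_le_mono1)
    moreover have "s \<le> N * N" using z(3) assms(3) by (meson le_trans mult_le_mono)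
    ultimately show "sz t \<le> N * N + N * (sz V + 1) + 1" unfolding t by simp
  qed
  also have "\<dots> \<le> L * ((N * N + N * (sz V + 1) + 1) + 1)" using assms(2) by (rule mult_le_mono1)
  finally show ?thesis .
qed

lemma fpm_dp [fp_intros]:
  assumes "fpm p M" "fpm p \<sigma>" "fpm p x" "fpm p w" "fpm p vs"
  shows "fpm p (\<lambda>e. dp (M e) (\<sigma> e) (x e) (w e) (vs e))"
proof (rule fpm_comp5[OF _ assms], unfold dp_def, rule fpm_fold)
  let ?M = "\<lambda>z :: bool list list \<times> nat list \<times> nat \<times> nat \<times> bool list list. fst z"
  let ?\<sigma> = "\<lambda>z :: bool list list \<times> nat list \<times> nat \<times> nat \<times> bool list list. fst (snd z)"
  let ?x = "\<lambda>z :: bool list list \<times> nat list \<times> nat \<times> nat \<times> bool list list. fst (snd (snd z))"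
  let ?w = "\<lambda>z :: bool list list \<times> nat list \<times> nat \<times> nat \<times> bool list list. fst (snd (snd (snd z)))"
  let ?vs = "\<lambda>z :: bool list list \<times> nat list \<times> nat \<times> nat \<times> bool list list. snd (snd (snd (snd z)))"
  let ?h = "\<lambda>z. (2 * length (?vs z) + 1) * (Suc (length (?\<sigma> z)) * Suc (length (?\<sigma> z)) +
    Suc (length (?\<sigma> z)) * (sz (?x z # ?\<sigma> z) + 1) + 1 + 1)"
  show "pb (\<lambda>_. 0) ?h"
    by (intro pb_intros fpm_sz fp_intros pb_mono[OF fpm_sz length_le_sz])
  fix z :: "bool list list \<times> nat list \<times> nat \<times> nat \<times> bool list list" and ks ks'
  assume "map Suc [0..<Suc (length (?\<sigma> z))] = ks @ ks'"
  then have "length ks \<le> Suc (length (?\<sigma> z))"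
    by (metis length_append length_map length_upt diff_zero le_add1)
  then show "sz (fold (dp_step (?M z) (?\<sigma> z) (?x z) (?w z) (?vs z)) ks [(0, [])]) \<le> ?h z"
    by (intro sz_table[OF table_inv_dp length_dp])
qed ((unfold dp_step_def)?, (intro fp_intros)+)

lemma fpm_insert_item [fp_intros]:
  assumes "fpm p M" "fpm p w" "fpm p vs" "fpm p x" "fpm p \<sigma>"
  shows "fpm p (\<lambda>e. insert_item (M e) (w e) (vs e) (x e) (\<sigma> e))"
  unfolding insert_item_def by (intro fp_intros assms)

text \<open>If no candidate survives, the result is the empty list, hence only inequalities. They
  keep the order polynomially bounded during all insertions.\<close>

lemma insert_item_bound:
  "length (insert_item M w vs x \<sigma>) \<le> Suc (length \<sigma>)" "set (insert_item M w vs x \<sigma>) \<subseteq> insert x (set \<sigma>)"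
proof -
  let ?T = "dp M \<sigma> x w vs"
  have inv: "table_inv (x # \<sigma>) (Suc (length \<sigma>)) ?T"
    using table_inv_dp[of x \<sigma> "map Suc [0..<Suc (length \<sigma>)]"] unfolding dp_def by simp
  from best_cases[of ?T] have "length (insert_item M w vs x \<sigma>) \<le> Suc (length \<sigma>) \<and>
      set (insert_item M w vs x \<sigma>) \<subseteq> insert x (set \<sigma>)"
  proof
    assume "\<exists>e\<in>set ?T. best ?T = [e] \<and> (\<forall>e'\<in>set ?T. fst e' \<le> fst e)"
    then obtain s z where "best ?T = [(s, z)]" "(s, z) \<in> set ?T" by fastforce
    with inv show ?thesis unfolding insert_item_def table_inv_def by auto
  qed (simp add: insert_item_def best_def)
  then show "length (insert_item M w vs x \<sigma>) \<le> Suc (length \<sigma>)"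
    "set (insert_item M w vs x \<sigma>) \<subseteq> insert x (set \<sigma>)" by auto
qed

lemma order_items_bound:
  "length (fold (insert_item M w vs) xs []) \<le> length xs \<and> set (fold (insert_item M w vs) xs []) \<subseteq> set xs"
proof (induction xs rule: rev_induct)
  case (snoc x xs)
  let ?\<sigma> = "fold (insert_item M w vs) xs []"
  from insert_item_bound[of M w vs x ?\<sigma>] snoc show ?case by auto
qed simp

lemma fpm_order_items [fp_intros]:
  assumes "fpm p M" "fpm p w" "fpm p vs" "fpm p n"
  shows "fpm p (\<lambda>e. order_items (M e) (w e) (vs e) (n e))"
proof (rule fpm_comp4[OF _ assms], unfold order_items_def, rule fpm_fold)
  let ?n = "\<lambda>z :: bool list list \<times> nat \<times> bool list list \<times> nat. snd (snd (snd z))"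
  show "pb (\<lambda>_. 0) (\<lambda>z. ?n z * (sz [0..<?n z] + 1))"
    using fpm_sz[of "\<lambda>_. 0" ?n] by (intro pb_intros fpm_sz[of _ "\<lambda>z. [0..<?n z]"] fp_intros) (simp add: fp_intros)
  fix z :: "bool list list \<times> nat \<times> bool list list \<times> nat" and xs ys
  assume *: "[0..<?n z] = xs @ ys"
  then have "length xs \<le> ?n z" by (metis length_append length_upt diff_zero le_add1)
  let ?\<sigma> = "fold (insert_item (fst z) (fst (snd z)) (fst (snd (snd z)))) xs []"
  from order_items_bound[of "fst z" "fst (snd z)" "fst (snd (snd z))" xs]
  have b: "length ?\<sigma> \<le> length xs" "set ?\<sigma> \<subseteq> set xs" by auto
  have "set ?\<sigma> \<subseteq> set [0..<?n z]" using b(2) unfolding * by auto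
  from sz_nat_list_le[OF this] have "sz ?\<sigma> \<le> length ?\<sigma> * (sz [0..<?n z] + 1)" .
  also have "\<dots> \<le> ?n z * (sz [0..<?n z] + 1)"
    using b(1) \<open>length xs \<le> ?n z\<close> by (intro mult_le_mono1) linarith
  finally show "sz ?\<sigma> \<le> ?n z * (sz [0..<?n z] + 1)" .
qed (intro fp_intros)+

section \<open>Positions, logarithms and bit vectors\<close>

lemma position_le: "position i \<sigma> \<le> length \<sigma>"
  by (induction \<sigma> rule: rev_induct) (auto simp: position_def)

lemma fpm_position [fp_intros]:
  assumes "fpm p i" "fpm p \<sigma>"
  shows "fpm p (\<lambda>e. position (i e) (\<sigma> e))"
proof (rule fpm_comp2[OF _ assms], unfold position_def, rule fpm_fold)
  fix z :: "nat \<times> nat list" and xs ys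
  assume "snd z = xs @ ys"
  from append_le_sz[OF this] position_le[of "fst z" xs]
  show "sz (fold (\<lambda>u a. if 0 < a \<or> u = fst z then Suc a else a) xs 0) \<le> sz z"
    by (cases z) (simp add: position_def)
qed (intro fp_intros pb_intros)+

lemma fpm_positions [fp_intros]:
  assumes "fpm p n" "fpm p \<sigma>"
  shows "fpm p (\<lambda>e. positions (n e) (\<sigma> e))"
  by (rule fpm_comp2[OF _ assms]) (unfold positions_def, intro fp_intros)

lemma lg_fold:
  fixes n :: nat and xs :: "unit list"
  defines "f \<equiv> (\<lambda>_ s. if n \<le> snd s then s else (Suc (fst s), snd s + snd s))"
  obtains k where "fold f xs (0, 1) = (k, 2 ^ k)" "k \<le> length xs" "2 ^ k < 2 * n \<or> k = 0"
    "n \<le> 2 ^ k \<or> k = length xs"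
proof -
  have "\<exists>k. fold f xs (0, 1) = (k, 2 ^ k) \<and> k \<le> length xs \<and> (2 ^ k < 2 * n \<or> k = 0) \<and>
      (n \<le> 2 ^ k \<or> k = length xs)"
  proof (induction xs rule: rev_induct)
    case (snoc x xs)
    then obtain k where k: "fold f xs (0, 1) = (k, 2 ^ k)" "k \<le> length xs" "2 ^ k < 2 * n \<or> k = 0"
      "n \<le> 2 ^ k \<or> k = length xs" by blast
    show ?case
    proof (cases "n \<le> 2 ^ k")
      case True
      with k show ?thesis by (intro exI[of _ k]) (auto simp: f_def)
    next
      case False
      with k show ?thesis by (intro exI[of _ "Suc k"]) (auto simp: f_def)
    qed
  qed simp
  with that show ?thesis by blast
qed

text \<open>Doubling for \<open>n\<close> rounds would give an exponentially large number in unary.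
  As it stops once \<open>n\<close> is reached, the power stays below \<open>2 * n\<close> or is
  1.\<close>

lemma fpm_lg [fp_intros]:
  assumes "fpm p n"
  shows "fpm p (\<lambda>e. lg (n e))"
proof (rule fpm_comp[OF assms], unfold lg_def, intro fpm_fst fpm_fold)
  fix n :: nat and xs ys :: "unit list"
  assume "replicate n () = xs @ ys"
  then have n: "length xs \<le> n" by (metis length_append length_replicate le_add1)
  obtain k where k: "fold (\<lambda>_ s. if n \<le> snd s then s else (Suc (fst s), snd s + snd s)) xs (0, 1) = (k, 2 ^ k)"
      "k \<le> length xs" "2 ^ k < 2 * n \<or> k = 0" "n \<le> 2 ^ k \<or> k = length xs"
    by (rule lg_fold[of n xs])
  have "(2::nat) ^ k \<le> 2 * n + 1" using k(3) by auto
  with k(2) n show "sz (fold (\<lambda>_ s. if n \<le> snd s then s else (Suc (fst s), snd s + snd s)) xs (0, 1)) \<le> 3 * sz n + 2"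
    unfolding k(1) by simp
qed (intro fp_intros pb_intros)+

lemma lg_bounds:
  assumes "2 \<le> n"
  shows "1 \<le> lg n" "log 2 n \<le> lg n" "lg n \<le> 2 * log 2 n"
proof -
  obtain k where k: "fold (\<lambda>_ s. if n \<le> snd s then s else (Suc (fst s), snd s + snd s)) (replicate n ()) (0, 1) = (k, 2 ^ k)"
      "k \<le> length (replicate n ())" "2 ^ k < 2 * n \<or> k = 0" "n \<le> 2 ^ k \<or> k = length (replicate n ())"
    by (rule lg_fold[of n "replicate n ()"])
  then have lg: "lg n = k" by (simp add: lg_def)
  \<comment> \<open>The \<open>n\<close> rounds suffice because \<open>n < 2 ^ n\<close>.\<close>
  have "n \<le> 2 ^ k" using k(4) less_exp[of n] by auto
  with assms have "k \<noteq> 0" by (cases k) auto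
  then show "1 \<le> lg n" by (simp add: lg)
  from \<open>n \<le> 2 ^ k\<close> have "real n \<le> 2 ^ k" by (metis of_nat_le_iff of_nat_numeral of_nat_power)
  then have "log 2 n \<le> log 2 (2 ^ k)" using assms by (intro log_mono) auto
  then show "log 2 n \<le> lg n" by (simp add: lg log_nat_power)
  from k(3) \<open>k \<noteq> 0\<close> have "real (2 ^ k) < real (2 * n)" by (subst of_nat_less_iff) simp
  then have "log 2 (2 ^ k) < log 2 (2 * n)" by (intro log_less) auto
  then have "k < 1 + log 2 n" using assms by (simp add: log_nat_power log_mult)
  moreover have "1 \<le> log 2 n" using assms by simp
  ultimately show "lg n \<le> 2 * log 2 n" by (simp add: lg)
qed

lemma fp_window: "fp window"
proof -
  have "fp (\<lambda>I :: input. 2 * (520 * (fst (snd I) + 1) * fst I ^ 4 * lg (fst (snd (snd I)))))"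
    by (intro fp_intros)
  then show ?thesis by (rule back_subst[of fp]) (auto simp: disp_bound_def fun_eq_iff)
qed

lemmas fpm_window [fp_intros] = fpm_comp[OF _ fp_window]

lemma fp_rank_items: "fp rank_items"
proof -
  have "fp (\<lambda>z :: bool list list \<times> input. positions (fst (snd (snd (snd z))))
     (order_items (fst (snd (snd (snd (snd z))))) (window (snd z)) (fst z) (fst (snd (snd (snd z))))))"
    by (intro fp_intros)
  then show ?thesis by (rule back_subst[of fp]) (auto simp: fun_eq_iff)
qed

lemma length_bit_vectors: "length (bit_vectors k) = 2 ^ k"
  and length_bit_vector: "v \<in> set (bit_vectors k) \<Longrightarrow> length v = k"
proof (induction k arbitrary: v)
  case (Suc k)
  have *: "bit_vectors (Suc k) = map ((#) True) (bit_vectors k) @ map ((#) False) (bit_vectors k)"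
    by (simp add: bit_vectors_def fold_units del: replicate_Suc)
  { case 1 show ?case using Suc by (simp add: *) }
  { case 2 then show ?case using Suc by (auto simp: *) }
qed (simp_all add: bit_vectors_def)

lemma bit_vectors_complete: "length v = k \<Longrightarrow> v \<in> set (bit_vectors k)"
proof (induction k arbitrary: v)
  case (Suc k)
  have *: "bit_vectors (Suc k) = map ((#) True) (bit_vectors k) @ map ((#) False) (bit_vectors k)"
    by (simp add: bit_vectors_def fold_units del: replicate_Suc)
  from Suc.prems obtain b u where "v = b # u" "length u = k" by (cases v) auto
  with Suc.IH show ?case by (cases b) (auto simp: *)
qed (simp add: bit_vectors_def)

lemma sz_bool_le: "sz (b :: bool) \<le> 1"
  by (cases b) auto

lemma sz_bit_vectors: "sz (bit_vectors k) \<le> 2 ^ k * (k * 2 + 1)"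
proof -
  have "sz v \<le> k * 2" if "v \<in> set (bit_vectors k)" for v
    using sz_list_le[of v 1] sz_bool_le length_bit_vector[OF that] by simp
  then have "sz (bit_vectors k) \<le> length (bit_vectors k) * (k * 2 + 1)" by (rule sz_list_le)
  then show ?thesis by (simp add: length_bit_vectors)
qed

text \<open>This is where the potential enters: it has to dominate the number of vectors.\<close>

lemma fpm_bit_vectors:
  assumes "fpm p k" "pb p (\<lambda>e. 2 ^ k e)"
  shows "fpm p (\<lambda>e. bit_vectors (k e))"
  unfolding bit_vectors_def
proof (rule fpm_fold)
  have "pb p (\<lambda>e. sz (k e))" by (rule fpm_sz[OF assms(1)])
  then show "pb p (\<lambda>e. 2 ^ k e * (k e * 2 + 1))" unfolding sz_nat by (intro pb_intros assms)
  fix e and xs ys :: "unit list"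
  assume "replicate (k e) () = xs @ ys"
  then have "length xs \<le> k e" by (metis length_append length_replicate le_add1)
  then have "(2::nat) ^ length xs * (length xs * 2 + 1) \<le> 2 ^ k e * (k e * 2 + 1)"
    by (intro mult_le_mono power_increasing add_mono) auto
  with sz_bit_vectors[of "length xs"]
  show "sz (fold (\<lambda>_ A. map ((#) True) A @ map ((#) False) A) xs [[]]) \<le> 2 ^ k e * (k e * 2 + 1)"
    by (simp add: bit_vectors_def fold_any_units)
qed (intro fp_intros assms)+

lemma fpm_algorithm: "fpm (\<lambda>I. 2 ^ (2 * window I)) algorithm"
  unfolding algorithm_def
  by (intro fpm_comp[OF _ fp_rank_items] fp_intros fpm_bit_vectors pb_intros) 

section \<open>Optimal orders are close to the true order\<close>

primrec agreement :: "('a \<Rightarrow> 'a \<Rightarrow> bool) \<Rightarrow> 'a list \<Rightarrow> nat" where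
  "agreement R [] = 0"
| "agreement R (x # xs) = length (filter (R x) xs) + agreement R xs"

definition optimal_order :: "('a \<Rightarrow> 'a \<Rightarrow> bool) \<Rightarrow> 'a list \<Rightarrow> bool" where
  "optimal_order R z \<longleftrightarrow> distinct z \<and>
     (\<forall>z'. distinct z' \<longrightarrow> set z' = set z \<longrightarrow> agreement R z' \<le> agreement R z)"

definition tournament :: "('a \<Rightarrow> 'a \<Rightarrow> bool) \<Rightarrow> 'a set \<Rightarrow> bool" where
  "tournament R V \<longleftrightarrow> (\<forall>x\<in>V. \<forall>y\<in>V. x \<noteq> y \<longrightarrow> R x y \<noteq> R y x)"

definition pair_sign :: "('a \<Rightarrow> 'a \<Rightarrow> bool) \<Rightarrow> 'a \<times> 'a \<Rightarrow> int" where
  "pair_sign R p = (if R (fst p) (snd p) then 1 else - 1)"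

section \<open>Orders as sets of pairs\<close>

primrec before :: "'a list \<Rightarrow> ('a \<times> 'a) set" where
  "before [] = {}"
| "before (x # xs) = {x} \<times> set xs \<union> before xs"

lemma before_subset: "before z \<subseteq> set z \<times> set z"
  by (induction z) auto

lemma finite_before [simp]: "finite (before z)"
  using before_subset by (rule finite_subset) simp

lemma before_append: "before (xs @ ys) = before xs \<union> before ys \<union> set xs \<times> set ys"
  by (induction xs) auto

lemma before_rev: "before (rev z) = (before z)\<inverse>"
  by (induction z) (auto simp: before_append)

lemma before_irrefl: "distinct z \<Longrightarrow> (x, x) \<notin> before z"
  using before_subset by (induction z) auto

lemma before_total: "x \<in> set z \<Longrightarrow> y \<in> set z \<Longrightarrow> x \<noteq> y \<Longrightarrow> (x, y) \<in> before z \<or> (y, x) \<in> before z"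
  by (induction z) auto

lemma before_asym: "distinct z \<Longrightarrow> (x, y) \<in> before z \<Longrightarrow> (y, x) \<notin> before z"
proof (induction z)
  case (Cons a z)
  then show ?case using before_subset[of z] by auto
qed simp

lemma before_iff_nth:
  assumes "distinct z" "i < length z" "j < length z"
  shows "(z ! i, z ! j) \<in> before z \<longleftrightarrow> i < j"
proof -
  have *: "(z ! i, z ! j) \<in> before z" if "i < j" "j < length z" for i j
    using that
  proof (induction z arbitrary: i j)
    case (Cons a z)
    show ?case
    proof (cases i)
      case 0
      with Cons.prems show ?thesis by (cases j) auto
    next
      case (Suc i')
      with Cons.prems Cons.IH[of i' "j - 1"] show ?thesis by (cases j) auto
    qed
  qed simp
  show ?thesis
    using *[of i j] *[of j i] before_asym[OF assms(1), of "z ! i" "z ! j"]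
      before_irrefl[OF assms(1), of "z ! i"] assms by (cases i j rule: linorder_cases) auto
qed

lemma agreement_card: "distinct z \<Longrightarrow> agreement R z = card {p \<in> before z. R (fst p) (snd p)}"
proof (induction z)
  case (Cons x z)
  have "{p \<in> before (x # z). R (fst p) (snd p)} = Pair x ` {y \<in> set z. R x y} \<union> {p \<in> before z. R (fst p) (snd p)}"
    by auto
  also have "card \<dots> = card (Pair x ` {y \<in> set z. R x y}) + card {p \<in> before z. R (fst p) (snd p)}"
    using Cons.prems before_subset[of z] by (intro card_Un_disjoint) auto
  also have "card (Pair x ` {y \<in> set z. R x y}) = card {y \<in> set z. R x y}"
    by (intro card_image inj_onI) auto
  also have "\<dots> = length (filter (R x) z)"
    using Cons.prems distinct_card[of "filter (R x) z"] by simp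
  finally show ?case using Cons by simp
qed simp

lemma agreement_snoc:
  "agreement R (z @ [y]) = agreement R z + length (filter (\<lambda>u. R u y) z)"
  by (induction z) auto

lemma sum_pair_sign: "finite D \<Longrightarrow> sum (pair_sign R) D = int (card {p \<in> D. R (fst p) (snd p)}) - int (card {p \<in> D. \<not> R (fst p) (snd p)})"
proof -
  assume "finite D"
  then have "sum (pair_sign R) D = sum (pair_sign R) {p \<in> D. R (fst p) (snd p)} + sum (pair_sign R) {p \<in> D. \<not> R (fst p) (snd p)}"
    by (subst sum.union_disjoint[symmetric]) (auto intro: sum.cong)
  then show ?thesis by (simp add: pair_sign_def)
qed

text \<open>Passing from one order to another only affects the pairs that are reversed.\<close>

lemma agreement_diff:
  assumes "distinct b" "distinct b'" "set b = set b'" "tournament R (set b)"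
  shows "int (agreement R b') - int (agreement R b) = sum (pair_sign R) (before b' - before b)"
proof -
  let ?D = "before b' - before b"
  let ?P = "\<lambda>p. R (fst p) (snd p)"
  \<comment> \<open>The pairs lost are the gained pairs turned around.\<close>
  have eq: "before b - before b' = ?D\<inverse>"
  proof -
    have "(x, y) \<in> before b - before b' \<longleftrightarrow> (y, x) \<in> ?D" for x y
      using assms before_subset[of b] before_subset[of b'] before_total[of x b y] before_total[of x b' y]
        before_asym[of b x y] before_asym[of b' y x] before_irrefl[of b x] before_irrefl[of b' x]
      by (cases "x = y") (auto dest: before_asym)
    then show ?thesis by auto
  qed
  have split: "card {p \<in> before c. ?P p} = card {p \<in> before b \<inter> before b'. ?P p} + card {p \<in> before c - (before b \<inter> before b'). ?P p}"
    if "before b \<inter> before b' \<subseteq> before c" for c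
  proof -
    have "{p \<in> before c. ?P p} = {p \<in> before b \<inter> before b'. ?P p} \<union> {p \<in> before c - (before b \<inter> before b'). ?P p}"
      using that by auto
    then show ?thesis by (simp add: card_Un_disjoint disjoint_iff)
  qed
  \<comment> \<open>In a tournament, an agreement on a lost pair is a disagreement on the gained
    pair.\<close>
  have "{p \<in> ?D\<inverse>. ?P p} = prod.swap ` {p \<in> ?D. \<not> ?P p}"
  proof -
    have "R y x \<longleftrightarrow> \<not> R x y" if "(x, y) \<in> ?D" for x y
    proof -
      have "x \<in> set b" "y \<in> set b" "x \<noteq> y"
        using that before_subset[of b'] before_irrefl[of b' x] assms(2,3) by auto
      with assms(4) show ?thesis unfolding tournament_def by blast
    qed
    then show ?thesis by (force simp: image_iff)
  qed
  then have "card {p \<in> ?D\<inverse>. ?P p} = card {p \<in> ?D. \<not> ?P p}"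
    by (simp add: card_image)
  moreover have "agreement R b = card {p \<in> before b \<inter> before b'. ?P p} + card {p \<in> ?D\<inverse>. ?P p}"
    using split[of b] by (simp add: agreement_card assms Diff_Int eq)
  moreover have "agreement R b' = card {p \<in> before b \<inter> before b'. ?P p} + card {p \<in> ?D. ?P p}"
    using split[of b'] by (simp add: agreement_card assms Diff_Int)
  ultimately show ?thesis by (simp add: sum_pair_sign)
qed

text \<open>Rearranging a block reverses only pairs inside the block, so the change of the agreement
  is a sum over these.\<close>

lemma optimal_order_block:
  assumes "optimal_order R (u @ b @ v)" "tournament R (set (u @ b @ v))" "distinct b'" "set b' = set b"
  shows "sum (pair_sign R) (before b' - before b) \<le> 0"
proof -
  have d: "distinct (u @ b @ v)" using assms(1) by (simp add: optimal_order_def)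
  have "distinct (u @ b' @ v)" using d assms(3,4) by auto
  moreover have "set (u @ b' @ v) = set (u @ b @ v)" using assms(4) by simp
  ultimately have "agreement R (u @ b' @ v) \<le> agreement R (u @ b @ v)" 
    and *: "int (agreement R (u @ b' @ v)) - int (agreement R (u @ b @ v)) =
      sum (pair_sign R) (before (u @ b' @ v) - before (u @ b @ v))"
    using assms(1,2) d agreement_diff[of "u @ b @ v" "u @ b' @ v" R] unfolding optimal_order_def by auto
  moreover have "before (u @ b' @ v) - before (u @ b @ v) = before b' - before b"
    using before_subset[of b'] before_subset[of b] before_subset[of u] before_subset[of v] d assms(4)
    by (auto simp: before_append)
  ultimately show ?thesis by simp
qed

text \<open>\<open>\<kappa>\<close> is a key of the true order: the item with the smaller key
  belongs first. Pairs are oriented as in the true order, so that \<open>pair_sign\<close> is 1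
  exactly for correct outcomes. Integer keys can be negated to reverse the order.\<close>

definition inversions :: "('a \<Rightarrow> int) \<Rightarrow> 'a list \<Rightarrow> ('a \<times> 'a) set" where
  "inversions \<kappa> b = {(x, y). \<kappa> x < \<kappa> y \<and> (y, x) \<in> before b}"

lemma finite_inversions [simp]: "finite (inversions \<kappa> b)"
  by (rule finite_subset[of _ "(before b)\<inverse>"]) (auto simp: inversions_def)

lemma inversions_subset: "inversions \<kappa> b \<subseteq> set b \<times> set b"
  using before_subset[of b] by (auto simp: inversions_def)

text \<open>A condition on the noise alone, which does not refer to optimal orders and is thus
  accessible to a union bound over all lists. The name reflects its consequence for blocks of
  optimal orders.\<close>

definition few_inversions :: "('a \<Rightarrow> 'a \<Rightarrow> bool) \<Rightarrow> ('a \<Rightarrow> int) \<Rightarrow> 'a set \<Rightarrow> nat \<Rightarrow> bool" where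
  "few_inversions R \<kappa> V K \<longleftrightarrow> (\<forall>b. distinct b \<longrightarrow> set b \<subseteq> V \<longrightarrow> b \<noteq> [] \<longrightarrow>
     K * length b \<le> card (inversions \<kappa> b) \<longrightarrow> 0 < sum (pair_sign R) (inversions \<kappa> b))"

lemma before_sort_key:
  assumes "distinct b" "inj_on \<kappa> (set b)"
  shows "before (sort_key (\<kappa> :: 'a \<Rightarrow> int) b) = {(x, y). x \<in> set b \<and> y \<in> set b \<and> \<kappa> x < \<kappa> y}"
proof -
  have "before c = {(x, y). x \<in> set c \<and> y \<in> set c \<and> \<kappa> x < \<kappa> y}"
    if "distinct c" "sorted (map \<kappa> c)" "inj_on \<kappa> (set c)" for c
    using that
  proof (induction c)
    case (Cons a c)
    then have "\<kappa> a < \<kappa> y" if "y \<in> set c" for y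
      using that by (force simp: inj_on_def order_less_le)
    moreover have "before c = {(x, y). x \<in> set c \<and> y \<in> set c \<and> \<kappa> x < \<kappa> y}"
      using Cons by auto
    ultimately show ?case by fastforce
  qed simp
  from this[of "sort_key \<kappa> b"] show ?thesis using assms by simp
qed

text \<open>Sorting the block correctly gains the sum of the signs over its inversions. If there
  were too many inversions, this gain would be positive.\<close>

lemma card_inversions_optimal_block:
  assumes "optimal_order R (u @ b @ v)" "tournament R (set (u @ b @ v))" "inj_on \<kappa> (set (u @ b @ v))"
    "few_inversions R \<kappa> (set (u @ b @ v)) K" "b \<noteq> []"
  shows "card (inversions \<kappa> b) < K * length b"
proof (rule ccontr)
  assume many: "\<not> ?thesis"
  have d: "distinct b" using assms(1) by (simp add: optimal_order_def)
  have inj: "inj_on \<kappa> (set b)" using assms(3) by (rule inj_on_subset) auto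
  have "before (sort_key \<kappa> b) - before b = inversions \<kappa> b"
  proof -
    have "x \<in> set b \<and> y \<in> set b \<and> \<kappa> x < \<kappa> y \<and> (x, y) \<notin> before b \<longleftrightarrow> \<kappa> x < \<kappa> y \<and> (y, x) \<in> before b" for x y
      using before_total[of x b y] before_asym[OF d, of y x] before_subset[of b] by auto
    then show ?thesis unfolding before_sort_key[OF d inj] inversions_def by auto
  qed
  moreover have "sum (pair_sign R) (before (sort_key \<kappa> b) - before b) \<le> 0"
    using assms(1,2) d by (intro optimal_order_block[of R u b v]) auto
  moreover have "0 < sum (pair_sign R) (inversions \<kappa> b)"
    using many assms(4,5) d unfolding few_inversions_def by auto
  ultimately show False by simp
qed

text \<open>Moving \<open>x\<close> from the end of a block to its front reverses exactly the pairs
  of \<open>x\<close> with the rest of the block.\<close>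

lemma optimal_order_move:
  assumes "optimal_order R (u @ (ys @ [x]) @ v)" "tournament R (set (u @ (ys @ [x]) @ v))"
  shows "(\<Sum>y\<in>set ys. pair_sign R (x, y)) \<le> 0"
proof -
  have d: "distinct (ys @ [x])" using assms(1) by (auto simp: optimal_order_def)
  have "before (x # ys) - before (ys @ [x]) = Pair x ` set ys"
    using d before_subset[of ys] by (auto simp: before_append)
  moreover have "sum (pair_sign R) (before (x # ys) - before (ys @ [x])) \<le> 0"
    using assms d by (intro optimal_order_block[of R u "ys @ [x]" v]) auto
  ultimately show ?thesis by (simp add: sum.reindex inj_on_def)
qed

section \<open>True positions within a subset of the items\<close>

definition rank_in :: "('a \<Rightarrow> int) \<Rightarrow> 'a set \<Rightarrow> 'a \<Rightarrow> nat" where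
  "rank_in \<kappa> V x = card {y \<in> V. \<kappa> y < \<kappa> x}"

lemma rank_in_mono_iff:
  assumes "finite V" "inj_on \<kappa> V" "x \<in> V" "y \<in> V"
  shows "rank_in \<kappa> V x < rank_in \<kappa> V y \<longleftrightarrow> \<kappa> x < \<kappa> y"
proof -
  have *: "rank_in \<kappa> V x < rank_in \<kappa> V y" if "\<kappa> x < \<kappa> y" "x \<in> V" for x y
    unfolding rank_in_def using that assms(1) by (intro psubset_card_mono) auto
  from *[of x y] *[of y x] assms show ?thesis
    by (cases "\<kappa> x" "\<kappa> y" rule: linorder_cases) (auto dest: inj_onD)
qed

lemma rank_in_less: "finite V \<Longrightarrow> x \<in> V \<Longrightarrow> rank_in \<kappa> V x < card V"
  unfolding rank_in_def by (intro psubset_card_mono) auto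

lemma bij_betw_rank_in:
  assumes "finite V" "inj_on \<kappa> V"
  shows "bij_betw (rank_in \<kappa> V) V {..<card V}"
proof -
  have inj: "inj_on (rank_in \<kappa> V) V"
  proof (rule inj_onI)
    fix x y assume xy: "x \<in> V" "y \<in> V" "rank_in \<kappa> V x = rank_in \<kappa> V y"
    with rank_in_mono_iff[OF assms, of x y] rank_in_mono_iff[OF assms, of y x]
    have "\<kappa> x = \<kappa> y" by linarith
    with xy assms show "x = y" by (auto dest: inj_onD)
  qed
  moreover have "rank_in \<kappa> V ` V = {..<card V}"
    using rank_in_less[OF assms(1)] card_image[OF inj] by (intro card_subset_eq) auto
  ultimately show ?thesis by (simp add: bij_betw_def)
qed

definition successors :: "('a \<Rightarrow> int) \<Rightarrow> 'a set \<Rightarrow> 'a \<Rightarrow> nat \<Rightarrow> 'a set" where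
  "successors \<kappa> V x W = {y \<in> V. rank_in \<kappa> V x < rank_in \<kappa> V y \<and> rank_in \<kappa> V y \<le> rank_in \<kappa> V x + W}"

text \<open>A single correctly oriented pair has expected sign at least \<open>2 * \<gamma>\<close>,
  so \<open>\<gamma> * W\<close> is half the expected surplus. The condition on the rank guarantees
  that \<open>W\<close> successors exist.\<close>

definition mostly_beats ::
    "('a \<Rightarrow> 'a \<Rightarrow> bool) \<Rightarrow> ('a \<Rightarrow> int) \<Rightarrow> 'a set \<Rightarrow> real \<Rightarrow> nat \<Rightarrow> bool" where
  "mostly_beats R \<kappa> V \<gamma> W0 \<longleftrightarrow> (\<forall>x\<in>V. \<forall>W\<ge>W0. rank_in \<kappa> V x + W < card V \<longrightarrow>
     \<gamma> * W \<le> real_of_int (\<Sum>y\<in>successors \<kappa> V x W. pair_sign R (x, y)))"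

section \<open>The largest displacement\<close>

lemma card_vimage_bij:
  assumes "bij_betw f V {..<N}" "c \<le> N"
  shows "card {y \<in> V. f y < c} = c"
proof -
  have "bij_betw f {y \<in> V. f y < c} {..<c}"
    using assms unfolding bij_betw_def by (auto simp: inj_on_def image_def set_eq_iff) (metis lessThan_iff order_less_le_trans)
  from bij_betw_same_card[OF this] show ?thesis by simp
qed

text \<open>The item at index \<open>m\<close> stands \<open>W\<close> places after its true
  position, and no displacement exceeds \<open>W\<close>. The case of an item standing too early is
  reduced to this one by reversal.\<close>

lemma max_displacement_aux:
  assumes opt: "optimal_order R z" and tour: "tournament R (set z)" and inj: "inj_on \<kappa> (set z)"
    and few: "few_inversions R \<kappa> (set z) K" and beats: "mostly_beats R \<kappa> (set z) \<gamma> W0"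
    and W0: "64 * real K \<le> \<gamma>\<^sup>2 * W0" "0 < W0" "0 < \<gamma>"
    and W: "W0 \<le> W" "\<And>i. i < length z \<Longrightarrow> i \<le> rank_in \<kappa> (set z) (z ! i) + W"
      "\<And>i. i < length z \<Longrightarrow> rank_in \<kappa> (set z) (z ! i) \<le> i + W"
    and m: "m < length z" "m = rank_in \<kappa> (set z) (z ! m) + W"
  shows False
proof -
  define V N where "V = set z" and "N = length z"
  define rk where "rk = rank_in \<kappa> V"
  define x r where "x = z ! m" and "r = rk x"
  have d: "distinct z" using opt by (simp add: optimal_order_def)
  have N: "card V = N" using d by (simp add: V_def N_def distinct_card)
  have "bij_betw ((!) z) {..<N} V" using d unfolding V_def N_def by (intro bij_betw_nth) auto
  then have bijp: "bij_betw (inv_into {..<N} ((!) z)) V {..<N}" by (rule bij_betw_inv_into)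
  define p where "p = inv_into {..<N} ((!) z)"
  note bijp = bijp[folded p_def]
  have zp: "z ! p y = y" "p y < N" if "y \<in> V" for y
    using that \<open>bij_betw ((!) z) {..<N} V\<close> bijp unfolding p_def
    by (auto simp: bij_betw_def f_inv_into_f)
  have pz: "p (z ! i) = i" if "i < N" for i
    using that \<open>bij_betw ((!) z) {..<N} V\<close> unfolding p_def by (auto simp: bij_betw_def inv_into_f_f)
  have bijr: "bij_betw rk V {..<N}"
    unfolding rk_def N[symmetric] using inj by (intro bij_betw_rank_in) (auto simp: V_def)
  have rk_less: "rk y < rk y' \<longleftrightarrow> \<kappa> y < \<kappa> y'" if "y \<in> V" "y' \<in> V" for y y'
    unfolding rk_def using inj that by (intro rank_in_mono_iff) (auto simp: V_def)
  have W': "p y \<le> rk y + W" "rk y \<le> p y + W" if "y \<in> V" for y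
    using W(2)[of "p y"] W(3)[of "p y"] zp[OF that] by (auto simp: rk_def V_def N_def)
  have x: "x \<in> V" "p x = r + W" "r + W < N"
    using m pz[of m] by (auto simp: x_def V_def r_def rk_def N_def)
  have before_p: "(y, y') \<in> before z \<longleftrightarrow> p y < p y'" if "y \<in> V" "y' \<in> V" for y y'
    using before_iff_nth[OF d, of "p y" "p y'"] zp[OF that(1)] zp[OF that(2)] by (simp add: N_def)
  \<comment> \<open>For a cut before index \<open>c\<close>, the items of \<open>A c\<close> belong
    in front of the cut but stand behind it; for \<open>B c\<close> it is the other way
    round.\<close>
  define A B where "A c = {y \<in> V. rk y < c \<and> c \<le> p y}" and "B c = {y \<in> V. p y < c \<and> c \<le> rk y}" for c
  have fin: "finite V" "finite (A c)" "finite (B c)" for c by (auto simp: V_def A_def B_def)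
  \<comment> \<open>In both orders exactly \<open>c\<close> items lie in front of the cut.\<close>
  have AB: "card (A c) = card (B c)" if "c \<le> N" for c
  proof -
    have "card {y \<in> V. rk y < c} = card {y \<in> V. p y < c}"
      using card_vimage_bij[OF bijr that] card_vimage_bij[OF bijp that] by simp
    then have "card ({y \<in> V. rk y < c} - {y \<in> V. p y < c}) = card ({y \<in> V. p y < c} - {y \<in> V. rk y < c})"
      using fin by (simp add: card_Diff_subset_Int Int_commute)
    moreover have "A c = {y \<in> V. rk y < c} - {y \<in> V. p y < c}" "B c = {y \<in> V. p y < c} - {y \<in> V. rk y < c}"
      by (auto simp: A_def B_def)
    ultimately show ?thesis by simp
  qed
  \<comment> \<open>The cuts will be \<open>r\<close>, just before the true position of
    \<open>x\<close>, and \<open>r + W + 1\<close>, just after its actual position. Items displaced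
    across one of them by at most \<open>W\<close> stand between \<open>r - W\<close> and
    \<open>r + 2 * W\<close>; if \<open>r < W\<close>, then truncation makes the block start at
    0.\<close>
  define s where "s = r - W"
  define b where "b = take (3 * W + 1) (drop s z)"
  obtain u v where z: "z = u @ b @ v" unfolding b_def by (metis append_take_drop_id)
  have mem_b: "y \<in> set b" if "y \<in> V" "s \<le> p y" "p y < s + (3 * W + 1)" for y
  proof -
    have "p y - s < length b" using that zp[OF that(1)] by (simp add: b_def N_def) linarith
    moreover from this have "b ! (p y - s) = y" using that zp[OF that(1)] by (simp add: b_def N_def)
    ultimately show ?thesis by (metis nth_mem)
  qed
  have pos: "0 < W" using W(1) W0(2) by simp
  have xb: "x \<in> set b" using x pos by (intro mem_b) (auto simp: s_def)
  have "card (inversions \<kappa> b) < K * length b"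
    using xb by (intro card_inversions_optimal_block[of R u b v, folded z, OF opt tour inj few]) auto
  also have "\<dots> \<le> K * (4 * W)" using pos by (intro mult_le_mono2) (simp add: b_def)
  finally have inv: "card (inversions \<kappa> b) < 4 * K * W" by simp
  \<comment> \<open>All pairs from \<open>A c\<close> and \<open>B c\<close> are inversions of the
    block, and both sets have the same size, so its square is bounded by the number of
    inversions.\<close>
  have cross: "card (A c) * card (A c) < 4 * K * W"
    if "c \<le> N" and *: "\<And>y. y \<in> A c \<union> B c \<Longrightarrow> s \<le> p y \<and> p y < s + (3 * W + 1)" for c
  proof -
    have "A c \<times> B c \<subseteq> inversions \<kappa> b"
    proof clarify
      fix y y' assume y: "y \<in> A c" "y' \<in> B c"
      then have V: "y \<in> V" "y' \<in> V" by (auto simp: A_def B_def)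
      with * y have b: "y \<in> set b" "y' \<in> set b" by (auto intro!: mem_b)
      have "rk y < rk y'" "p y' < p y" using y by (auto simp: A_def B_def)
      then have "\<kappa> y < \<kappa> y'" "(y, y') \<notin> before z" "y \<noteq> y'" using V rk_less before_p by auto
      moreover have "before b \<subseteq> before (u @ b @ v)" by (auto simp: before_append)
      note this[folded z]
      ultimately show "(y, y') \<in> inversions \<kappa> b"
        using before_total[OF b] by (auto simp: inversions_def)
    qed
    then have "card (A c \<times> B c) \<le> card (inversions \<kappa> b)" by (intro card_mono) auto
    with inv show ?thesis using AB[OF that(1)] by (simp add: card_cartesian_product)
  qed
  have a1: "card (A r) * card (A r) < 4 * K * W"
  proof (rule cross)
    fix y assume "y \<in> A r \<union> B r"
    then show "s \<le> p y \<and> p y < s + (3 * W + 1)"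
      using W'[of y] by (auto simp: A_def B_def s_def)
  qed (use x in simp)
  have a2: "card (A (r + W + 1)) * card (A (r + W + 1)) < 4 * K * W"
  proof (rule cross)
    fix y assume "y \<in> A (r + W + 1) \<union> B (r + W + 1)"
    then show "s \<le> p y \<and> p y < s + (3 * W + 1)"
      using W'[of y] by (auto simp: A_def B_def s_def)
  qed (use x in simp)
  \<comment> \<open>\<open>Y\<close> consists of the items that \<open>x\<close> has to jump over on
    its way back, \<open>J\<close> of those that truly follow it. Both have size
    \<open>W\<close>.\<close>
  define Y J where "Y = {y \<in> V. r \<le> p y \<and> p y < r + W}" and "J = successors \<kappa> V x W"
  have J: "J = {y \<in> V. r < rk y \<and> rk y < r + W + 1}" by (auto simp: J_def successors_def rk_def r_def)
  have card_int: "card {y \<in> V. a \<le> f y \<and> f y < c} = c - a" if "bij_betw f V {..<N}" "a \<le> c" "c \<le> N" for f a c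
  proof -
    have "{y \<in> V. a \<le> f y \<and> f y < c} = {y \<in> V. f y < c} - {y \<in> V. f y < a}" by auto
    then have "card {y \<in> V. a \<le> f y \<and> f y < c} = card {y \<in> V. f y < c} - card {y \<in> V. f y < a}"
      using that(2) fin by (simp add: card_Diff_subset subset_iff)
    with card_vimage_bij[OF that(1)] that show ?thesis by simp
  qed
  have cY: "card Y = W" unfolding Y_def using card_int[OF bijp, of r "r + W"] x by simp
  have cJ: "card J = W" unfolding J using card_int[OF bijr, of "r + 1" "r + W + 1"] x by (simp add: Suc_le_eq)
  have finYJ: "finite Y" "finite J" using fin by (auto simp: Y_def J)
  have cd: "card (J - Y) = card (Y - J)"
    using finYJ cY cJ by (simp add: card_Diff_subset_Int Int_commute)
  \<comment> \<open>An item of \<open>Y\<close> outside \<open>J\<close> has a true position below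
    \<open>r\<close> or above \<open>r + W\<close>, since only \<open>x\<close> has true position
    \<open>r\<close>.\<close>
  have "Y - J \<subseteq> A r \<union> B (r + W + 1)"
  proof
    fix y assume y: "y \<in> Y - J"
    then have yV: "y \<in> V" and "y \<noteq> x" using x by (auto simp: Y_def)
    then have "rk y \<noteq> r" using bijr x(1) unfolding r_def bij_betw_def by (auto dest: inj_onD)
    with y yV show "y \<in> A r \<union> B (r + W + 1)" by (auto simp: Y_def J A_def B_def)
  qed
  then have "card (Y - J) \<le> card (A r \<union> B (r + W + 1))" using fin by (intro card_mono) auto
  also have "\<dots> \<le> card (A r) + card (B (r + W + 1))" by (rule card_Un_le)
  finally have YJ: "card (Y - J) \<le> card (A r) + card (A (r + W + 1))" using AB x by simp
  have "r + W < length z" using x by (simp add: N_def)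
  have "x = z ! (r + W)" using zp(1)[OF x(1)] x(2) by simp
  have z': "z = take r z @ (take W (drop r z) @ [x]) @ drop (Suc W) (drop r z)"
  proof -
    have "drop r z = take (Suc W) (drop r z) @ drop (Suc W) (drop r z)" by (simp only: append_take_drop_id)
    also have "take (Suc W) (drop r z) = take W (drop r z) @ [x]"
      using \<open>r + W < length z\<close> \<open>x = z ! (r + W)\<close> by (subst take_Suc_conv_app_nth) auto
    finally show ?thesis by (metis append_take_drop_id)
  qed
  have setY: "set (take W (drop r z)) = Y"
  proof -
    have "y \<in> set (take W (drop r z)) \<longleftrightarrow> (\<exists>i<W. y = z ! (r + i))" for y
      using \<open>r + W < length z\<close> by (auto simp: in_set_conv_nth)
    moreover have "(\<exists>i<W. y = z ! (r + i)) \<longleftrightarrow> y \<in> Y" for y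
    proof
      assume "\<exists>i<W. y = z ! (r + i)"
      then obtain i where "i < W" "y = z ! (r + i)" by blast
      then show "y \<in> Y" using \<open>r + W < length z\<close> pz[of "r + i"] by (auto simp: Y_def V_def N_def)
    next
      assume "y \<in> Y"
      then have "y = z ! (r + (p y - r))" "p y - r < W" using zp(1)[of y] by (auto simp: Y_def)
      then show "\<exists>i<W. y = z ! (r + i)" by blast
    qed
    ultimately show ?thesis by blast
  qed
  \<comment> \<open>Moving \<open>x\<close> from \<open>r + W\<close> back to \<open>r\<close>
    cannot improve an optimal order.\<close>
  have "(\<Sum>y\<in>Y. pair_sign R (x, y)) \<le> 0"
    unfolding setY[symmetric]
    using optimal_order_move[of R "take r z" "take W (drop r z)" x "drop (Suc W) (drop r z)"] opt tour
    by (simp only: z'[symmetric])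
  \<comment> \<open>The sums over \<open>J\<close> and \<open>Y\<close> differ only on the two set
    differences, which have equal size. So the surplus of \<open>x\<close> on \<open>J\<close> is at
    most \<open>2 * card (Y - J)\<close>.\<close>
  moreover have "(\<Sum>y\<in>J. pair_sign R (x, y)) - (\<Sum>y\<in>Y. pair_sign R (x, y)) =
      (\<Sum>y\<in>J - Y. pair_sign R (x, y)) - (\<Sum>y\<in>Y - J. pair_sign R (x, y))"
  proof -
    have "(\<Sum>y\<in>J. pair_sign R (x, y)) = (\<Sum>y\<in>J \<inter> Y. pair_sign R (x, y)) + (\<Sum>y\<in>J - Y. pair_sign R (x, y))"
      using finYJ by (subst sum.union_disjoint[symmetric]) (auto intro: sum.cong)
    moreover have "(\<Sum>y\<in>Y. pair_sign R (x, y)) = (\<Sum>y\<in>J \<inter> Y. pair_sign R (x, y)) + (\<Sum>y\<in>Y - J. pair_sign R (x, y))"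
      using finYJ by (subst sum.union_disjoint[symmetric]) (auto intro: sum.cong)
    ultimately show ?thesis by simp
  qed
  moreover have "(\<Sum>y\<in>J - Y. pair_sign R (x, y)) \<le> (\<Sum>y\<in>J - Y. 1)" "(\<Sum>y\<in>Y - J. - 1) \<le> (\<Sum>y\<in>Y - J. pair_sign R (x, y))"
    by (intro sum_mono; simp add: pair_sign_def)+
  ultimately have "(\<Sum>y\<in>J. pair_sign R (x, y)) \<le> 2 * int (card (Y - J))" using cd by simp
  moreover have "\<gamma> * W \<le> real_of_int (\<Sum>y\<in>J. pair_sign R (x, y))"
    using beats W(1) x N unfolding mostly_beats_def J_def V_def r_def rk_def by blast
  ultimately have "\<gamma> * W \<le> real_of_int (2 * int (card (Y - J)))"
    by (metis of_int_le_iff order_trans)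
  then have le: "\<gamma> * W \<le> 2 * (real (card (A r)) + real (card (A (r + W + 1))))"
    using YJ by simp
  let ?a = "real (card (A r))" and ?c = "real (card (A (r + W + 1)))"
  have aa: "?a * ?a < 4 * real K * W" using of_nat_less_iff[where 'a = real, THEN iffD2, OF a1] by simp
  have cc: "?c * ?c < 4 * real K * W" using of_nat_less_iff[where 'a = real, THEN iffD2, OF a2] by simp
  \<comment> \<open>The factor 64 arises from
    \<open>(2 * (a + c))\<^sup>2 \<le> 8 * (a\<^sup>2 + c\<^sup>2)\<close>, where both squares are
    below \<open>4 * K * W\<close>.\<close>
  have "(\<gamma> * W)\<^sup>2 \<le> (2 * (?a + ?c))\<^sup>2" using le W0(3) by (intro power_mono) auto
  also have "\<dots> \<le> 8 * (?a * ?a + ?c * ?c)"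
    using sum_squares_ge_zero[of "?a - ?c" 0] by (simp add: power2_eq_square algebra_simps)
  also have "\<dots> < 64 * real K * W" using aa cc by simp
  also have "\<dots> \<le> \<gamma>\<^sup>2 * W0 * W" using W0(1) by (intro mult_right_mono) auto
  also have "\<dots> \<le> \<gamma>\<^sup>2 * W * W" using W(1) by (intro mult_right_mono mult_left_mono) auto
  finally show False by (simp add: power2_eq_square algebra_simps)
qed

section \<open>Reversal symmetry\<close>

lemma swap_image: "prod.swap ` A = A\<inverse>"
  by auto

lemma agreement_rev:
  assumes "distinct c" shows "agreement (\<lambda>x y. R y x) (rev c) = agreement R c"
proof -
  have "{p \<in> before (rev c). R (snd p) (fst p)} = prod.swap ` {p \<in> before c. R (fst p) (snd p)}"
    unfolding before_rev swap_image by auto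
  then show ?thesis using assms by (simp add: agreement_card card_image)
qed

lemma inversions_uminus: "inversions (\<lambda>x. - \<kappa> x) b = prod.swap ` inversions \<kappa> (rev b)"
  unfolding inversions_def before_rev swap_image by auto

lemma rank_in_uminus:
  assumes "distinct z" "inj_on \<kappa> (set z)" "x \<in> set z"
  shows "rank_in (\<lambda>x. - \<kappa> x) (set (rev z)) x + rank_in \<kappa> (set z) x + 1 = length z"
proof -
  let ?A = "{y \<in> set z. \<kappa> y < \<kappa> x}" and ?B = "{y \<in> set z. \<kappa> x < \<kappa> y}"
  have "\<kappa> y < \<kappa> x \<or> \<kappa> x < \<kappa> y \<or> y = x" if "y \<in> set z" for y
    using inj_onD[OF assms(2) _ that assms(3)] by linarith
  then have "set z = insert x (?A \<union> ?B)" using assms(3) by auto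
  then have "card (set z) = card (insert x (?A \<union> ?B))" by (rule arg_cong)
  also have "\<dots> = Suc (card (?A \<union> ?B))" by (intro card_insert_disjoint) auto
  also have "card (?A \<union> ?B) = card ?A + card ?B" by (intro card_Un_disjoint) auto
  finally show ?thesis using distinct_card[OF assms(1)] by (simp add: rank_in_def)
qed

text \<open>If the worst item stands too early, it stands too late after reversing the list, the
  outcomes and the key. All hypotheses are stable under this; the second part of
  \<open>beats\<close> is the reversed form of the first.\<close>

lemma max_displacement:
  assumes opt: "optimal_order R z" and tour: "tournament R (set z)" and inj: "inj_on \<kappa> (set z)"
    and few: "few_inversions R \<kappa> (set z) K"
    and beats: "mostly_beats R \<kappa> (set z) \<gamma> W0" "mostly_beats (\<lambda>x y. R y x) (\<lambda>x. - \<kappa> x) (set z) \<gamma> W0"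
    and W0: "64 * real K \<le> \<gamma>\<^sup>2 * W0" "0 < W0" "0 < \<gamma>"
    and i: "i < length z"
  shows "i < rank_in \<kappa> (set z) (z ! i) + W0 \<and> rank_in \<kappa> (set z) (z ! i) < i + W0"
proof (rule ccontr)
  let ?rk = "rank_in \<kappa> (set z)"
  let ?R = "\<lambda>x y. R y x" and ?k = "\<lambda>x. - \<kappa> x"
  let ?rk' = "rank_in ?k (set (rev z))"
  define disp where "disp j = nat \<bar>int j - int (?rk (z ! j))\<bar>" for j
  define W where "W = Max (disp ` {..<length z})"
  assume "\<not> ?thesis"
  then have "W0 \<le> disp i" by (auto simp: disp_def)
  also have "disp i \<le> W" unfolding W_def using i by (intro Max_ge) auto
  finally have W: "W0 \<le> W" .
  have "W \<in> disp ` {..<length z}" unfolding W_def using i by (intro Max_in) auto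
  then obtain m where m: "m < length z" "disp m = W" by auto
  have le: "disp j \<le> W" if "j < length z" for j unfolding W_def using that by (intro Max_ge) auto
  have d: "distinct z" using opt by (simp add: optimal_order_def)
  show False
  proof (cases "m = ?rk (z ! m) + W")
    case True
    show False
    proof (rule max_displacement_aux[OF opt tour inj few beats(1) W0 W _ _ m(1) True])
      fix j assume "j < length z"
      from le[OF this] show "j \<le> ?rk (z ! j) + W" "?rk (z ! j) \<le> j + W" by (auto simp: disp_def)
    qed
  next
    case False
    then have rm: "?rk (z ! m) = m + W" using m(2) by (auto simp: disp_def)
    note rk' = rank_in_uminus[OF d inj] and agr = agreement_rev[of _ R]
    have opt': "optimal_order ?R (rev z)"
      unfolding optimal_order_def
    proof (intro conjI allI impI)
      fix c assume c: "distinct c" "set c = set (rev z)"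
      then have "agreement R (rev c) \<le> agreement R z" using opt by (auto simp: optimal_order_def)
      then show "agreement ?R c \<le> agreement ?R (rev z)"
        using agr[of "rev c"] agr[OF d] c by simp
    qed (use d in simp)
    have tour': "tournament ?R (set (rev z))" using tour unfolding tournament_def set_rev by blast
    have inj': "inj_on ?k (set (rev z))" using inj by (auto simp: inj_on_def)
    have few': "few_inversions ?R ?k (set (rev z)) K"
      unfolding few_inversions_def
    proof (intro allI impI)
      fix b assume b: "distinct b" "set b \<subseteq> set (rev z)" "b \<noteq> []" "K * length b \<le> card (inversions ?k b)"
      note eq = inversions_uminus[of \<kappa> b]
      then have "K * length (rev b) \<le> card (inversions \<kappa> (rev b))" using b by (simp add: card_image)
      with few b have "0 < sum (pair_sign R) (inversions \<kappa> (rev b))" unfolding few_inversions_def by auto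
      then show "0 < sum (pair_sign ?R) (inversions ?k b)"
        unfolding eq by (subst sum.reindex) (auto simp: pair_sign_def o_def)
    qed
    have beats': "mostly_beats ?R ?k (set (rev z)) \<gamma> W0" using beats(2) by simp
    define m' where "m' = length z - 1 - m"
    have nth: "rev z ! j = z ! (length z - 1 - j)" if "j < length z" for j
      using that by (simp add: rev_nth)
    have m': "m' < length (rev z)" "rev z ! m' = z ! m" using m(1) nth[of m'] by (auto simp: m'_def)
    show False
    proof (rule max_displacement_aux[OF opt' tour' inj' few' beats' W0 W _ _ m'(1)])
      show "m' = ?rk' (rev z ! m') + W"
        using rk'[of "z ! m"] rm m(1) unfolding m'(2) by (simp add: m'_def)
      fix j assume "j < length (rev z)"
      then have j: "j < length z" "length z - 1 - j < length z" by auto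
      show "j \<le> ?rk' (rev z ! j) + W" "?rk' (rev z ! j) \<le> j + W"
        using rk'[of "z ! (length z - 1 - j)"] le[OF j(2)] j unfolding nth[OF j(1)] disp_def
        by auto
    qed
  qed
qed

section \<open>Correctness of the dynamic program\<close>

definition table_sound :: "bool list list \<Rightarrow> nat list \<Rightarrow> nat \<Rightarrow> (nat \<times> nat list) list \<Rightarrow> bool" where
  "table_sound M V m T \<longleftrightarrow> (\<forall>(s, z)\<in>set T. distinct z \<and> length z = m \<and> set z \<subseteq> set V \<and>
     s = agreement (beats M) (rev z))"

lemma table_sound_extensions:
  assumes "table_sound M V m T" shows "table_sound M V (Suc m) (extensions M V T)"
  unfolding table_sound_def set_extensions
proof clarify
  fix s z y
  assume "(s, z) \<in> set T" and y: "y \<in> set V" "y \<notin> set z"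
  with assms have z: "distinct z" "length z = m" "set z \<subseteq> set V" "s = agreement (beats M) (rev z)"
    unfolding table_sound_def by auto
  have "agreement (beats M) (rev (y # z)) = s + length (filter (\<lambda>u. beats M u y) z)"
    using z(4) by (simp add: agreement_snoc flip: rev_filter)
  with z y show "distinct (y # z) \<and> length (y # z) = Suc m \<and> set (y # z) \<subseteq> set V \<and>
      s + length (filter (\<lambda>u. beats M u y) z) = agreement (beats M) (rev (y # z))"
    by simp
qed

lemma table_sound_dp: "table_sound M (x # \<sigma>) (length ks) (fold (dp_step M \<sigma> x w vs) ks [(0, [])])"
proof (induction ks rule: rev_induct)
  case Nil
  show ?case by (simp add: table_sound_def)
next
  case (snoc k ks)
  from table_sound_extensions[OF this] set_dp_step_subset show ?case
    unfolding table_sound_def by fastforce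
qed

lemma best_dominates:
  assumes "e \<in> set es"
  shows "\<exists>e'\<in>set (best es). fst e \<le> fst e'"
  using best_cases[of es] assms by auto

text \<open>An entry at least as good as \<open>\<tau>\<close> on the first \<open>m\<close> items
  stays so when extended by the next item of \<open>\<tau>\<close>, because both gain the same. The
  extension has a candidate set, so it can only be displaced by something at least as good.\<close>

lemma dp_step_dominates:
  assumes T: "(s, z) \<in> set T" "set z = set (take m \<tau>)" "distinct z" "agreement (beats M) (take m \<tau>) \<le> s"
    and \<tau>: "m < length \<tau>" "distinct \<tau>" "set \<tau> = set (x # \<sigma>)"
    and S: "S \<in> set (targets \<sigma> x w vs k)" "set S = set (take (Suc m) \<tau>)"
  shows "\<exists>(s', z')\<in>set (dp_step M \<sigma> x w vs k T). set z' = set (take (Suc m) \<tau>) \<and>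
    agreement (beats M) (take (Suc m) \<tau>) \<le> s'"
proof -
  define y where "y = \<tau> ! m"
  have take: "take (Suc m) \<tau> = take m \<tau> @ [y]" using \<tau>(1) by (simp add: y_def take_Suc_conv_app_nth)
  have "distinct (take m \<tau> @ [y])" unfolding take[symmetric] using \<tau>(2) by simp
  then have y: "y \<notin> set z" "y \<in> set (x # \<sigma>)" using T(2) \<tau>(1,3) nth_mem[OF \<tau>(1)] by (auto simp: y_def)
  let ?e = "(s + length (filter (\<lambda>u. beats M u y) z), y # z)"
  have e: "?e \<in> set (extensions M (x # \<sigma>) T)" unfolding set_extensions using T(1) y by blast
  have "length (filter (\<lambda>u. beats M u y) z) = length (filter (\<lambda>u. beats M u y) (take m \<tau>))"
    using T(2,3) \<tau>(2) distinct_card[of "filter (\<lambda>u. beats M u y) z"]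
      distinct_card[of "filter (\<lambda>u. beats M u y) (take m \<tau>)"] by simp
  then have ag: "agreement (beats M) (take (Suc m) \<tau>) \<le> fst ?e"
    using T(4) by (simp add: take agreement_snoc)
  have "?e \<in> set (filter (\<lambda>e. set (snd e) = set S) (extensions M (x # \<sigma>) T))"
    using e S(2) T(2) by (simp add: take)
  from best_dominates[OF this] obtain e' where e': "fst ?e \<le> fst e'"
    "e' \<in> set (best (filter (\<lambda>e. set (snd e) = set S) (extensions M (x # \<sigma>) T)))" by blast
  from subsetD[OF best_subset e'(2)] have "set (snd e') = set S" by simp
  moreover have "e' \<in> set (dp_step M \<sigma> x w vs k T)" unfolding dp_step_def using S(1) e'(2) by auto
  ultimately show ?thesis using e'(1) ag S(2) by (intro bexI[of _ e']) auto
qed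

text \<open>If all prefix sets of some optimal order \<open>\<tau>\<close> are candidates, then the
  final table contains an entry at least as good as \<open>\<tau>\<close>. Soundness ensures that
  the recorded number is the agreement of an actual order.\<close>

lemma insert_item_optimal:
  assumes \<tau>: "optimal_order (beats M) \<tau>" "set \<tau> = set (x # \<sigma>)" and \<sigma>: "distinct \<sigma>" "x \<notin> set \<sigma>"
    and S: "\<And>m. 1 \<le> m \<Longrightarrow> m \<le> length \<tau> \<Longrightarrow> \<exists>S\<in>set (targets \<sigma> x w vs m). set S = set (take m \<tau>)"
  shows "optimal_order (beats M) (insert_item M w vs x \<sigma>)" "set (insert_item M w vs x \<sigma>) = set (x # \<sigma>)"
proof -
  let ?T = "\<lambda>m. fold (dp_step M \<sigma> x w vs) (map Suc [0..<m]) [(0, [])]"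
  have d: "distinct \<tau>" using \<tau>(1) by (simp add: optimal_order_def)
  have len: "length \<tau> = Suc (length \<sigma>)"
    using distinct_card[OF d] distinct_card[OF \<sigma>(1)] \<sigma>(2) by (simp add: \<tau>(2))
  have dom: "\<exists>(s, z)\<in>set (?T m). set z = set (take m \<tau>) \<and> agreement (beats M) (take m \<tau>) \<le> s"
    if "m \<le> length \<tau>" for m
    using that
  proof (induction m)
    case (Suc m)
    then obtain s z where z: "(s, z) \<in> set (?T m)" "set z = set (take m \<tau>)"
      "agreement (beats M) (take m \<tau>) \<le> s" by auto
    have "distinct z" using table_sound_dp[of M x \<sigma> "map Suc [0..<m]" w vs] z(1)
      unfolding table_sound_def by auto
    moreover from S[of "Suc m"] Suc.prems obtain S where
      "S \<in> set (targets \<sigma> x w vs (Suc m))" "set S = set (take (Suc m) \<tau>)" by auto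
    ultimately show ?case
      using dp_step_dominates[OF z(1,2) _ z(3) _ d \<tau>(2)] Suc.prems by simp
  qed simp
  have sound: "table_sound M (x # \<sigma>) (length \<tau>) (dp M \<sigma> x w vs)"
    using table_sound_dp[of M x \<sigma> "map Suc [0..<length \<tau>]" w vs] by (simp add: dp_def len)
  from dom[of "length \<tau>"] obtain s z where "(s, z) \<in> set (dp M \<sigma> x w vs)" "agreement (beats M) \<tau> \<le> s"
    by (auto simp: dp_def len)
  then obtain e where e: "e \<in> set (best (dp M \<sigma> x w vs))" "agreement (beats M) \<tau> \<le> fst e"
    using best_dominates[of "(s, z)" "dp M \<sigma> x w vs"] by force
  obtain s' z' where "e = (s', z')" by (cases e)
  with e best_cases[of "dp M \<sigma> x w vs"] have
    b: "best (dp M \<sigma> x w vs) = [(s', z')]" "agreement (beats M) \<tau> \<le> s'" "(s', z') \<in> set (dp M \<sigma> x w vs)"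
    by auto
  with sound have z': "distinct z'" "length z' = length \<tau>" "set z' \<subseteq> set (x # \<sigma>)"
    "s' = agreement (beats M) (rev z')" unfolding table_sound_def by auto
  have res: "insert_item M w vs x \<sigma> = rev z'" by (simp add: insert_item_def b(1))
  \<comment> \<open>A list of distinct items from a set of the same size exhausts the set.\<close>
  have "set z' = set \<tau>"
    using z' distinct_card[OF d] distinct_card[OF z'(1)] unfolding \<tau>(2)[symmetric]
    by (intro card_subset_eq) auto
  then show "set (insert_item M w vs x \<sigma>) = set (x # \<sigma>)" by (simp add: res \<tau>(2))
  show "optimal_order (beats M) (insert_item M w vs x \<sigma>)"
    unfolding optimal_order_def res
  proof (intro conjI allI impI)
    fix c assume "distinct c" "set c = set (rev z')"
    then have "agreement (beats M) c \<le> agreement (beats M) \<tau>"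
      using \<tau>(1) \<open>set z' = set \<tau>\<close> by (simp add: optimal_order_def)
    with b(2) z'(4) show "agreement (beats M) c \<le> agreement (beats M) (rev z')" by linarith
  qed (use z' in simp)
qed

section \<open>Candidates cover the prefixes of the new order\<close>

lemma select_by_filter: "select_by (map P xs @ v) xs = filter P xs"
  by (induction xs) auto

lemma target_exists:
  assumes "set (take (m - w) \<sigma>) \<subseteq> S" "S \<subseteq> insert x (set (take (m + w) \<sigma>))"
  shows "\<exists>S'\<in>set (targets \<sigma> x w (bit_vectors (2 * w)) m). set S' = S"
proof -
  define win where "win = take (w + w) (drop (m - w) \<sigma>)"
  \<comment> \<open>The vector records membership in \<open>S\<close>; it is padded where the window
    is cut off by the end of \<open>\<sigma>\<close>.\<close>
  define v where "v = map (\<lambda>y. y \<in> S) win @ replicate (2 * w - length win) False"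
  have "length v = 2 * w" by (simp add: v_def win_def)
  then have v: "v \<in> set (bit_vectors (2 * w))" by (rule bit_vectors_complete)
  let ?u = "take (m - w) \<sigma> @ select_by v (take (w + w) (drop (m - w) \<sigma>))"
  have u: "?u = take (m - w) \<sigma> @ filter (\<lambda>y. y \<in> S) win"
    unfolding v_def by (simp only: select_by_filter flip: win_def)
  have "set (take (m + w) \<sigma>) \<subseteq> set (take (m - w) \<sigma>) \<union> set win"
  proof (cases "w \<le> m")
    case True
    then have "m + w = (m - w) + (w + w)" by simp
    then show ?thesis unfolding win_def by (metis set_append subset_refl take_add)
  next
    \<comment> \<open>By truncated subtraction the window now starts at 0, and its length bound
      \<open>w + w\<close> exceeds \<open>m + w\<close>.\<close>
    case False
    then show ?thesis using set_take_subset_set_take[of "m + w" "w + w" \<sigma>] by (auto simp: win_def)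
  qed
  then have "S - {x} \<subseteq> set ?u" "set ?u \<subseteq> S"
    using assms unfolding u by auto
  then have "set (if x \<in> S then x # ?u else ?u) = S" by auto
  moreover have "(if x \<in> S then x # ?u else ?u) \<in> set (targets \<sigma> x w (bit_vectors (2 * w)) m)"
    using v by (auto simp: targets_def)
  ultimately show ?thesis by (rule bexI)
qed

text \<open>Both orders are close to the true order, which bounds by \<open>2 W\<close> how far they are from each other.\<close>

lemma insert_item_close:
  fixes \<kappa> :: "nat \<Rightarrow> int"
  assumes \<tau>: "distinct \<tau>" "set \<tau> = set (x # \<sigma>)" and \<sigma>: "distinct \<sigma>" "x \<notin> set \<sigma>"
    and close_\<tau>: "\<And>i. i < length \<tau> \<Longrightarrow> i < rank_in \<kappa> (set \<tau>) (\<tau> ! i) + W \<and> rank_in \<kappa> (set \<tau>) (\<tau> ! i) < i + W"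
    and close_\<sigma>: "\<And>i. i < length \<sigma> \<Longrightarrow> i < rank_in \<kappa> (set \<sigma>) (\<sigma> ! i) + W \<and> rank_in \<kappa> (set \<sigma>) (\<sigma> ! i) < i + W"
  shows "set (take (m - 2 * W) \<sigma>) \<subseteq> set (take m \<tau>)" "set (take m \<tau>) \<subseteq> insert x (set (take (m + 2 * W) \<sigma>))"
proof -
  \<comment> \<open>Adding \<open>x\<close> raises ranks by at most one, which is absorbed by the
    strict inequalities in the closeness assumptions.\<close>
  have rk: "rank_in \<kappa> (set \<sigma>) y \<le> rank_in \<kappa> (set \<tau>) y" "rank_in \<kappa> (set \<tau>) y \<le> rank_in \<kappa> (set \<sigma>) y + 1" for y
  proof -
    show "rank_in \<kappa> (set \<sigma>) y \<le> rank_in \<kappa> (set \<tau>) y"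
      unfolding rank_in_def \<tau>(2) by (intro card_mono) auto
    have "rank_in \<kappa> (set \<tau>) y \<le> card (insert x {u \<in> set \<sigma>. \<kappa> u < \<kappa> y})"
      unfolding rank_in_def \<tau>(2) by (intro card_mono) auto
    also have "\<dots> \<le> Suc (card {u \<in> set \<sigma>. \<kappa> u < \<kappa> y})" by (simp add: card_insert_if)
    finally show "rank_in \<kappa> (set \<tau>) y \<le> rank_in \<kappa> (set \<sigma>) y + 1" by (simp add: rank_in_def)
  qed
  show "set (take (m - 2 * W) \<sigma>) \<subseteq> set (take m \<tau>)"
  proof
    fix y assume "y \<in> set (take (m - 2 * W) \<sigma>)"
    then obtain i where "i < length (take (m - 2 * W) \<sigma>)" "take (m - 2 * W) \<sigma> ! i = y"
      unfolding in_set_conv_nth by blast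
    then have i: "i < length \<sigma>" "i < m - 2 * W" "\<sigma> ! i = y" by simp_all
    have "y \<in> set \<tau>" unfolding \<tau>(2) using nth_mem[OF i(1)] i(3) by simp
    then obtain j where j: "j < length \<tau>" "\<tau> ! j = y" unfolding in_set_conv_nth by blast
    have "j < m" using close_\<tau>[OF j(1), unfolded j(2)] close_\<sigma>[OF i(1), unfolded i(3)] i(2) rk[of y]
      unfolding less_diff_conv by linarith
    with j have "j < length (take m \<tau>)" "take m \<tau> ! j = y" by simp_all
    then show "y \<in> set (take m \<tau>)" using nth_mem by blast
  qed
  show "set (take m \<tau>) \<subseteq> insert x (set (take (m + 2 * W) \<sigma>))"
  proof
    fix y assume "y \<in> set (take m \<tau>)"
    then obtain j where "j < length (take m \<tau>)" "take m \<tau> ! j = y" unfolding in_set_conv_nth by blast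
    then have j: "j < length \<tau>" "j < m" "\<tau> ! j = y" by simp_all
    show "y \<in> insert x (set (take (m + 2 * W) \<sigma>))"
    proof (cases "y = x")
      case False
      then have "y \<in> set \<sigma>" using nth_mem[OF j(1), unfolded \<tau>(2)] j(3) by simp
      then obtain i where i: "i < length \<sigma>" "\<sigma> ! i = y" unfolding in_set_conv_nth by blast
      have "i < m + 2 * W" using close_\<tau>[OF j(1), unfolded j(3)] close_\<sigma>[OF i(1), unfolded i(2)] j(2) rk[of y]
        by linarith
      with i have "i < length (take (m + 2 * W) \<sigma>)" "take (m + 2 * W) \<sigma> ! i = y" by simp_all
      then show ?thesis using nth_mem by blast
    qed simp
  qed
qed

lemma optimal_order_exists:
  assumes "finite V"
  shows "\<exists>z. set z = V \<and> optimal_order R z"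
proof -
  let ?L = "{z. distinct z \<and> set z = V}"
  have "?L \<subseteq> {z. set z \<subseteq> V \<and> length z \<le> card V}" by (auto simp: distinct_card)
  then have fin: "finite ?L" by (rule finite_subset) (rule finite_lists_length_le[OF assms])
  have "?L \<noteq> {}" using finite_distinct_list[OF assms] by auto
  let ?m = "Max (agreement R ` ?L)"
  have "?m \<in> agreement R ` ?L" using fin \<open>?L \<noteq> {}\<close> by (intro Max_in) auto
  then obtain z where z: "distinct z" "set z = V" "agreement R z = ?m" by auto
  have "agreement R z' \<le> agreement R z" if "distinct z'" "set z' = V" for z'
    unfolding z(3) using fin that by (intro Max_ge) auto
  with z show ?thesis unfolding optimal_order_def by blast
qed

text \<open>The hypothesis \<open>close\<close> is applied to the computed order of the first
  \<open>i\<close> items and to an arbitrary optimal order \<open>\<tau>\<close> of the first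
  \<open>Suc i\<close>, which exists but is not known to the algorithm.\<close>

lemma order_items_optimal:
  fixes \<kappa> :: "nat \<Rightarrow> int"
  assumes close: "\<And>i z. i \<le> n \<Longrightarrow> optimal_order (beats M) z \<Longrightarrow> set z = {..<i} \<Longrightarrow>
     \<forall>j<length z. j < rank_in \<kappa> (set z) (z ! j) + W \<and> rank_in \<kappa> (set z) (z ! j) < j + W"
  shows "optimal_order (beats M) (order_items M (2 * W) (bit_vectors (2 * (2 * W))) n)"
    "set (order_items M (2 * W) (bit_vectors (2 * (2 * W))) n) = {..<n}"
proof -
  let ?\<sigma> = "\<lambda>i. fold (insert_item M (2 * W) (bit_vectors (2 * (2 * W)))) [0..<i] []"
  have "optimal_order (beats M) (?\<sigma> i) \<and> set (?\<sigma> i) = {..<i}" if "i \<le> n" for i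
    using that
  proof (induction i)
    case 0
    then show ?case by (simp add: optimal_order_def)
  next
    case (Suc i)
    then have \<sigma>: "optimal_order (beats M) (?\<sigma> i)" "set (?\<sigma> i) = {..<i}" by auto
    obtain \<tau> where \<tau>: "set \<tau> = {..<Suc i}" "optimal_order (beats M) \<tau>"
      using optimal_order_exists[of "{..<Suc i}"] by blast
    have set\<tau>: "set \<tau> = set (i # ?\<sigma> i)" using \<tau>(1) \<sigma>(2) by auto
    have d: "distinct (?\<sigma> i)" "i \<notin> set (?\<sigma> i)" "distinct \<tau>" using \<sigma> \<tau> by (auto simp: optimal_order_def)
    note * = insert_item_close[OF d(3) set\<tau> d(1,2), of \<kappa> W]
    have S: "\<exists>S\<in>set (targets (?\<sigma> i) i (2 * W) (bit_vectors (2 * (2 * W))) m). set S = set (take m \<tau>)" for m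
      using close[OF Suc.prems \<tau>(2,1)] close[of i, OF _ \<sigma>] Suc.prems by (intro target_exists *) auto
    note insert_item_optimal[OF \<tau>(2) set\<tau> d(1,2) S]
    then show ?case using set\<tau> \<tau>(1) by simp
  qed
  from this[of n] show "optimal_order (beats M) (order_items M (2 * W) (bit_vectors (2 * (2 * W))) n)"
    "set (order_items M (2 * W) (bit_vectors (2 * (2 * W))) n) = {..<n}"
    by (simp_all add: order_items_def)
qed

section \<open>The noise is benign with high probability\<close>

text \<open>The expected sum is at least \<open>2 * \<gamma> * card P\<close>, so a sum below half
  of this deviates by at least \<open>\<gamma> * card P\<close>, which Hoeffding's inequality
  bounds.\<close>

lemma noisy_sum_tail:
  assumes D: "noisy_sorting_model n \<gamma> \<pi> D" and \<gamma>: "0 < \<gamma>"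
    and P: "P \<subseteq> {(x, y). x \<in> {1..n} \<and> y \<in> {1..n} \<and> \<pi> y < \<pi> x}"
  shows "measure_pmf.prob D {q. real_of_int (\<Sum>(x, y)\<in>P. q x y) < \<gamma> * card P} \<le> exp (- \<gamma>\<^sup>2 * card P / 2)"
proof (cases "P = {}")
  case False
  \<comment> \<open>Independence is given only for pairs with the smaller index first.
    \<open>X\<close> restores the sign of the original orientation; this is well defined because
    \<open>P\<close> never contains a pair in both orientations.\<close>
  define idx where "idx = (\<lambda>(x, y). (min x y, max x y :: nat))"
  define X where "X = (\<lambda>p (q :: outcome). real_of_int (if p \<in> P then q (fst p) (snd p) else - q (fst p) (snd p)))"
  have "P \<subseteq> {1..n} \<times> {1..n}" using P by auto
  then have finP: "finite P" by (rule finite_subset) simp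
  have inj: "inj_on idx P"
  proof (rule inj_onI)
    fix p p' assume p: "p \<in> P" "p' \<in> P" "idx p = idx p'"
    obtain x y x' y' where xy: "p = (x, y)" "p' = (x', y')" by (cases p; cases p')
    have "\<pi> y < \<pi> x" "\<pi> y' < \<pi> x'" using P p(1,2) xy by auto
    moreover have "x = x' \<and> y = y' \<or> x = y' \<and> y = x'"
      using p(3) by (auto simp: idx_def xy min_def max_def split: if_splits)
    ultimately show "p = p'" by (auto simp: xy)
  qed
  have card: "card (idx ` P) = card P" by (rule card_image[OF inj])
  have co: "comparison_outcome n q" if "q \<in> set_pmf D" for q
    using D that by (simp add: noisy_sorting_model_def)
  have X: "X (idx p) q = q (fst p) (snd p)" "q (fst p) (snd p) \<in> {1, -1}" if "p \<in> P" "q \<in> set_pmf D" for p q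
  proof -
    obtain x y where p: "p = (x, y)" by (cases p)
    have xy: "x \<in> {1..n}" "y \<in> {1..n}" "\<pi> y < \<pi> x" using P that(1) p by auto
    then have "x \<noteq> y" by auto
    with xy co[OF that(2)] have q: "q x y \<in> {1, -1}" "q y x = - q x y"
      unfolding comparison_outcome_def by blast+
    then show "q (fst p) (snd p) \<in> {1, -1}" by (simp add: p)
    have "(y, x) \<notin> P" using P xy by auto
    then show "X (idx p) q = q (fst p) (snd p)"
      using that(1) q(2) by (auto simp: X_def idx_def p min_def max_def)
  qed
  have "prob_space.indep_vars (measure_pmf D) (\<lambda>_. borel) X (idx ` P)"
  proof -
    let ?I = "{(i, j). 1 \<le> i \<and> i < j \<and> j \<le> n}"
    have "prob_space.indep_vars (measure_pmf D) (\<lambda>_. count_space UNIV) (\<lambda>(i, j) q. q i j) ?I"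
      using D by (simp add: noisy_sorting_model_def)
    moreover have "idx ` P \<subseteq> ?I"
    proof
      fix i assume "i \<in> idx ` P"
      then obtain x y where i: "(x, y) \<in> P" "i = (min x y, max x y)" by (auto simp: idx_def)
      then have "x \<in> {1..n}" "y \<in> {1..n}" "x \<noteq> y" using P by auto
      then show "i \<in> ?I" by (auto simp: i(2))
    qed
    ultimately have "prob_space.indep_vars (measure_pmf D) (\<lambda>_. count_space UNIV) (\<lambda>(i, j) q. q i j) (idx ` P)"
      by (rule prob_space.indep_vars_subset[OF prob_space_measure_pmf])
    then have "prob_space.indep_vars (measure_pmf D) (\<lambda>_. borel)
        (\<lambda>p q. (\<lambda>z. real_of_int (if p \<in> P then z else - z)) ((\<lambda>(i, j) q. q i j) p q)) (idx ` P)"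
      by (rule prob_space.indep_vars_compose2[OF prob_space_measure_pmf]) simp
    moreover have "X = (\<lambda>p q. (\<lambda>z. real_of_int (if p \<in> P then z else - z)) ((\<lambda>(i, j) q. q i j) p q))"
      by (auto simp: X_def fun_eq_iff)
    ultimately show ?thesis by simp
  qed
  then interpret Hoeffding_ineq "measure_pmf D" "idx ` P" X "\<lambda>_. -1" "\<lambda>_. 1" "\<Sum>p\<in>idx ` P. measure_pmf.expectation D (X p)"
  proof unfold_locales
    show "finite (idx ` P)" using finP by simp
    fix p assume "p \<in> idx ` P"
    then show "AE q in measure_pmf D. X p q \<in> {-1..1}"
      using X by (fastforce simp: AE_measure_pmf_iff)
  qed simp
  have exp: "2 * \<gamma> \<le> measure_pmf.expectation D (X (idx p))" if "p \<in> P" for p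
  proof -
    obtain x y where p: "p = (x, y)" by (cases p)
    have xy: "x \<in> {1..n}" "y \<in> {1..n}" "\<pi> y < \<pi> x" using P that(1) p by auto
    have "measure_pmf.expectation D (X (idx p)) = measure_pmf.expectation D (\<lambda>q. 2 * indicator {q. q x y = 1} q - 1)"
    proof (intro integral_cong_AE)
      have "X (idx p) q = 2 * indicator {q. q x y = 1} q - 1" if "q \<in> set_pmf D" for q
        using X[OF \<open>p \<in> P\<close> that] p by (auto simp: indicator_def)
      then show "AE q in measure_pmf D. X (idx p) q = 2 * indicator {q. q x y = 1} q - 1"
        by (simp add: AE_measure_pmf_iff)
    qed auto
    also have "\<dots> = 2 * measure_pmf.prob D {q. q x y = 1} - 1"
      by (subst Bochner_Integration.integral_diff) (auto simp: measure_pmf.emeasure_eq_measure)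
    moreover have "1 / 2 + \<gamma> \<le> measure_pmf.prob D {q. q x y = 1}"
      using D xy unfolding noisy_sorting_model_def by blast
    ultimately show ?thesis by simp
  qed
  have "(\<Sum>p\<in>P. 2 * \<gamma>) \<le> (\<Sum>p\<in>P. measure_pmf.expectation D (X (idx p)))"
    by (rule sum_mono) (rule exp)
  then have mu: "2 * \<gamma> * card P \<le> (\<Sum>p\<in>idx ` P. measure_pmf.expectation D (X p))"
    using inj by (simp add: sum.reindex mult.commute)
  have "measure_pmf.prob D {q. real_of_int (\<Sum>(x, y)\<in>P. q x y) < \<gamma> * card P} \<le>
     measure_pmf.prob D {q\<in>space (measure_pmf D). (\<Sum>p\<in>idx ` P. X p q) \<le>
       (\<Sum>p\<in>idx ` P. measure_pmf.expectation D (X p)) - \<gamma> * card P}"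
  proof (rule measure_pmf.finite_measure_mono_AE)
    have "(\<Sum>p\<in>idx ` P. X p q) = real_of_int (\<Sum>(x, y)\<in>P. q x y)" if "q \<in> set_pmf D" for q
      using inj X[OF _ that] by (simp add: sum.reindex case_prod_beta)
    then show "AE q in measure_pmf D. q \<in> {q. real_of_int (\<Sum>(x, y)\<in>P. q x y) < \<gamma> * card P} \<longrightarrow>
       q \<in> {q\<in>space (measure_pmf D). (\<Sum>p\<in>idx ` P. X p q) \<le>
       (\<Sum>p\<in>idx ` P. measure_pmf.expectation D (X p)) - \<gamma> * card P}"
      using mu by (auto simp: AE_measure_pmf_iff)
  qed simp
  \<comment> \<open>Each of the \<open>card P\<close> variables ranges over an interval of length 2,
    so the denominator is \<open>4 * card P\<close>.\<close>
  also have "\<dots> \<le> exp (- 2 * (\<gamma> * card P)\<^sup>2 / (\<Sum>p\<in>idx ` P. (1 - (- 1))\<^sup>2))"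
    using \<gamma> False finP by (intro Hoeffding_ineq_le) (auto simp: card card_gt_0_iff)
  also have "\<dots> = exp (- \<gamma>\<^sup>2 * card P / 2)"
    using False finP by (simp add: card power2_eq_square field_simps)
  finally show ?thesis .
qed simp

text \<open>The common form of the events in the union bound: both conditions on the noise follow
  from fixed sets of pairs being benign.\<close>

definition benign :: "('a \<Rightarrow> 'a \<Rightarrow> bool) \<Rightarrow> real \<Rightarrow> ('a \<times> 'a) set \<Rightarrow> bool" where
  "benign R \<gamma> P \<longleftrightarrow> \<gamma> * card P \<le> real_of_int (sum (pair_sign R) P)"

text \<open>This passes to items numbered from 0. The key is the negated true position, as orders
  start with the largest item.\<close>

lemma not_benign_prob:
  fixes R :: "outcome \<Rightarrow> nat \<Rightarrow> nat \<Rightarrow> bool" and \<kappa> :: "nat \<Rightarrow> int"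
  assumes D: "noisy_sorting_model n \<gamma> \<pi> D" and \<gamma>: "0 < \<gamma>"
    and R: "\<And>q x y. x < n \<Longrightarrow> y < n \<Longrightarrow> x \<noteq> y \<Longrightarrow> R q x y \<longleftrightarrow> q (Suc x) (Suc y) = 1"
    and \<kappa>: "\<And>x. \<kappa> x = - int (\<pi> (Suc x))"
    and P: "P \<subseteq> {(x, y). x < n \<and> y < n \<and> \<kappa> x < \<kappa> y}" and c: "c \<le> card P"
  shows "measure_pmf.prob D {q. \<not> benign (R q) \<gamma> P} \<le> exp (- \<gamma>\<^sup>2 * c / 2)"
proof -
  let ?S = "\<lambda>(x, y). (Suc x, Suc y)"
  have inj: "inj_on ?S P" by (auto simp: inj_on_def)
  have "measure_pmf.prob D {q. \<not> benign (R q) \<gamma> P} \<le>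
    measure_pmf.prob D {q. real_of_int (\<Sum>(x, y)\<in>?S ` P. q x y) < \<gamma> * card (?S ` P)}"
  proof (rule measure_pmf.finite_measure_mono_AE)
    have "sum (pair_sign (R q)) P = (\<Sum>(x, y)\<in>?S ` P. q x y)" if q: "q \<in> set_pmf D" for q
    proof -
      have "pair_sign (R q) p = (case ?S p of (x, y) \<Rightarrow> q x y)" if "p \<in> P" for p
      proof -
        obtain x y where p: "p = (x, y)" by (cases p)
        then have xy: "x < n" "y < n" "x \<noteq> y" using P that by auto
        have "comparison_outcome n q" using D q by (simp add: noisy_sorting_model_def)
        moreover have "Suc x \<in> {1..n}" "Suc y \<in> {1..n}" "Suc x \<noteq> Suc y" using xy by auto
        ultimately have "q (Suc x) (Suc y) \<in> {1, -1}" unfolding comparison_outcome_def by blast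
        with R[OF xy, of q] show ?thesis by (auto simp: pair_sign_def p)
      qed
      then show ?thesis using inj by (simp add: sum.reindex)
    qed
    then show "AE q in measure_pmf D. q \<in> {q. \<not> benign (R q) \<gamma> P} \<longrightarrow>
      q \<in> {q. real_of_int (\<Sum>(x, y)\<in>?S ` P. q x y) < \<gamma> * card (?S ` P)}"
      using card_image[OF inj] by (simp add: AE_measure_pmf_iff benign_def del: of_int_sum)
  qed simp
  also have "\<dots> \<le> exp (- \<gamma>\<^sup>2 * card (?S ` P) / 2)"
    by (rule noisy_sum_tail[OF D \<gamma>]) (use P \<kappa> in force)
  also have "\<dots> \<le> exp (- \<gamma>\<^sup>2 * c / 2)" using c card_image[OF inj] by (simp add: mult_left_mono)
  finally show ?thesis .
qed

section \<open>Union bound over all noise events\<close>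

lemma card_successors:
  assumes "finite V" "inj_on \<kappa> V" "rank_in \<kappa> V x + W < card V"
  shows "card (successors \<kappa> V x W) = W"
proof -
  note bij = bij_betw_rank_in[OF assms(1,2)]
  have "successors \<kappa> V x W = {y \<in> V. rank_in \<kappa> V y < rank_in \<kappa> V x + W + 1} - {y \<in> V. rank_in \<kappa> V y < rank_in \<kappa> V x + 1}"
    by (auto simp: successors_def)
  also have "card \<dots> = card {y \<in> V. rank_in \<kappa> V y < rank_in \<kappa> V x + W + 1} - card {y \<in> V. rank_in \<kappa> V y < rank_in \<kappa> V x + 1}"
    using assms(1) by (intro card_Diff_subset) auto
  finally show ?thesis using card_vimage_bij[OF bij] assms(3) by simp
qed

text \<open>There are at most \<open>n ^ s\<close> lists of length \<open>s\<close>, and a list with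
  at least \<open>K * s\<close> inversions fails with a probability exponentially small in
  \<open>K * s\<close>, so the number of lists is outweighed for every \<open>s\<close>. For the
  surpluses there are at most \<open>n ^ 3\<close> triples of a prefix of the items, an item and a
  width.\<close>

lemma all_good_prob:
  fixes R :: "outcome \<Rightarrow> nat \<Rightarrow> nat \<Rightarrow> bool" and \<kappa> :: "nat \<Rightarrow> int"
  assumes D: "noisy_sorting_model n \<gamma> \<pi> D" and \<gamma>: "0 < \<gamma>" and \<pi>: "\<pi> permutes {1..n}" and n: "2 \<le> n"
    and R: "\<And>q x y. x < n \<Longrightarrow> y < n \<Longrightarrow> x \<noteq> y \<Longrightarrow> R q x y \<longleftrightarrow> q (Suc x) (Suc y) = 1"
    and \<kappa>: "\<And>x. \<kappa> x = - int (\<pi> (Suc x))"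
    and K: "exp (- \<gamma>\<^sup>2 * K / 2) \<le> 1 / real n ^ (B + 4)" "0 < K"
    and W0: "exp (- \<gamma>\<^sup>2 * W0 / 2) \<le> 1 / real n ^ (B + 6)"
  shows "measure_pmf.prob D {q. \<not> (few_inversions (R q) \<kappa> {..<n} K \<and> (\<forall>i\<le>n.
      mostly_beats (R q) \<kappa> {..<i} \<gamma> W0 \<and> mostly_beats (\<lambda>x y. R q y x) (\<lambda>x. - \<kappa> x) {..<i} \<gamma> W0))} \<le> 1 / real n ^ B"
    (is "measure_pmf.prob D ?bad \<le> _")
proof -
  have inj: "inj_on \<kappa> {..<i}" "inj_on (\<lambda>x. - \<kappa> x) {..<i}" for i
    using permutes_inj[OF \<pi>] by (auto simp: \<kappa> inj_on_def inj_def)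
  define E where "E P = {q. \<not> benign (R q) \<gamma> P}" for P
  define L where "L s = {b. set b \<subseteq> {..<n} \<and> length b = s \<and> K * s \<le> card (inversions \<kappa> b)}" for s
  define T where "T k = {(i, x, W). i \<in> {1..n} \<and> x \<in> {..<n} \<and> W \<in> {..<n} \<and>
    x < i \<and> W0 \<le> W \<and> rank_in k {..<i} x + W < i}" for k :: "nat \<Rightarrow> int"
  define F where "F = (\<lambda>(i, x, W). Pair x ` successors \<kappa> {..<i} x W)"
  \<comment> \<open>The reversed key interchanges the roles, so the correctly oriented pair has
    \<open>x\<close> second.\<close>
  define G where "G = (\<lambda>(i, x, W). (\<lambda>y. (y, x)) ` successors (\<lambda>x. - \<kappa> x) {..<i} x W)"
  have T_sub: "T k \<subseteq> {1..n} \<times> {..<n} \<times> {..<n}" for k by (auto simp: T_def)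
  then have finT: "finite (T k)" for k by (rule finite_subset) simp
  have "card (T k) \<le> card ({1..n} \<times> {..<n} \<times> {..<n})" for k using T_sub by (rule card_mono[rotated]) simp
  then have cardT: "real (card (T k)) \<le> real n ^ 3" for k
    by (simp add: power3_eq_cube mult.assoc flip: of_nat_mult)
  have L_sub: "L s \<subseteq> {b. set b \<subseteq> {..<n} \<and> length b = s}" for s by (auto simp: L_def)
  then have finL: "finite (L s)" for s by (rule finite_subset) (simp add: finite_lists_length_eq)
  have "card (L s) \<le> card {b. set b \<subseteq> {..<n} \<and> length b = s}" for s
    using L_sub by (rule card_mono[rotated]) (simp add: finite_lists_length_eq)
  then have cardL: "card (L s) \<le> n ^ s" for s by (simp add: card_lists_length_eq)
  have sub: "?bad \<subseteq> (\<Union>s\<in>{1..n}. \<Union>b\<in>L s. E (inversions \<kappa> b)) \<union> ((\<Union>t\<in>T \<kappa>. E (F t)) \<union> (\<Union>t\<in>T (\<lambda>x. - \<kappa> x). E (G t)))"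
    (is "_ \<subseteq> ?U")
  proof (rule subsetI, rule ccontr)
    fix q assume q: "q \<in> ?bad" and nq: "q \<notin> ?U"
    have q1: "benign (R q) \<gamma> (inversions \<kappa> b)" if "s \<in> {1..n}" "b \<in> L s" for s b
      using nq that unfolding E_def by blast
    have q2: "benign (R q) \<gamma> (F t)" if "t \<in> T \<kappa>" for t
      using nq that unfolding E_def by blast
    have q3: "benign (R q) \<gamma> (G t)" if "t \<in> T (\<lambda>x. - \<kappa> x)" for t
      using nq that unfolding E_def by blast
    have "few_inversions (R q) \<kappa> {..<n} K"
      unfolding few_inversions_def
    proof (intro allI impI)
      fix b assume b: "distinct b" "set b \<subseteq> {..<n}" "b \<noteq> []" "K * length b \<le> card (inversions \<kappa> b)"
      have "length b \<le> n" using b(1,2) by (metis card_lessThan card_mono distinct_card finite_lessThan)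
      then have "benign (R q) \<gamma> (inversions \<kappa> b)" using b by (intro q1[of "length b"]) (auto simp: L_def Suc_le_eq)
      moreover have "0 < K * length b" using K(2) b(3) by simp
      then have "0 < \<gamma> * card (inversions \<kappa> b)" using b(4) \<gamma> by (intro mult_pos_pos) linarith+
      ultimately show "0 < sum (pair_sign (R q)) (inversions \<kappa> b)" unfolding benign_def by linarith
    qed
    moreover have "mostly_beats (R q) \<kappa> {..<i} \<gamma> W0" if "i \<le> n" for i
      unfolding mostly_beats_def
    proof (intro ballI allI impI)
      fix x W assume xW: "x \<in> {..<i}" "W0 \<le> W" "rank_in \<kappa> {..<i} x + W < card {..<i}"
      then have "benign (R q) \<gamma> (F (i, x, W))" using that by (intro q2) (auto simp: T_def)
      then show "\<gamma> * W \<le> real_of_int (\<Sum>y\<in>successors \<kappa> {..<i} x W. pair_sign (R q) (x, y))"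
        using card_successors[OF _ inj(1) xW(3)]
        by (simp add: benign_def F_def card_image sum.reindex inj_on_def)
    qed
    moreover have "mostly_beats (\<lambda>x y. R q y x) (\<lambda>x. - \<kappa> x) {..<i} \<gamma> W0" if "i \<le> n" for i
      unfolding mostly_beats_def
    proof (intro ballI allI impI)
      fix x W assume xW: "x \<in> {..<i}" "W0 \<le> W" "rank_in (\<lambda>x. - \<kappa> x) {..<i} x + W < card {..<i}"
      then have "benign (R q) \<gamma> (G (i, x, W))" using that by (intro q3) (auto simp: T_def)
      then show "\<gamma> * W \<le> real_of_int (\<Sum>y\<in>successors (\<lambda>x. - \<kappa> x) {..<i} x W. pair_sign (\<lambda>x y. R q y x) (x, y))"
        using card_successors[OF _ inj(2) xW(3)]
        by (simp add: benign_def G_def card_image sum.reindex inj_on_def pair_sign_def)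
    qed
    ultimately show False using q by blast
  qed
  have prob_E: "measure_pmf.prob D (E P) \<le> exp (- \<gamma>\<^sup>2 * c / 2)"
    if "P \<subseteq> {(x, y). x < n \<and> y < n \<and> \<kappa> x < \<kappa> y}" "c \<le> card P" for P c
    unfolding E_def by (rule not_benign_prob[where n = n and \<pi> = \<pi>]) (use D \<gamma> R \<kappa> that in auto)
  have prob_L: "measure_pmf.prob D (\<Union>b\<in>L s. E (inversions \<kappa> b)) \<le> 1 / real n ^ (B + 3)" if "s \<in> {1..n}" for s
  proof -
    have "measure_pmf.prob D (\<Union>b\<in>L s. E (inversions \<kappa> b)) \<le> (\<Sum>b\<in>L s. measure_pmf.prob D (E (inversions \<kappa> b)))"
      using finL by (intro measure_pmf.finite_measure_subadditive_finite) auto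
    also have "\<dots> \<le> (\<Sum>b\<in>L s. exp (- \<gamma>\<^sup>2 * (K * s) / 2))"
    proof (rule sum_mono)
      fix b assume b: "b \<in> L s"
      have "inversions \<kappa> b \<subseteq> {(x, y). x < n \<and> y < n \<and> \<kappa> x < \<kappa> y}"
        using b inversions_subset[of \<kappa> b] by (auto simp: L_def inversions_def)
      then show "measure_pmf.prob D (E (inversions \<kappa> b)) \<le> exp (- \<gamma>\<^sup>2 * (K * s) / 2)"
        using b prob_E[of "inversions \<kappa> b" "K * s"] by (simp add: L_def)
    qed
    also have "\<dots> = card (L s) * exp (- \<gamma>\<^sup>2 * K / 2) ^ s"
      by (simp add: exp_of_nat_mult[symmetric] algebra_simps)
    \<comment> \<open>Each of the \<open>s\<close> entries costs a factor \<open>n\<close> and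
      leaves \<open>n ^ (B + 3)\<close> in the denominator. The worst case is then
      \<open>s = 1\<close>, and summing over \<open>s\<close> costs one more factor
      \<open>n\<close>.\<close>
    also have "\<dots> \<le> real n ^ s * (1 / real n ^ (B + 4)) ^ s"
      using cardL[of s] K(1) by (intro mult_mono power_mono) (simp_all flip: of_nat_power)
    also have "\<dots> = (1 / real n ^ (B + 3)) ^ s"
    proof -
      have "real n * (1 / real n ^ (B + 4)) = 1 / real n ^ (B + 3)"
        using n by (simp add: power_add field_simps eval_nat_numeral)
      then show ?thesis by (simp only: power_mult_distrib[symmetric])
    qed
    also have "\<dots> \<le> (1 / real n ^ (B + 3)) ^ 1"
      using n that by (intro power_decreasing) auto
    finally show ?thesis by simp
  qed
  have "measure_pmf.prob D (\<Union>s\<in>{1..n}. \<Union>b\<in>L s. E (inversions \<kappa> b)) \<le>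
    (\<Sum>s\<in>{1..n}. measure_pmf.prob D (\<Union>b\<in>L s. E (inversions \<kappa> b)))"
    by (intro measure_pmf.finite_measure_subadditive_finite) auto
  also have "\<dots> \<le> (\<Sum>s\<in>{1..n}. 1 / real n ^ (B + 3))" by (rule sum_mono) (rule prob_L)
  also have "\<dots> = 1 / real n ^ (B + 2)" using n by (simp add: power_add field_simps power2_eq_square power3_eq_cube)
  finally have 1: "measure_pmf.prob D (\<Union>s\<in>{1..n}. \<Union>b\<in>L s. E (inversions \<kappa> b)) \<le> 1 / real n ^ (B + 2)" .
  have tri: "measure_pmf.prob D (\<Union>t\<in>T k. E (H t)) \<le> 1 / real n ^ (B + 3)"
    if "\<And>t. t \<in> T k \<Longrightarrow> H t \<subseteq> {(x, y). x < n \<and> y < n \<and> \<kappa> x < \<kappa> y} \<and> W0 \<le> card (H t)" for k H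
  proof -
    have "measure_pmf.prob D (\<Union>t\<in>T k. E (H t)) \<le> (\<Sum>t\<in>T k. measure_pmf.prob D (E (H t)))"
      using finT by (intro measure_pmf.finite_measure_subadditive_finite) auto
    also have "\<dots> \<le> (\<Sum>t\<in>T k. exp (- \<gamma>\<^sup>2 * W0 / 2))" using that by (intro sum_mono prob_E) auto
    also have "\<dots> = real (card (T k)) * exp (- \<gamma>\<^sup>2 * W0 / 2)" by simp
    also have "\<dots> \<le> real n ^ 3 * (1 / real n ^ (B + 6))" using cardT W0 by (intro mult_mono) auto
    also have "\<dots> = 1 / real n ^ (B + 3)" using n by (simp add: power_add field_simps eval_nat_numeral)
    finally show ?thesis .
  qed
  have 2: "measure_pmf.prob D (\<Union>t\<in>T \<kappa>. E (F t)) \<le> 1 / real n ^ (B + 3)"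
  proof (rule tri)
    fix t assume t: "t \<in> T \<kappa>"
    obtain i x W where [simp]: "t = (i, x, W)" by (cases t)
    have *: "i \<le> n" "x < i" "W0 \<le> W" "rank_in \<kappa> {..<i} x + W < i" using t by (auto simp: T_def)
    then have "card (F t) = W"
      using card_successors[OF _ inj(1), of i x W] by (simp add: F_def card_image inj_on_def)
    moreover have "F t \<subseteq> {(x, y). x < n \<and> y < n \<and> \<kappa> x < \<kappa> y}"
      using *(1,2) rank_in_mono_iff[OF finite_lessThan inj(1), of x i] by (auto simp: F_def successors_def)
    ultimately show "F t \<subseteq> {(x, y). x < n \<and> y < n \<and> \<kappa> x < \<kappa> y} \<and> W0 \<le> card (F t)" using * by simp
  qed
  have 3: "measure_pmf.prob D (\<Union>t\<in>T (\<lambda>x. - \<kappa> x). E (G t)) \<le> 1 / real n ^ (B + 3)"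
  proof (rule tri)
    fix t assume t: "t \<in> T (\<lambda>x. - \<kappa> x)"
    obtain i x W where [simp]: "t = (i, x, W)" by (cases t)
    have *: "i \<le> n" "x < i" "W0 \<le> W" "rank_in (\<lambda>x. - \<kappa> x) {..<i} x + W < i" using t by (auto simp: T_def)
    then have "card (G t) = W"
      using card_successors[OF _ inj(2), of i x W] by (simp add: G_def card_image inj_on_def)
    moreover have "G t \<subseteq> {(x, y). x < n \<and> y < n \<and> \<kappa> x < \<kappa> y}"
      using *(1,2) rank_in_mono_iff[OF finite_lessThan inj(2), of x i] by (auto simp: G_def successors_def)
    ultimately show "G t \<subseteq> {(x, y). x < n \<and> y < n \<and> \<kappa> x < \<kappa> y} \<and> W0 \<le> card (G t)" using * by simp
  qed
  have "measure_pmf.prob D ?bad \<le> measure_pmf.prob D ((\<Union>s\<in>{1..n}. \<Union>b\<in>L s. E (inversions \<kappa> b)) \<union>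
      ((\<Union>t\<in>T \<kappa>. E (F t)) \<union> (\<Union>t\<in>T (\<lambda>x. - \<kappa> x). E (G t))))"
    by (intro measure_pmf.finite_measure_mono sub) auto
  also have "\<dots> \<le> 1 / real n ^ (B + 2) + (1 / real n ^ (B + 3) + 1 / real n ^ (B + 3))"
    using 1 2 3 by (intro order_trans[OF measure_Un_le] add_mono) auto
  also have "\<dots> \<le> 1 / real n ^ (B + 2) + 1 / real n ^ (B + 2)"
    using n by (simp add: power_add field_simps eval_nat_numeral)
  also have "\<dots> \<le> 1 / real n ^ (B + 1)"
    using n by (simp add: power_add field_simps eval_nat_numeral)
  also have "\<dots> \<le> 1 / real n ^ B"
    using n by (simp add: field_simps)
  finally show ?thesis .
qed

section \<open>Rankings and orders\<close>

definition outcome_matrix :: "nat \<Rightarrow> outcome \<Rightarrow> bool list list" where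
  "outcome_matrix n q = map (\<lambda>i. map (\<lambda>j. i \<noteq> j \<and> q i j = 1) [1..<Suc n]) [1..<Suc n]"

lemma beats_outcome_matrix:
  "u < n \<Longrightarrow> y < n \<Longrightarrow> beats (outcome_matrix n q) u y \<longleftrightarrow> u \<noteq> y \<and> q (Suc u) (Suc y) = 1"
  by (simp add: beats_def outcome_matrix_def hd0_drop del: upt_Suc)

lemma nswr_input_enc:
  "nswr_input \<gamma> \<beta> n q = enc (nat \<lceil>1 / \<gamma>\<rceil>, nat \<lceil>\<beta>\<rceil>, n, outcome_matrix n q, ())"
  unfolding nswr_input_def outcome_sexp_def outcome_matrix_def
  by (simp add: list_sexp_def enc_list_def enc_nat_def enc_bool_def o_def del: upt_Suc)

lemma tournament_beats:
  assumes "comparison_outcome n q"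
  shows "tournament (beats (outcome_matrix n q)) {..<n}"
  unfolding tournament_def
proof (intro ballI impI)
  fix x y assume xy: "x \<in> {..<n}" "y \<in> {..<n}" "x \<noteq> y"
  then have "Suc x \<in> {1..n}" "Suc y \<in> {1..n}" "Suc x \<noteq> Suc y" by auto
  with assms have "q (Suc x) (Suc y) \<in> {1, -1}" "q (Suc y) (Suc x) = - q (Suc x) (Suc y)"
    unfolding comparison_outcome_def by blast+
  with xy show "beats (outcome_matrix n q) x y \<noteq> beats (outcome_matrix n q) y x"
    by (auto simp: beats_outcome_matrix)
qed

lemma tournament_subset: "tournament R V \<Longrightarrow> U \<subseteq> V \<Longrightarrow> tournament R U"
  unfolding tournament_def by blast

lemma agreement_True: "length z = length z' \<Longrightarrow> agreement (\<lambda>_ _. True) z = agreement (\<lambda>_ _. True) z'"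
  by (induction z z' rule: list_induct2) auto

text \<open>A pair contributes 1 or -1, so the score is twice the number of agreements minus the
  number of pairs. The latter is written as the agreement with a relation that always holds; it is
  the same for all rankings, so maximizing the score and maximizing the agreement are
  equivalent.\<close>

lemma score_eq:
  assumes q: "comparison_outcome n q" and z: "distinct z" "set z = {..<n}"
    and before: "before z = {(u, y). u < n \<and> y < n \<and> \<tau> (Suc y) < (\<tau> (Suc u) :: nat)}"
  shows "score n q \<tau> = 2 * int (agreement (beats (outcome_matrix n q)) z) - int (agreement (\<lambda>_ _. True) [0..<n])"
proof -
  let ?R = "beats (outcome_matrix n q)" and ?S = "\<lambda>(x, y). (Suc x, Suc y)"
  have inj: "inj_on ?S (before z)" by (auto simp: inj_on_def)
  have "{(i, j) \<in> {1..n} \<times> {1..n}. \<tau> j < \<tau> i} = ?S ` before z"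
  proof -
    have "(i, j) \<in> ?S ` before z" if "i \<in> {1..n}" "j \<in> {1..n}" "\<tau> j < \<tau> i" for i j
      using that unfolding before by (intro image_eqI[of _ _ "(i - 1, j - 1)"]) auto
    then show ?thesis by (auto simp: before)
  qed
  then have "score n q \<tau> = (\<Sum>p\<in>before z. case ?S p of (i, j) \<Rightarrow> q i j)"
    unfolding score_def by (simp add: sum.reindex[OF inj])
  also have "\<dots> = sum (pair_sign ?R) (before z)"
  proof (rule sum.cong)
    fix p assume p: "p \<in> before z"
    obtain u y where [simp]: "p = (u, y)" by (cases p)
    have uy: "u < n" "y < n" "u \<noteq> y" using p by (auto simp: before)
    then have "Suc u \<in> {1..n}" "Suc y \<in> {1..n}" "Suc u \<noteq> Suc y" by auto
    then have "q (Suc u) (Suc y) \<in> {1, -1}" using q unfolding comparison_outcome_def by blast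
    with uy show "(case ?S p of (i, j) \<Rightarrow> q i j) = pair_sign ?R p" by (auto simp: pair_sign_def beats_outcome_matrix)
  qed simp
  also have "\<dots> = 2 * int (card {p \<in> before z. ?R (fst p) (snd p)}) - int (card (before z))"
  proof -
    have "before z = {p \<in> before z. ?R (fst p) (snd p)} \<union> {p \<in> before z. \<not> ?R (fst p) (snd p)}" by auto
    then have "card (before z) = card ({p \<in> before z. ?R (fst p) (snd p)} \<union> {p \<in> before z. \<not> ?R (fst p) (snd p)})"
      by (rule arg_cong)
    also have "\<dots> = card {p \<in> before z. ?R (fst p) (snd p)} + card {p \<in> before z. \<not> ?R (fst p) (snd p)}"
      by (rule card_Un_disjoint) auto
    finally show ?thesis by (simp add: sum_pair_sign)
  qed
  also have "card (before z) = agreement (\<lambda>_ _. True) z" using agreement_card[OF z(1), of "\<lambda>_ _. True"] by simp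
  also have "\<dots> = agreement (\<lambda>_ _. True) [0..<n]"
    using distinct_card[OF z(1)] by (intro agreement_True) (simp add: z(2))
  finally show ?thesis by (simp add: agreement_card[OF z(1)])
qed

lemma order_of_ranking:
  assumes "\<tau> permutes {1..n}"
  shows "\<exists>z. distinct z \<and> set z = {..<n} \<and> before z = {(u, y). u < n \<and> y < n \<and> \<tau> (Suc y) < \<tau> (Suc u)}"
proof -
  let ?k = "\<lambda>u. - int (\<tau> (Suc u))"
  have "inj_on ?k (set [0..<n])" using permutes_inj[OF assms] by (auto simp: inj_on_def inj_def)
  from before_sort_key[OF distinct_upt this] show ?thesis
    by (intro exI[of _ "sort_key ?k [0..<n]"]) auto
qed

section \<open>From orders back to rankings\<close>

lemma position_snoc:
  "position i (\<sigma> @ [u]) = (if 0 < position i \<sigma> \<or> u = i then Suc (position i \<sigma>) else position i \<sigma>)"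
  by (simp add: position_def)

lemma position_notin: "i \<notin> set \<sigma> \<Longrightarrow> position i \<sigma> = 0"
proof (induction \<sigma> rule: rev_induct)
  case Nil
  show ?case by (simp add: position_def)
qed (auto simp: position_snoc)

lemma position_nth: "distinct \<sigma> \<Longrightarrow> k < length \<sigma> \<Longrightarrow> position (\<sigma> ! k) \<sigma> = length \<sigma> - k"
proof (induction \<sigma> rule: rev_induct)
  case (snoc u \<sigma>)
  then show ?case
    by (cases "k < length \<sigma>") (auto simp: position_snoc nth_append position_notin less_Suc_eq)
qed simp

lemma ranking_of_order:
  assumes \<sigma>: "distinct \<sigma>" "set \<sigma> = {..<n}"
  shows "\<exists>\<rho>. \<rho> permutes {1..n} \<and> enc (positions n \<sigma>) = ranking_sexp n \<rho> \<and>
    before \<sigma> = {(u, y). u < n \<and> y < n \<and> \<rho> (Suc y) < \<rho> (Suc u)}"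
proof -
  \<comment> \<open>Outside \<open>{1..n}\<close> this is the identity, as \<open>permutes\<close>
    demands; inside, numbering shifts by one.\<close>
  define \<rho> where "\<rho> i = (if i \<in> {1..n} then position (i - 1) \<sigma> else i)" for i
  have len: "length \<sigma> = n" using distinct_card[OF \<sigma>(1)] by (simp add: \<sigma>(2))
  have idx: "\<exists>k<n. \<sigma> ! k = u" if "u < n" for u
    using that \<sigma>(2) len by (metis in_set_conv_nth lessThan_iff)
  have \<rho>: "\<rho> (Suc (\<sigma> ! k)) = n - k" if "k < n" for k
  proof -
    have "\<sigma> ! k < n" using nth_mem[of k \<sigma>] that by (simp add: len \<sigma>(2))
    with that show ?thesis using position_nth[OF \<sigma>(1), of k] by (simp add: \<rho>_def len)
  qed
  have "\<rho> ` {1..n} = {1..n}"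
  proof -
    have "\<rho> i \<in> {1..n}" if "i \<in> {1..n}" for i
    proof -
      have "i - 1 < n" using that unfolding atLeastAtMost_iff by linarith
      from idx[OF this] obtain k where "k < n" "\<sigma> ! k = i - 1" by blast
      with \<rho>[of k] that show ?thesis by simp
    qed
    moreover have "j \<in> \<rho> ` {1..n}" if j: "j \<in> {1..n}" for j
    proof (rule image_eqI)
      show "j = \<rho> (Suc (\<sigma> ! (n - j)))" using \<rho>[of "n - j"] j by simp
      have "\<sigma> ! (n - j) < n" using nth_mem[of "n - j" \<sigma>] j by (simp add: len \<sigma>(2))
      then show "Suc (\<sigma> ! (n - j)) \<in> {1..n}" by simp
    qed
    ultimately show ?thesis by blast
  qed
  then have "bij_betw \<rho> {1..n} {1..n}"
    unfolding bij_betw_def by (intro conjI eq_card_imp_inj_on) simp_all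
  then have "\<rho> permutes {1..n}" by (rule bij_imp_permutes) (auto simp: \<rho>_def)
  moreover have "enc (positions n \<sigma>) = ranking_sexp n \<rho>"
  proof -
    have "map (\<lambda>i. nat_sexp (\<rho> i)) [1..<Suc n] = map (\<lambda>i. nat_sexp (position i \<sigma>)) [0..<n]"
      by (rule nth_equalityI) (simp_all add: \<rho>_def del: upt_Suc)
    then show ?thesis
      by (simp add: positions_def ranking_sexp_def enc_list_def enc_nat_def o_def del: upt_Suc)
  qed
  moreover have "(u, y) \<in> before \<sigma> \<longleftrightarrow> u < n \<and> y < n \<and> \<rho> (Suc y) < \<rho> (Suc u)" for u y
  proof (cases "u < n \<and> y < n")
    case True
    with idx obtain k l where kl: "k < n" "\<sigma> ! k = u" "l < n" "\<sigma> ! l = y" by meson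
    then have "(u, y) \<in> before \<sigma> \<longleftrightarrow> k < l" using before_iff_nth[OF \<sigma>(1), of k l] len by simp
    also have "\<dots> \<longleftrightarrow> \<rho> (Suc y) < \<rho> (Suc u)" using \<rho>[of k] \<rho>[of l] kl by auto
    finally show ?thesis using True by simp
  next
    case False
    then show ?thesis using before_subset[of \<sigma>] \<sigma>(2) by auto
  qed
  ultimately show ?thesis by (intro exI[of _ \<rho>]) auto
qed

lemma optimal_ranking_of_order:
  assumes q: "comparison_outcome n q" and \<sigma>: "optimal_order (beats (outcome_matrix n q)) \<sigma>" "set \<sigma> = {..<n}"
  shows "\<exists>\<rho>. optimal_ranking n q \<rho> \<and> enc (positions n \<sigma>) = ranking_sexp n \<rho>"
proof -
  have d: "distinct \<sigma>" using \<sigma>(1) by (simp add: optimal_order_def)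
  from ranking_of_order[OF d \<sigma>(2)] obtain \<rho> where \<rho>: "\<rho> permutes {1..n}"
    "enc (positions n \<sigma>) = ranking_sexp n \<rho>" "before \<sigma> = {(u, y). u < n \<and> y < n \<and> \<rho> (Suc y) < \<rho> (Suc u)}"
    by blast
  have "score n q \<tau> \<le> score n q \<rho>" if \<tau>: "\<tau> permutes {1..n}" for \<tau>
  proof -
    from order_of_ranking[OF \<tau>] obtain z where z: "distinct z" "set z = {..<n}"
      "before z = {(u, y). u < n \<and> y < n \<and> \<tau> (Suc y) < \<tau> (Suc u)}" by blast
    have "agreement (beats (outcome_matrix n q)) z \<le> agreement (beats (outcome_matrix n q)) \<sigma>"
      using \<sigma> z by (simp add: optimal_order_def)
    then show ?thesis using score_eq[OF q z] score_eq[OF q d \<sigma>(2) \<rho>(3)] by simp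
  qed
  with \<rho> show ?thesis unfolding optimal_ranking_def is_arg_max_def by (intro exI[of _ \<rho>]) (auto simp: not_less)
qed

section \<open>The main theorem\<close>

lemma few_inversions_subset: "few_inversions R \<kappa> V K \<Longrightarrow> U \<subseteq> V \<Longrightarrow> few_inversions R \<kappa> U K"
  unfolding few_inversions_def by blast

lemma algorithm_correct:
  fixes \<kappa> :: "nat \<Rightarrow> int"
  assumes q: "comparison_outcome n q" and \<kappa>: "inj_on \<kappa> {..<n}"
    and few: "few_inversions (beats (outcome_matrix n q)) \<kappa> {..<n} K"
    and beats: "\<And>i. i \<le> n \<Longrightarrow> mostly_beats (beats (outcome_matrix n q)) \<kappa> {..<i} \<gamma> (disp_bound a b n)"
      "\<And>i. i \<le> n \<Longrightarrow> mostly_beats (\<lambda>x y. beats (outcome_matrix n q) y x) (\<lambda>x. - \<kappa> x) {..<i} \<gamma> (disp_bound a b n)"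
    and W0: "64 * real K \<le> \<gamma>\<^sup>2 * disp_bound a b n" "0 < disp_bound a b n" "0 < \<gamma>"
  shows "\<exists>\<rho>. optimal_ranking n q \<rho> \<and> enc (algorithm (a, b, n, outcome_matrix n q, ())) = ranking_sexp n \<rho>"
proof -
  let ?M = "outcome_matrix n q" and ?W = "disp_bound a b n"
  have close: "\<forall>j<length z. j < rank_in \<kappa> (set z) (z ! j) + ?W \<and> rank_in \<kappa> (set z) (z ! j) < j + ?W"
    if i: "i \<le> n" "optimal_order (beats ?M) z" "set z = {..<i}" for i z
  proof (intro allI impI, rule max_displacement[OF i(2), where \<kappa> = \<kappa> and \<gamma> = \<gamma> and K = K])
    have sub: "set z \<subseteq> {..<n}" using i by auto
    show "tournament (beats ?M) (set z)" using tournament_beats[OF q] sub by (rule tournament_subset)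
    show "inj_on \<kappa> (set z)" using \<kappa> sub by (rule inj_on_subset)
    show "few_inversions (beats ?M) \<kappa> (set z) K" using few sub by (rule few_inversions_subset)
  qed (use beats[OF i(1)] i(3) W0 in simp_all)
  note * = order_items_optimal[of n ?M \<kappa> ?W, OF close]
  show ?thesis
    using optimal_ranking_of_order[OF q *] by (simp add: algorithm_def)
qed

section \<open>Bounds on the running time\<close>

lemma sz_outcome_matrix: "sz (outcome_matrix n q) \<le> n * (n * 2 + 1)"
proof -
  have "sz (outcome_matrix n q) \<le> length (outcome_matrix n q) * (n * 2 + 1)"
  proof (rule sz_list_le)
    fix r assume "r \<in> set (outcome_matrix n q)"
    then have "length r = n" by (auto simp: outcome_matrix_def)
    then show "sz r \<le> n * 2" using sz_list_le[of r 1] sz_bool_le by simp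
  qed
  then show ?thesis by (simp add: outcome_matrix_def del: upt_Suc)
qed

lemma parameter_bounds:
  fixes \<gamma> \<beta> :: real
  assumes "0 < \<gamma>" "\<gamma> < 1/2" "0 < \<beta>"
  defines "a \<equiv> nat \<lceil>1 / \<gamma>\<rceil>" and "b \<equiv> nat \<lceil>\<beta>\<rceil>"
  shows "1 \<le> a" "1 \<le> \<gamma> * a" "real a ^ 4 \<le> 6 * \<gamma> powr (-4)" "\<beta> \<le> b" "real (b + 1) \<le> 2 * (\<beta> + 1)"
proof -
  have g: "2 < 1 / \<gamma>" using assms(1,2) by (simp add: field_simps)
  have a: "1 / \<gamma> \<le> a" "a \<le> 1 / \<gamma> + 1" unfolding a_def using g by linarith+
  then show "1 \<le> a" using g by linarith
  show "1 \<le> \<gamma> * a" using a(1) assms(1) by (simp add: field_simps)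
  \<comment> \<open>Since \<open>1 / \<gamma>\<close> exceeds 2, rounding up costs at most a factor
    \<open>3/2\<close>, and \<open>(3/2) ^ 4 = 81/16\<close>.\<close>
  have "a \<le> (3/2) * (1 / \<gamma>)" using a(2) g by linarith
  then have "real a ^ 4 \<le> ((3/2) * (1 / \<gamma>)) ^ 4" by (intro power_mono) auto
  also have "\<dots> = (81/16) * \<gamma> powr (-4)"
    using assms(1) by (simp add: powr_minus power_divide divide_simps power_mult_distrib)
  also have "\<dots> \<le> 6 * \<gamma> powr (-4)" by (intro mult_right_mono) auto
  finally show "real a ^ 4 \<le> 6 * \<gamma> powr (-4)" .
  show "\<beta> \<le> b" unfolding b_def by linarith
  have "real b \<le> \<beta> + 1" unfolding b_def using assms(3) by linarith
  with assms(3) show "real (b + 1) \<le> 2 * (\<beta> + 1)" by simp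
qed

text \<open>The exponent of the table size is \<open>2080 = 4 * 520\<close> times the rounded
  parameters and \<open>lg n\<close>. Rounding \<beta>, rounding \<gamma> and bounding
  \<open>lg\<close> cost the factors 2, 6 and 2, which makes 49920. The remaining summands cost a
  factor 4, which is at most \<open>n ^ 2\<close>.\<close>

lemma run_time_bound:
  fixes \<gamma> \<beta> :: real and n :: nat and q :: outcome
  assumes "0 < \<gamma>" "\<gamma> < 1/2" "0 < \<beta>" "2 \<le> n"
  defines "I \<equiv> (nat \<lceil>1 / \<gamma>\<rceil>, nat \<lceil>\<beta>\<rceil>, n, outcome_matrix n q, ())"
  shows "real (2 ^ (2 * window I) + sz I + 2) \<le> n powr (49923 * ((\<beta> + 1) * \<gamma> powr (-4)))"
proof -
  define a b where "a = nat \<lceil>1 / \<gamma>\<rceil>" and "b = nat \<lceil>\<beta>\<rceil>"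
  note pb = parameter_bounds[OF assms(1-3), folded a_def b_def]
  define Z where "Z = (\<beta> + 1) * \<gamma> powr (-4)"
  have "16 \<le> \<gamma> powr (-4)"
  proof -
    have "\<gamma> ^ 4 \<le> (1/2) ^ 4" using assms(1,2) by (intro power_mono) auto
    then show ?thesis using assms(1) by (simp add: powr_minus field_simps)
  qed
  also have "\<dots> \<le> Z" unfolding Z_def using assms(3) by (simp add: algebra_simps)
  finally have Z: "16 \<le> Z" .
  define e where "e = 2 * window I"
  have e: "e = 2080 * (b + 1) * a ^ 4 * lg n" by (simp add: e_def I_def disp_bound_def a_def b_def)
  have lg: "1 \<le> lg n" "lg n \<le> 2 * log 2 n" using lg_bounds[OF assms(4)] by auto
  have "real e = 2080 * (real (b + 1) * real a ^ 4) * real (lg n)" by (simp add: e)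
  also have "\<dots> \<le> 2080 * ((2 * (\<beta> + 1)) * (6 * \<gamma> powr (-4))) * (2 * log 2 n)"
    using pb lg by (intro mult_mono mult_left_mono) auto
  also have "\<dots> = 49920 * Z * log 2 n" by (simp add: Z_def)
  finally have "2 powr real e \<le> 2 powr (log 2 n * (49920 * Z))" by (simp add: mult.commute)
  also have "\<dots> = n powr (49920 * Z)" using assms(4) by (simp add: powr_powr[symmetric])
  finally have 1: "2 ^ e \<le> n powr (49920 * Z)" by (simp add: powr_realpow)
  have "a * 1 * 1 * 1 \<le> a ^ 4 * (b + 1) * lg n * 2080" "1 * b * 1 * 1 \<le> a ^ 4 * (b + 1) * lg n * 2080"
    using pb(1) lg(1) self_le_power[of a 4] by (intro mult_le_mono; simp)+
  then have "a \<le> e" "b \<le> e" unfolding e by (simp_all only: mult_1_right mult_1_left ac_simps)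
  then have "a \<le> 2 ^ e" "b \<le> 2 ^ e" using less_exp[of e] by (meson less_imp_le le_trans)+
  moreover have "sz I = a + b + n + sz (outcome_matrix n q) + 4" by (simp add: I_def a_def b_def)
  moreover have "n + n * (n * 2 + 1) + 6 \<le> n ^ 5"
  proof -
    have "n + n * (n * 2 + 1) + 6 \<le> 8 * (n * n)"
    proof -
      have "n + n * (n * 2 + 1) + 6 = 2 * (n * n) + 2 * n + 6" by (simp add: algebra_simps)
      moreover have "2 * 2 \<le> n * n" "2 * n \<le> n * n"
        using assms(4) by (intro mult_le_mono; simp)+
      ultimately show ?thesis by linarith
    qed
    also have "8 \<le> n * n * n" using mult_le_mono[OF mult_le_mono[OF assms(4,4)] assms(4)] by simp
    finally show ?thesis by (simp add: eval_nat_numeral mult.assoc)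
  qed
  ultimately have "2 ^ e + sz I + 2 \<le> 3 * 2 ^ e + n ^ 5" using sz_outcome_matrix[of n q] by linarith
  then have "real (2 ^ e + sz I + 2) \<le> real (3 * 2 ^ e + n ^ 5)" by (rule of_nat_mono)
  also have "\<dots> = 3 * 2 ^ e + real n powr 5" using assms(4) by (simp add: powr_numeral)
  also have "\<dots> \<le> 3 * n powr (49920 * Z) + n powr (49920 * Z)"
    using 1 Z assms(4) by (intro add_mono mult_left_mono powr_mono) auto
  also have "\<dots> = 2 powr 2 * n powr (49920 * Z)" by simp
  also have "\<dots> \<le> n powr 2 * n powr (49920 * Z)" using assms(4) by (intro mult_right_mono powr_mono2) auto
  also have "\<dots> = n powr (2 + 49920 * Z)" by (simp add: powr_add)
  also have "\<dots> \<le> n powr (49923 * Z)" using assms(4) Z by (intro powr_mono) auto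
  finally show ?thesis by (simp add: e_def Z_def)
qed

section \<open>Bound on the failure probability\<close>

lemma exp_le_inverse_power:
  assumes "0 < n" "real m * ln (real n) \<le> x"
  shows "exp (- x) \<le> 1 / real n ^ m"
proof -
  have "exp (- x) \<le> exp (- (m * ln n))" using assms(2) by simp
  also have "\<dots> = 1 / real n ^ m" using assms(1) by (simp add: exp_minus exp_of_nat_mult inverse_eq_divide)
  finally show ?thesis .
qed

lemma failure_probability:
  assumes \<gamma>: "0 < \<gamma>" "\<gamma> < 1/2" and \<beta>: "0 < \<beta>" and n: "2 \<le> n" and \<pi>: "\<pi> permutes {1..n}"
    and D: "noisy_sorting_model n \<gamma> \<pi> D"
  shows "measure_pmf.prob D {q. \<not> (\<exists>\<rho>. optimal_ranking n q \<rho> \<and>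
     enc (algorithm (nat \<lceil>1 / \<gamma>\<rceil>, nat \<lceil>\<beta>\<rceil>, n, outcome_matrix n q, ())) = ranking_sexp n \<rho>)} \<le> n powr (- \<beta>)"
proof -
  define a b where "a = nat \<lceil>1 / \<gamma>\<rceil>" and "b = nat \<lceil>\<beta>\<rceil>"
  note pb = parameter_bounds[OF \<gamma> \<beta>, folded a_def b_def]
  define \<kappa> where "\<kappa> x = - int (\<pi> (Suc x))" for x
  \<comment> \<open>As \<open>\<gamma> * a\<close> is at least 1, this gives
    \<open>\<gamma>\<^sup>2 * K / 2 \<ge> 4 * (b + 1) * lg n\<close>, which covers the exponent
    \<open>b + 4\<close> of the union bound.\<close>
  define K where "K = 8 * (b + 1) * a\<^sup>2 * lg n"
  let ?W = "disp_bound a b n" and ?R = "\<lambda>q. beats (outcome_matrix n q)"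
  have lg: "1 \<le> lg n" "log 2 n \<le> lg n" using lg_bounds[OF n] by auto
  have ln: "ln n \<le> lg n" 
  proof -
    have "ln (real n) \<le> log 2 n"
      using n ln_2_less_1 by (simp add: log_def field_simps mult_left_le)
    with lg show ?thesis by linarith
  qed
  have ga: "1 \<le> (\<gamma> * a)\<^sup>2" using pb(2) by simp
  have gK: "8 * real (b + 1) * lg n \<le> \<gamma>\<^sup>2 * K"
    using mult_right_mono[OF ga, of "8 * real (b + 1) * lg n"] by (simp add: K_def power_mult_distrib algebra_simps)
  \<comment> \<open>By \<open>520 = 65 * 8\<close> the displacement bound is
    \<open>65 * (a\<^sup>2 * K)\<close>, and \<open>\<gamma> * a \<ge> 1\<close> takes care of
    \<open>a\<^sup>2\<close>.\<close>
  have gW: "65 * real K \<le> \<gamma>\<^sup>2 * ?W"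
  proof -
    have "?W = 65 * (a\<^sup>2 * K)"
    proof -
      have "a ^ 4 = a\<^sup>2 * a\<^sup>2" by (simp flip: power_add)
      then show ?thesis by (simp add: disp_bound_def K_def algebra_simps)
    qed
    then have "\<gamma>\<^sup>2 * ?W = (\<gamma> * a)\<^sup>2 * (65 * real K)"
      by (simp add: power_mult_distrib)
    then show ?thesis using mult_right_mono[OF ga, of "65 * real K"] by simp
  qed
  have K: "8 * (b + 1) * lg n \<le> K"
  proof -
    have "8 * (b + 1) * 1 * lg n \<le> K"
      unfolding K_def using pb(1) by (intro mult_le_mono) auto
    then show ?thesis by simp
  qed
  then have K0: "0 < K" using lg(1) by (intro less_le_trans[OF _ K]) simp
  have W0: "0 < ?W" using pb(1) lg(1) by (simp add: disp_bound_def)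
  have m1: "real (b + 4) * ln n \<le> \<gamma>\<^sup>2 * K / 2"
  proof -
    have "real (b + 4) * ln n \<le> real (4 * (b + 1)) * lg n" using ln n by (intro mult_mono) auto
    with gK show ?thesis by (simp add: algebra_simps)
  qed
  have m2: "real (b + 6) * ln n \<le> \<gamma>\<^sup>2 * ?W / 2"
  proof -
    have "real (b + 6) * ln n \<le> real (8 * (b + 1)) * lg n" using ln n by (intro mult_mono) auto
    also have "\<dots> \<le> real K" using K by (metis of_nat_le_iff of_nat_mult)
    also have "\<dots> \<le> \<gamma>\<^sup>2 * ?W / 2" using gW by simp
    finally show ?thesis .
  qed
  let ?good = "\<lambda>q. few_inversions (?R q) \<kappa> {..<n} K \<and> (\<forall>i\<le>n.
      mostly_beats (?R q) \<kappa> {..<i} \<gamma> ?W \<and> mostly_beats (\<lambda>x y. ?R q y x) (\<lambda>x. - \<kappa> x) {..<i} \<gamma> ?W)"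
  have inj: "inj_on \<kappa> {..<n}" using permutes_inj[OF \<pi>] by (auto simp: \<kappa>_def inj_on_def inj_def)
  have "measure_pmf.prob D {q. \<not> (\<exists>\<rho>. optimal_ranking n q \<rho> \<and>
     enc (algorithm (a, b, n, outcome_matrix n q, ())) = ranking_sexp n \<rho>)} \<le> measure_pmf.prob D {q. \<not> ?good q}"
  proof (rule measure_pmf.finite_measure_mono_AE)
    have "\<exists>\<rho>. optimal_ranking n q \<rho> \<and> enc (algorithm (a, b, n, outcome_matrix n q, ())) = ranking_sexp n \<rho>"
      if "q \<in> set_pmf D" "?good q" for q
    proof (rule algorithm_correct)
      show "comparison_outcome n q" using D that(1) by (simp add: noisy_sorting_model_def)
      show "64 * real K \<le> \<gamma>\<^sup>2 * ?W" using gW by simp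
    qed (use that(2) inj W0 \<gamma> in auto)
    then show "AE q in measure_pmf D. q \<in> {q. \<not> (\<exists>\<rho>. optimal_ranking n q \<rho> \<and>
        enc (algorithm (a, b, n, outcome_matrix n q, ())) = ranking_sexp n \<rho>)} \<longrightarrow> q \<in> {q. \<not> ?good q}"
      by (auto simp: AE_measure_pmf_iff)
  qed simp
  also have "\<dots> \<le> 1 / real n ^ b"
  proof (rule all_good_prob[OF D \<gamma>(1) \<pi> n])
    show "exp (- \<gamma>\<^sup>2 * K / 2) \<le> 1 / real n ^ (b + 4)" using exp_le_inverse_power[OF _ m1] n by simp
    show "exp (- \<gamma>\<^sup>2 * ?W / 2) \<le> 1 / real n ^ (b + 6)" using exp_le_inverse_power[OF _ m2] n by simp
  qed (use K0 in \<open>simp_all add: \<kappa>_def beats_outcome_matrix\<close>)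
  also have "\<dots> = n powr (- real b)" using n by (simp add: powr_minus powr_realpow inverse_eq_divide)
  also have "\<dots> \<le> n powr (- \<beta>)" using n pb(4) by (intro powr_mono) auto
  finally show ?thesis by (simp add: a_def b_def)
qed

theorem theorem1:
  "\<exists>(P :: com) (C :: real). C > 0 \<and>
     (\<forall>(\<gamma> :: real) (\<beta> :: real) (n :: nat) (\<pi> :: nat \<Rightarrow> nat) (D :: outcome pmf).
        0 < \<gamma> \<and> \<gamma> < 1/2 \<and> \<beta> > 0 \<and> n \<ge> 1 \<and> \<pi> permutes {1..n} \<and> noisy_sorting_model n \<gamma> \<pi> D \<longrightarrow>
        measure_pmf.prob
          (nswr_run P (nat \<lfloor>real n powr (C * ((\<beta> + 1) * \<gamma> powr (-4)))\<rfloor>) \<gamma> \<beta> n D)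
          {(q, cfg). \<not> solves_nswr n q cfg}
        \<le> real n powr (- \<beta>))"
proof -
  from fpm_algorithm obtain P T where T: "pb (\<lambda>I. 2 ^ (2 * window I)) T"
    and P: "\<And>I k. exec P (enc I) k (T I) (enc (algorithm I)) k" unfolding fpm_def by blast
  from T obtain d where d: "\<And>I. T I \<le> (2 ^ (2 * window I) + sz I + 2) ^ d" unfolding pb_def by blast
  \<comment> \<open>The polynomial of degree \<open>d\<close> multiplies the exponent of the
    potential; \<open>Suc d\<close> keeps \<open>C\<close> positive if \<open>d\<close> is
    0.\<close>
  define C where "C = 49923 * real (Suc d)"
  show ?thesis
  proof (intro exI conjI allI impI; (elim conjE)?)
    show "0 < C" by (simp add: C_def)
    fix \<gamma> \<beta> :: real and n :: nat and \<pi> :: "nat \<Rightarrow> nat" and D :: "outcome pmf"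
    assume \<gamma>: "0 < \<gamma>" "\<gamma> < 1/2" and \<beta>: "0 < \<beta>" and "1 \<le> n" and \<pi>: "\<pi> permutes {1..n}"
      and D: "noisy_sorting_model n \<gamma> \<pi> D"
    let ?Z = "(\<beta> + 1) * \<gamma> powr (-4)"
    let ?t = "nat \<lfloor>real n powr (C * ?Z)\<rfloor>"
    show "measure_pmf.prob (nswr_run P ?t \<gamma> \<beta> n D) {(q, cfg). \<not> solves_nswr n q cfg} \<le> real n powr (- \<beta>)"
    \<comment> \<open>For \<open>n = 1\<close> both bounds are powers of 1: only one step is
      granted, but a failure probability of 1 is allowed.\<close>
    proof (cases "n = 1")
      case True
      then show ?thesis by simp
    next
      case False
      with \<open>1 \<le> n\<close> have n: "2 \<le> n" by simp
      define I where "I q = (nat \<lceil>1 / \<gamma>\<rceil>, nat \<lceil>\<beta>\<rceil>, n, outcome_matrix n q, ())" for q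
      have "T (I q) \<le> ?t" for q
      proof -
        let ?B = "2 ^ (2 * window (I q)) + sz (I q) + 2"
        have "real (T (I q)) \<le> real (?B ^ Suc d)"
          using d[of "I q"] by (intro of_nat_mono order_trans[OF d] power_increasing) auto
        also have "\<dots> = real ?B ^ Suc d" by (rule of_nat_power)
        also have "\<dots> \<le> (real n powr (49923 * ?Z)) ^ Suc d"
          unfolding I_def by (intro power_mono run_time_bound \<gamma> \<beta> n) simp
        also have "\<dots> = real n powr (49923 * ?Z * real (Suc d))"
          using n by (simp add: powr_realpow[symmetric] powr_powr del: power_Suc of_nat_Suc)
        also have "49923 * ?Z * real (Suc d) = C * ?Z" by (simp only: C_def mult_ac)
        finally show ?thesis by (rule le_nat_floor)
      qed
      then have run: "exec P (enc (I q)) Atom ?t (enc (algorithm (I q))) Atom" for q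
        using P exec_mono by blast
      have "\<exists>s. steps ?t (initial P (nswr_input \<gamma> \<beta> n q)) = return_pmf (Skip, s) \<and> s 0 = enc (algorithm (I q))" for q
      proof -
        let ?s = "(\<lambda>_. Atom)(0 := enc (I q)) :: store"
        have "initial P (nswr_input \<gamma> \<beta> n q) = (P, ?s)"
          by (simp only: initial_def nswr_input_enc I_def)
        moreover have "?s 0 = enc (I q) \<and> ?s 1 = Atom" by simp
        ultimately show ?thesis using run[of q] unfolding exec_def by metis
      qed
      then obtain s where s: "\<And>q. steps ?t (initial P (nswr_input \<gamma> \<beta> n q)) = return_pmf (Skip, s q)"
        "\<And>q. s q 0 = enc (algorithm (I q))" by metis
      \<comment> \<open>As \<open>P\<close> tosses no coins, the joint law is the image of
        \<open>D\<close>, and the failure probability is that of an event about the noise.\<close>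
      have "nswr_run P ?t \<gamma> \<beta> n D = map_pmf (\<lambda>q. (q, Skip, s q)) D"
        unfolding nswr_run_def s(1) by (simp add: map_pmf_def bind_return_pmf)
      then have "measure_pmf.prob (nswr_run P ?t \<gamma> \<beta> n D) {(q, cfg). \<not> solves_nswr n q cfg} =
          measure_pmf.prob D {q. \<not> (\<exists>\<rho>. optimal_ranking n q \<rho> \<and> enc (algorithm (I q)) = ranking_sexp n \<rho>)}"
        by (simp add: vimage_def solves_nswr_def halts_with_def s(2))
      also have "\<dots> \<le> real n powr (- \<beta>)"
        unfolding I_def by (rule failure_probability[OF \<gamma> \<beta> n \<pi> D])
      finally show ?thesis .
    qed
  qed
qed

end
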